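(* Let $k$ be an algebraically closed field and let $\mathcal{C}$ be a $k$-linear Hom-finite, 2-Calabi--Yau triangulated category with split idempotents and with a cluster-tilting object $T$. Let $\Lambda=\operatorname{End}_{\mathcal{C}}(T)$. Then the antisymmetric bilinear form $\langle\ ,\ \rangle_a$ on $K_0^{\mathrm{sp}}(\operatorname{mod}\Lambda)$ descends to the Grothendieck group $K_0(\operatorname{mod}\Lambda)$, i.e. $\langle N,N'\rangle_a$ depends only on the classes of $N$ and $N'$ in $K_0(\operatorname{mod}\Lambda)$.
   Context: $\Sigma$ is the suspension functor of $\mathcal{C}$ and $D=\operatorname{Hom}_k(?,k)$. Hom-finite: all spaces $\mathcal{C}(X,Y)$ are finite-dimensional. 2-Calabi--Yau: there are bifunctorial isomorphisms $\mathcal{C}(X,\Sigma Y)\simeq D\mathcal{C}(Y,\Sigma X)$. Cluster-tilting: $\mathcal{C}(T,\Sigma T)=0$, and any $X$ with $\mathcal{C}(X,\Sigma T)=0$ belongs to $\operatorname{add}T$, the full subcategory of direct summands of finite direct sums of copies of $T$. $\operatorname{mod}\Lambda$ is the category of finite-dimensional right $\Lambda$-modules. $K_0^{\mathrm{sp}}(\operatorname{mod}\Lambda)$ is the split Grothendieck group: the free abelian group on isoclasses $[N]$ of finite-dimensional modules modulo the relations $[N_1\oplus N_2]=[N_1]+[N_2]$. On it, bilinear forms are defined by $\langle N,N'\rangle=\dim\operatorname{Hom}_\Lambda(N,N')-\dim\operatorname{Ext}^1_\Lambda(N,N')$ and $\langle N,N'\rangle_a=\langle N,N'\rangle-\langle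 N',N\rangle$. $K_0(\operatorname{mod}\Lambda)$ is the usual Grothendieck group of the abelian category $\operatorname{mod}\Lambda$. It is known that $F=\mathcal{C}(T,?)$ induces an equivalence $\mathcal{C}/(\Sigma T)\simeq\operatorname{mod}\Lambda$, where $(\Sigma T)$ is the ideal of morphisms factoring through an object of $\operatorname{add}\Sigma T$. *)

theory Defs
  imports
    "HOL-Computational_Algebra.Polynomial"
    "HOL-Library.Function_Algebras"
    "HOL-Algebra.Free_Abelian_Groups"
begin

section \<open>Linear algebra on subspaces\<close>

definition fd_subspace :: "('k::field \<Rightarrow> 'v::ab_group_add \<Rightarrow> 'v) \<Rightarrow> 'v set \<Rightarrow> bool" where
  "fd_subspace s V \<longleftrightarrow> Modules.module.subspace s V \<and> (\<exists>B. finite B \<and> V \<subseteq> Modules.module.span s B)"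

definition linear_on ::
  "('k::field \<Rightarrow> 'v::ab_group_add \<Rightarrow> 'v) \<Rightarrow> ('k \<Rightarrow> 'w::ab_group_add \<Rightarrow> 'w) \<Rightarrow> 'v set \<Rightarrow> ('v \<Rightarrow> 'w) \<Rightarrow> bool" where
  "linear_on s t V f \<longleftrightarrow>
     (\<forall>x\<in>V. \<forall>y\<in>V. f (x + y) = f x + f y) \<and> (\<forall>c. \<forall>x\<in>V. f (s c x) = t c (f x))"

definition fun_scale :: "('k \<Rightarrow> 'v \<Rightarrow> 'v) \<Rightarrow> 'k \<Rightarrow> ('a \<Rightarrow> 'v) \<Rightarrow> 'a \<Rightarrow> 'v" where
  "fun_scale s c f = (\<lambda>x. s c (f x))"

lemma vector_space_fun_scale: "vector_space s \<Longrightarrow> vector_space (fun_scale s)"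
  by (simp add: vector_space_def fun_scale_def plus_fun_def)

abbreviation vscale :: "'k::field \<Rightarrow> (nat \<Rightarrow> 'k) \<Rightarrow> nat \<Rightarrow> 'k" where
  "vscale \<equiv> fun_scale (*)"

lemma vector_space_vscale: "vector_space vscale"
  by (rule vector_space_fun_scale) (unfold_locales, simp_all add: algebra_simps)

text \<open>The dual of a subspace \<open>V\<close>; the value 0 outside \<open>V\<close> makes functionals on \<open>V\<close> unique as functions.\<close>

definition dual_space :: "('k::field \<Rightarrow> 'v::ab_group_add \<Rightarrow> 'v) \<Rightarrow> 'v set \<Rightarrow> ('v \<Rightarrow> 'k) set" where
  "dual_space s V = {\<xi>. linear_on s (*) V \<xi> \<and> (\<forall>x. x \<notin> V \<longrightarrow> \<xi> x = 0)}"


section \<open>Linear categories\<close>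

text \<open>
  The objects are the elements of the type \<open>'o\<close>. All spaces of morphisms are subspaces of a single
  ambient vector space \<open>'m\<close>, for example the direct sum of all of them; so all zero
  morphisms are the vector 0, and composition needs no object indices.
  The composite \<open>g \<cdot>\<^bsub>C\<^esub> f\<close> is ``first \<open>f\<close>, then \<open>g\<close>''.
\<close>

record ('k, 'o, 'm) lin_cat =
  Scale :: "'k \<Rightarrow> 'm \<Rightarrow> 'm"
  Hom :: "'o \<Rightarrow> 'o \<Rightarrow> 'm set"
  Comp :: "'m \<Rightarrow> 'm \<Rightarrow> 'm" (infixl \<open>\<cdot>\<index>\<close> 70)
  Id :: "'o \<Rightarrow> 'm"

locale linear_category =
  fixes C :: "('k::field, 'o, 'm::ab_group_add, 'z) lin_cat_scheme" (structure)
  assumes vector_space_mor: "vector_space (Scale C)"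
    and subspace_Hom: "Modules.module.subspace (Scale C) (Hom C X Y)"
    and Comp_closed: "f \<in> Hom C X Y \<Longrightarrow> g \<in> Hom C Y Z \<Longrightarrow> g \<cdot> f \<in> Hom C X Z"
    and Comp_assoc:
      "f \<in> Hom C W X \<Longrightarrow> g \<in> Hom C X Y \<Longrightarrow> h \<in> Hom C Y Z \<Longrightarrow> (h \<cdot> g) \<cdot> f = h \<cdot> (g \<cdot> f)"
    and Id_closed: "Id C X \<in> Hom C X X"
    and Comp_Id: "f \<in> Hom C X Y \<Longrightarrow> f \<cdot> Id C X = f"
    and Id_Comp: "f \<in> Hom C X Y \<Longrightarrow> Id C Y \<cdot> f = f"
    and linear_Comp_left: "f \<in> Hom C X Y \<Longrightarrow> linear_on (Scale C) (Scale C) (Hom C Y Z) (\<lambda>g. g \<cdot> f)"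
    and linear_Comp_right: "g \<in> Hom C Y Z \<Longrightarrow> linear_on (Scale C) (Scale C) (Hom C X Y) (\<lambda>f. g \<cdot> f)"

definition zero_object :: "('k, 'o, 'm::ab_group_add, 'z) lin_cat_scheme \<Rightarrow> 'o \<Rightarrow> bool" where
  "zero_object C Z \<longleftrightarrow> (\<forall>X. Hom C X Z = {0} \<and> Hom C Z X = {0})"

definition iso_mor :: "('k, 'o, 'm, 'z) lin_cat_scheme \<Rightarrow> 'o \<Rightarrow> 'o \<Rightarrow> 'm \<Rightarrow> bool" where
  "iso_mor C X Y f \<longleftrightarrow> f \<in> Hom C X Y \<and> (\<exists>g\<in>Hom C Y X. g \<cdot>\<^bsub>C\<^esub> f = Id C X \<and> f \<cdot>\<^bsub>C\<^esub> g = Id C Y)"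

definition is_direct_sum ::
  "('k, 'o, 'm::ab_group_add, 'z) lin_cat_scheme \<Rightarrow> nat \<Rightarrow> (nat \<Rightarrow> 'o) \<Rightarrow> 'o \<Rightarrow> bool" where
  "is_direct_sum C n X Z \<longleftrightarrow> (\<exists>\<iota> \<pi>.
     (\<forall>i<n. \<iota> i \<in> Hom C (X i) Z \<and> \<pi> i \<in> Hom C Z (X i)) \<and>
     (\<forall>i<n. \<forall>j<n. \<pi> i \<cdot>\<^bsub>C\<^esub> \<iota> j = (if i = j then Id C (X i) else 0)) \<and>
     (\<Sum>i<n. \<iota> i \<cdot>\<^bsub>C\<^esub> \<pi> i) = Id C Z)"

definition is_biproduct :: "('k, 'o, 'm::ab_group_add, 'z) lin_cat_scheme \<Rightarrow> 'o \<Rightarrow> 'o \<Rightarrow> 'o \<Rightarrow> bool" where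
  "is_biproduct C X Y Z \<longleftrightarrow> is_direct_sum C 2 (\<lambda>i. if i = 0 then X else Y) Z"

definition idempotents_split :: "('k, 'o, 'm, 'z) lin_cat_scheme \<Rightarrow> bool" where
  "idempotents_split C \<longleftrightarrow> (\<forall>X. \<forall>e\<in>Hom C X X. e \<cdot>\<^bsub>C\<^esub> e = e \<longrightarrow>
     (\<exists>Y. \<exists>r\<in>Hom C X Y. \<exists>s\<in>Hom C Y X. s \<cdot>\<^bsub>C\<^esub> r = e \<and> r \<cdot>\<^bsub>C\<^esub> s = Id C Y))"

definition hom_finite :: "('k::field, 'o, 'm::ab_group_add, 'z) lin_cat_scheme \<Rightarrow> bool" where
  "hom_finite C \<longleftrightarrow> (\<forall>X Y. fd_subspace (Scale C) (Hom C X Y))"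

text \<open>\<open>add T\<close>: direct summands of finite direct sums of copies of \<open>T\<close>.\<close>

definition add_closure :: "('k, 'o, 'm::ab_group_add, 'z) lin_cat_scheme \<Rightarrow> 'o \<Rightarrow> 'o set" where
  "add_closure C T = {X. \<exists>n Y Z. is_direct_sum C n (\<lambda>_. T) Z \<and> is_biproduct C X Y Z}"


section \<open>Triangulated categories\<close>

text \<open>
  \<open>Susp\<close> and \<open>SuspM\<close> are the suspension on objects and on morphisms. \<open>Dist C X Y Z u v w\<close> says that
  \<open>X \<rightarrow> Y \<rightarrow> Z \<rightarrow> \<Sigma>X\<close>, with the maps \<open>u\<close>, \<open>v\<close>, \<open>w\<close>, is a distinguished triangle.
\<close>

record ('k, 'o, 'm) tri_cat = "('k, 'o, 'm) lin_cat" +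
  Susp :: "'o \<Rightarrow> 'o"
  SuspM :: "'m \<Rightarrow> 'm"
  Dist :: "'o \<Rightarrow> 'o \<Rightarrow> 'o \<Rightarrow> 'm \<Rightarrow> 'm \<Rightarrow> 'm \<Rightarrow> bool"

text \<open>The suspension is a linear autoequivalence, not necessarily an automorphism.\<close>

locale triangulated_category = linear_category C
  for C :: "('k::field, 'o, 'm::ab_group_add) tri_cat" (structure) +
  assumes ex_zero_object: "\<exists>Z. zero_object C Z"
    and ex_biproduct: "\<exists>Z. is_biproduct C X Y Z"
    and SuspM_Id: "SuspM C (Id C X) = Id C (Susp C X)"
    and SuspM_Comp: "f \<in> Hom C X Y \<Longrightarrow> g \<in> Hom C Y Z \<Longrightarrow> SuspM C (g \<cdot> f) = SuspM C g \<cdot> SuspM C f"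
    and linear_SuspM: "linear_on (Scale C) (Scale C) (Hom C X Y) (SuspM C)"
    and bij_SuspM: "bij_betw (SuspM C) (Hom C X Y) (Hom C (Susp C X) (Susp C Y))"
    and Susp_ess_surj: "\<exists>Y f. iso_mor C (Susp C Y) X f"
    and Dist_Hom:
      "Dist C X Y Z u v w \<Longrightarrow> u \<in> Hom C X Y \<and> v \<in> Hom C Y Z \<and> w \<in> Hom C Z (Susp C X)"
    and Dist_iso:
      "Dist C X Y Z u v w \<Longrightarrow> iso_mor C X X' a \<Longrightarrow> iso_mor C Y Y' b \<Longrightarrow> iso_mor C Z Z' c \<Longrightarrow>
       u' \<in> Hom C X' Y' \<Longrightarrow> v' \<in> Hom C Y' Z' \<Longrightarrow> w' \<in> Hom C Z' (Susp C X') \<Longrightarrow>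
       u' \<cdot> a = b \<cdot> u \<Longrightarrow> v' \<cdot> b = c \<cdot> v \<Longrightarrow> w' \<cdot> c = SuspM C a \<cdot> w \<Longrightarrow>
       Dist C X' Y' Z' u' v' w'"
    and Dist_Id: "zero_object C Z \<Longrightarrow> Dist C X X Z (Id C X) 0 0"
    and Dist_cone: "u \<in> Hom C X Y \<Longrightarrow> \<exists>Z v w. Dist C X Y Z u v w"
    and Dist_rotate:
      "u \<in> Hom C X Y \<Longrightarrow> v \<in> Hom C Y Z \<Longrightarrow> w \<in> Hom C Z (Susp C X) \<Longrightarrow>
       Dist C X Y Z u v w \<longleftrightarrow> Dist C Y Z (Susp C X) v w (- SuspM C u)"
    and Dist_morphism:
      "Dist C X Y Z u v w \<Longrightarrow> Dist C X' Y' Z' u' v' w' \<Longrightarrow>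
       a \<in> Hom C X X' \<Longrightarrow> b \<in> Hom C Y Y' \<Longrightarrow> u' \<cdot> a = b \<cdot> u \<Longrightarrow>
       \<exists>c\<in>Hom C Z Z'. v' \<cdot> b = c \<cdot> v \<and> w' \<cdot> c = SuspM C a \<cdot> w"
    and octahedral:
      "Dist C X Y Z' u j k \<Longrightarrow> Dist C Y Z X' v l i \<Longrightarrow> Dist C X Z Y' (v \<cdot> u) m n \<Longrightarrow>
       \<exists>f g. Dist C Z' Y' X' f g (SuspM C j \<cdot> i) \<and>
         f \<cdot> j = m \<cdot> v \<and> n \<cdot> f = k \<and> g \<cdot> m = l \<and> i \<cdot> g = SuspM C u \<cdot> n"

text \<open>Linear isomorphisms \<open>C(X, \<Sigma>Y) \<simeq> D C(Y, \<Sigma>X)\<close>, natural in \<open>X\<close> and in \<open>Y\<close>.\<close>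

definition two_calabi_yau :: "('k::field, 'o, 'm::ab_group_add) tri_cat \<Rightarrow> bool" where
  "two_calabi_yau C \<longleftrightarrow> (\<exists>\<phi> :: 'o \<Rightarrow> 'o \<Rightarrow> 'm \<Rightarrow> 'm \<Rightarrow> 'k.
     (\<forall>X Y. bij_betw (\<phi> X Y) (Hom C X (Susp C Y)) (dual_space (Scale C) (Hom C Y (Susp C X))) \<and>
            linear_on (Scale C) (fun_scale (*)) (Hom C X (Susp C Y)) (\<phi> X Y)) \<and>
     (\<forall>X X' Y. \<forall>a\<in>Hom C X' X. \<forall>f\<in>Hom C X (Susp C Y). \<forall>g\<in>Hom C Y (Susp C X').
        \<phi> X' Y (f \<cdot>\<^bsub>C\<^esub> a) g = \<phi> X Y f (SuspM C a \<cdot>\<^bsub>C\<^esub> g)) \<and>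
     (\<forall>X Y Y'. \<forall>b\<in>Hom C Y Y'. \<forall>f\<in>Hom C X (Susp C Y). \<forall>g\<in>Hom C Y' (Susp C X).
        \<phi> X Y' (SuspM C b \<cdot>\<^bsub>C\<^esub> f) g = \<phi> X Y f (g \<cdot>\<^bsub>C\<^esub> b)))"

definition cluster_tilting :: "('k, 'o, 'm::ab_group_add) tri_cat \<Rightarrow> 'o \<Rightarrow> bool" where
  "cluster_tilting C T \<longleftrightarrow>
     Hom C T (Susp C T) = {0} \<and> (\<forall>X. Hom C X (Susp C T) = {0} \<longrightarrow> X \<in> add_closure C T)"


section \<open>Finite-dimensional right modules over an algebra\<close>

record ('k, 'a) alg =
  alg_carrier :: "'a set"
  alg_scale :: "'k \<Rightarrow> 'a \<Rightarrow> 'a"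
  alg_mult :: "'a \<Rightarrow> 'a \<Rightarrow> 'a"
  alg_one :: 'a

definition End_alg :: "('k, 'o, 'm, 'z) lin_cat_scheme \<Rightarrow> 'o \<Rightarrow> ('k, 'm) alg" where
  "End_alg C T = \<lparr>alg_carrier = Hom C T T, alg_scale = Scale C, alg_mult = Comp C, alg_one = Id C T\<rparr>"

text \<open>
  The underlying spaces of modules are finite-dimensional subspaces of \<open>nat \<Rightarrow> 'k\<close>.
  As \<open>nat \<Rightarrow> 'k\<close> has infinite dimension, every finite-dimensional module is isomorphic to one of these.
\<close>

record ('k, 'a) rmod =
  vecs :: "(nat \<Rightarrow> 'k) set"
  act :: "(nat \<Rightarrow> 'k) \<Rightarrow> 'a \<Rightarrow> nat \<Rightarrow> 'k"

definition fd_modules :: "('k::field, 'a::ab_group_add) alg \<Rightarrow> ('k, 'a) rmod set" where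
  "fd_modules A = {M. fd_subspace vscale (vecs M) \<and>
     (\<forall>x\<in>vecs M. \<forall>a\<in>alg_carrier A. act M x a \<in> vecs M) \<and>
     (\<forall>a\<in>alg_carrier A. linear_on vscale vscale (vecs M) (\<lambda>x. act M x a)) \<and>
     (\<forall>x\<in>vecs M. linear_on (alg_scale A) vscale (alg_carrier A) (act M x)) \<and>
     (\<forall>x\<in>vecs M. act M x (alg_one A) = x) \<and>
     (\<forall>x\<in>vecs M. \<forall>a\<in>alg_carrier A. \<forall>b\<in>alg_carrier A.
        act M (act M x a) b = act M x (alg_mult A a b))}"

text \<open>Homomorphisms are made 0 outside the underlying space, so that they are unique as functions.\<close>

definition mod_hom ::
  "('k::field, 'a) alg \<Rightarrow> ('k, 'a) rmod \<Rightarrow> ('k, 'a) rmod \<Rightarrow> ((nat \<Rightarrow> 'k) \<Rightarrow> nat \<Rightarrow> 'k) set" where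
  "mod_hom A M N = {f. f ` vecs M \<subseteq> vecs N \<and> (\<forall>x. x \<notin> vecs M \<longrightarrow> f x = 0) \<and>
     linear_on vscale vscale (vecs M) f \<and>
     (\<forall>x\<in>vecs M. \<forall>a\<in>alg_carrier A. f (act M x a) = act N (f x) a)}"

abbreviation mor_dim :: "((nat \<Rightarrow> 'k::field) \<Rightarrow> nat \<Rightarrow> 'k) set \<Rightarrow> nat" where
  "mor_dim \<equiv> vector_space.dim (fun_scale vscale)"

definition mod_iso :: "('k::field, 'a) alg \<Rightarrow> ('k, 'a) rmod \<Rightarrow> ('k, 'a) rmod \<Rightarrow> bool" where
  "mod_iso A M N \<longleftrightarrow> (\<exists>f\<in>mod_hom A M N. bij_betw f (vecs M) (vecs N))"

definition mod_direct_sum ::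
  "('k::field, 'a) alg \<Rightarrow> ('k, 'a) rmod \<Rightarrow> ('k, 'a) rmod \<Rightarrow> ('k, 'a) rmod \<Rightarrow> bool" where
  "mod_direct_sum A N1 N2 M \<longleftrightarrow>
     (\<exists>i1\<in>mod_hom A N1 M. \<exists>i2\<in>mod_hom A N2 M. \<exists>p1\<in>mod_hom A M N1. \<exists>p2\<in>mod_hom A M N2.
        (\<forall>x\<in>vecs N1. p1 (i1 x) = x \<and> p2 (i1 x) = 0) \<and>
        (\<forall>x\<in>vecs N2. p2 (i2 x) = x \<and> p1 (i2 x) = 0) \<and>
        (\<forall>x\<in>vecs M. i1 (p1 x) + i2 (p2 x) = x))"

definition short_exact ::
  "('k::field, 'a) alg \<Rightarrow> ('k, 'a) rmod \<Rightarrow> ('k, 'a) rmod \<Rightarrow> ('k, 'a) rmod \<Rightarrow> bool" where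
  "short_exact A L M N \<longleftrightarrow> (\<exists>f\<in>mod_hom A L M. \<exists>g\<in>mod_hom A M N.
     inj_on f (vecs L) \<and> f ` vecs L = {x\<in>vecs M. g x = 0} \<and> g ` vecs M = vecs N)"

definition projective_mod :: "('k::field, 'a::ab_group_add) alg \<Rightarrow> ('k, 'a) rmod \<Rightarrow> bool" where
  "projective_mod A P \<longleftrightarrow> P \<in> fd_modules A \<and>
     (\<forall>M\<in>fd_modules A. \<forall>N\<in>fd_modules A. \<forall>g\<in>mod_hom A M N. \<forall>f\<in>mod_hom A P N.
        g ` vecs M = vecs N \<longrightarrow> (\<exists>h\<in>mod_hom A P M. \<forall>x\<in>vecs P. g (h x) = f x))"

text \<open>An exact sequence \<open>P2 \<rightarrow> P1 \<rightarrow> P0 \<rightarrow> N \<rightarrow> 0\<close>, the beginning of a projective resolution of \<open>N\<close>.\<close>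

definition proj_resolution where
  "proj_resolution A N P0 P1 P2 e d1 d2 \<longleftrightarrow>
     projective_mod A P0 \<and> projective_mod A P1 \<and> projective_mod A P2 \<and>
     e \<in> mod_hom A P0 N \<and> d1 \<in> mod_hom A P1 P0 \<and> d2 \<in> mod_hom A P2 P1 \<and>
     e ` vecs P0 = vecs N \<and>
     d1 ` vecs P1 = {x\<in>vecs P0. e x = 0} \<and>
     d2 ` vecs P2 = {x\<in>vecs P1. d1 x = 0}"

text \<open>
  The dimension of \<open>Ext\<^sup>1(N, N')\<close>, the first cohomology of \<open>Hom(P0, N') \<rightarrow> Hom(P1, N') \<rightarrow> Hom(P2, N')\<close>:
  that of the cocycles minus that of the coboundaries. It does not depend on the resolution.
\<close>

definition ext1_dim ::
  "('k::field, 'a::ab_group_add) alg \<Rightarrow> ('k, 'a) rmod \<Rightarrow> ('k, 'a) rmod \<Rightarrow> nat" where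
  "ext1_dim A N N' = (THE n. \<exists>P0 P1 P2 e d1 d2. proj_resolution A N P0 P1 P2 e d1 d2 \<and>
     n = mor_dim {f\<in>mod_hom A P1 N'. \<forall>x\<in>vecs P2. f (d2 x) = 0}
       - mor_dim ((\<lambda>h. h \<circ> d1) ` mod_hom A P0 N'))"

definition euler_form ::
  "('k::field, 'a::ab_group_add) alg \<Rightarrow> ('k, 'a) rmod \<Rightarrow> ('k, 'a) rmod \<Rightarrow> int" where
  "euler_form A N N' = int (mor_dim (mod_hom A N N')) - int (ext1_dim A N N')"


section \<open>Grothendieck groups\<close>

definition iso_class :: "('k::field, 'a::ab_group_add) alg \<Rightarrow> ('k, 'a) rmod \<Rightarrow> ('k, 'a) rmod set" where
  "iso_class A N = {M\<in>fd_modules A. mod_iso A M N}"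

definition free_on_modules ::
  "('k::field, 'a::ab_group_add) alg \<Rightarrow> (('k, 'a) rmod set \<Rightarrow>\<^sub>0 int) monoid" where
  "free_on_modules A = free_Abelian_group (iso_class A ` fd_modules A)"

definition split_relations ::
  "('k::field, 'a::ab_group_add) alg \<Rightarrow> (('k, 'a) rmod set \<Rightarrow>\<^sub>0 int) set" where
  "split_relations A = generate (free_on_modules A)
     {frag_of (iso_class A M) - frag_of (iso_class A N1) - frag_of (iso_class A N2) | M N1 N2.
        M \<in> fd_modules A \<and> N1 \<in> fd_modules A \<and> N2 \<in> fd_modules A \<and> mod_direct_sum A N1 N2 M}"

definition exact_relations ::
  "('k::field, 'a::ab_group_add) alg \<Rightarrow> (('k, 'a) rmod set \<Rightarrow>\<^sub>0 int) set" where
  "exact_relations A = generate (free_on_modules A)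
     {frag_of (iso_class A M) - frag_of (iso_class A L) - frag_of (iso_class A N) | L M N.
        L \<in> fd_modules A \<and> M \<in> fd_modules A \<and> N \<in> fd_modules A \<and> short_exact A L M N}"

definition K0_split where
  "K0_split A = free_on_modules A Mod split_relations A"

definition K0 where
  "K0 A = free_on_modules A Mod exact_relations A"

definition class_split where
  "class_split A N = split_relations A #>\<^bsub>free_on_modules A\<^esub> frag_of (iso_class A N)"

definition class_K0 where
  "class_K0 A N = exact_relations A #>\<^bsub>free_on_modules A\<^esub> frag_of (iso_class A N)"

text \<open>The canonical surjection \<open>K0_split A \<rightarrow> K0 A\<close>, sending the coset of \<open>c\<close> to the coset of \<open>c\<close>.\<close>

definition split_to_K0 where
  "split_to_K0 A x = the_elem ((\<lambda>c. exact_relations A #>\<^bsub>free_on_modules A\<^esub> c) ` x)"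

definition bilinear_form :: "('g, 'z) monoid_scheme \<Rightarrow> ('g \<Rightarrow> 'g \<Rightarrow> int) \<Rightarrow> bool" where
  "bilinear_form G b \<longleftrightarrow> (\<forall>x\<in>carrier G. \<forall>y\<in>carrier G. \<forall>z\<in>carrier G.
     b (x \<otimes>\<^bsub>G\<^esub> y) z = b x z + b y z \<and> b x (y \<otimes>\<^bsub>G\<^esub> z) = b x y + b x z)"

text \<open>The bilinear form on \<open>K0_split A\<close> with the values \<open>euler_form A N N'\<close> on classes of modules.\<close>

definition split_form where
  "split_form A x y = (THE n. \<exists>b. bilinear_form (K0_split A) b \<and>
     (\<forall>N\<in>fd_modules A. \<forall>N'\<in>fd_modules A.
        b (class_split A N) (class_split A N') = euler_form A N N') \<and> n = b x y)"

definition split_form_a where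
  "split_form_a A x y = split_form A x y - split_form A y x"

end

theory Submission
  imports Defs "HOL-Library.Product_Plus"
begin

text \<open>
  Write \<open>[X, Y]\<close> for the dimension of \<open>\<C>(X, Y)\<close>. Let \<open>N = \<C>(T, X)\<close> and \<open>N' = \<C>(T, Y)\<close>, and choose triangles
  \<open>T\<^sub>1 \<rightarrow> T\<^sub>0 \<rightarrow> X \<rightarrow> \<Sigma>T\<^sub>1\<close> and \<open>X \<rightarrow> \<Sigma>\<^sup>2U\<^sub>0 \<rightarrow> \<Sigma>\<^sup>2U\<^sub>1 \<rightarrow> \<Sigma>X\<close> with all \<open>T\<^sub>i\<close> and \<open>U\<^sub>i\<close> in \<open>add T\<close>.
  Let \<open>K(X, \<Sigma>Y)\<close> and \<open>K'(X, \<Sigma>Y)\<close> be the spaces of maps that vanish on all maps to \<open>X\<close> from \<open>T\<close> and from \<open>\<Sigma>T\<close>.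
  The first triangle yields
  \<open>\<langle>N, N'\<rangle> = [T\<^sub>0, Y] - [T\<^sub>1, Y] + dim K(X, \<Sigma>Y) - dim (K \<inter> K')(X, \<Sigma>Y)\<close>, because
  \<open>Ext\<^sup>1(N, N') = (K \<inter> K')(X, \<Sigma>Y)\<close>. The Calabi-Yau pairing of \<open>K(X, \<Sigma>Y)\<close> with \<open>K'(Y, \<Sigma>X)\<close> has the radicals
  \<open>(K \<inter> K')(X, \<Sigma>Y)\<close> and \<open>(K \<inter> K')(Y, \<Sigma>X)\<close>, and its left rank equals its right rank. The second triangle
  yields \<open>dim Hom(N', N) - dim K'(Y, \<Sigma>X) = [U\<^sub>0, Y] - [U\<^sub>1, Y]\<close>. Together,
  \<open>\<langle>N, N'\<rangle>\<^sub>a = [T\<^sub>0, Y] - [T\<^sub>1, Y] - [U\<^sub>0, Y] + [U\<^sub>1, Y]\<close>. Since \<open>[U, Y] = dim Hom(P, N')\<close> with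
  \<open>P = \<C>(T, U)\<close> projective for \<open>U\<close> in \<open>add T\<close>, the right-hand side is additive on short exact sequences in \<open>N'\<close>.
\<close>

section \<open>Dimensions of subspaces\<close>

text \<open>Neither Hom nor Ext of modules is additive on short exact sequences. The formula above
  gets around this because its four objects of \<open>add T\<close> depend on \<open>N\<close>
  alone, so that \<open>N'\<close> enters only through exact functors. To reach it, the two Euler
  forms are treated differently: \<langle>N, N'\<rangle> through the maps out of
  \<open>T\<^sub>0\<close> and \<open>T\<^sub>1\<close>, but \<langle>N', N\<rangle> through
  \<open>\<C>(Y, X)\<close> itself. What then remains is a difference of a left rank and a right
  rank, which agree. The double suspension occurs because \<open>\<Sigma>\<^sup>2\<close> acts as a
  Serre functor. Since suspension is only an autoequivalence, the object representing
  \<open>N\<close> is taken at the outset in the form \<open>\<Sigma>\<^sup>2W\<close>, and the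
  second triangle is a coresolution of \<open>W\<close>, suspended twice. The left argument is never
  resolved in its own right: by \<open>\<langle>M, K\<rangle> = \<langle>K, M\<rangle> - \<langle>K,
  M\<rangle>\<^sub>a\<close>, additivity on direct sums on the left follows from additivity of both
  forms on the right. All comparisons are dimension counts by rank and nullity; quotient vector
  spaces are never formed.\<close>

lemma linear_on_add: "linear_on s t V f \<Longrightarrow> x \<in> V \<Longrightarrow> y \<in> V \<Longrightarrow> f (x + y) = f x + f y"
  by (simp add: linear_on_def)

lemma linear_on_scale: "linear_on s t V f \<Longrightarrow> x \<in> V \<Longrightarrow> f (s c x) = t c (f x)"
  by (simp add: linear_on_def)

lemma linear_on_zero: "linear_on s t V f \<Longrightarrow> 0 \<in> V \<Longrightarrow> f 0 = 0"
  using linear_on_add[of s t V f 0 0] by simp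

lemma linear_on_subset: "linear_on s t V f \<Longrightarrow> U \<subseteq> V \<Longrightarrow> linear_on s t U f"
  unfolding linear_on_def by blast

lemma linear_on_comp:
  "linear_on s t V f \<Longrightarrow> linear_on t r W g \<Longrightarrow> f ` V \<subseteq> W \<Longrightarrow> linear_on s r V (\<lambda>x. g (f x))"
  by (auto simp: linear_on_def image_subset_iff)

lemma linear_on_cong: "(\<And>x. x \<in> V \<Longrightarrow> f x = g x) \<Longrightarrow> (\<And>x y. x \<in> V \<Longrightarrow> y \<in> V \<Longrightarrow> x + y \<in> V) \<Longrightarrow>
   (\<And>c x. x \<in> V \<Longrightarrow> s c x \<in> V) \<Longrightarrow> linear_on s t V f \<longleftrightarrow> linear_on s t V g"
  by (auto simp: linear_on_def)

context vector_space begin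

lemma linear_on_diff:
  assumes "linear_on scale t V f" "subspace V" "x \<in> V" "y \<in> V"
  shows "f (x - y) = f x - f y"
  using linear_on_add[OF assms(1) subspace_diff[OF assms(2-4)] assms(4)] by simp

lemma linear_on_neg:
  assumes "linear_on scale t V f" "subspace V" "x \<in> V"
  shows "f (- x) = - f x"
  using linear_on_diff[OF assms(1,2) subspace_0[OF assms(2)] assms(3)]
    linear_on_zero[OF assms(1) subspace_0[OF assms(2)]] by simp

lemma linear_on_sum:
  assumes "linear_on scale t V f" "subspace V" "\<And>i. i \<in> I \<Longrightarrow> x i \<in> V"
  shows "f (\<Sum>i\<in>I. x i) = (\<Sum>i\<in>I. f (x i))"
  using assms(3)
proof (induction I rule: infinite_finite_induct)
  case (insert i I)
  then show ?case
    by (simp add: linear_on_add[OF assms(1)] subspace_sum[OF assms(2)])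
qed (use linear_on_zero[OF assms(1) subspace_0[OF assms(2)]] in simp_all)

lemma linear_on_inj:
  assumes "linear_on scale t V f" "subspace V"
  shows "inj_on f V \<longleftrightarrow> (\<forall>x\<in>V. f x = 0 \<longrightarrow> x = 0)"
proof
  show "inj_on f V \<Longrightarrow> \<forall>x\<in>V. f x = 0 \<longrightarrow> x = 0"
    using linear_on_zero[OF assms(1) subspace_0[OF assms(2)]] subspace_0[OF assms(2)]
    by (metis (full_types) inj_onD)
next
  assume R: "\<forall>x\<in>V. f x = 0 \<longrightarrow> x = 0"
  show "inj_on f V"
  proof (rule inj_onI)
    fix x y assume "x \<in> V" "y \<in> V" "f x = f y"
    then show "x = y"
      using R linear_on_diff[OF assms, of x y] subspace_diff[OF assms(2), of x y] by auto
  qed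
qed

lemma subspace_ker:
  assumes "vector_space t" "linear_on scale t V f" "subspace V"
  shows "subspace {x\<in>V. f x = 0}"
proof -
  interpret t: vector_space t by fact
  show ?thesis
    using linear_on_zero[OF assms(2) subspace_0[OF assms(3)]] assms(2,3)
    by (auto simp: subspace_def linear_on_def)
qed

lemma fd_subspace_iff: "fd_subspace scale V \<longleftrightarrow> subspace V \<and> (\<exists>B. finite B \<and> V \<subseteq> span B)"
  by (simp add: fd_subspace_def)

lemma fd_basis:
  assumes "fd_subspace scale V"
  obtains B where "finite B" "independent B" "B \<subseteq> V" "span B = V" "card B = dim V"
proof -
  obtain S where S: "finite S" "V \<subseteq> span S" and V: "subspace V"
    using assms by (auto simp: fd_subspace_iff)
  obtain B where B: "B \<subseteq> V" "independent B" "V \<subseteq> span B" "card B = dim V"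
    by (rule basis_exists[of V])
  have "finite B" using independent_span_bound[OF S(1) B(2)] S(2) B(1) by blast
  then show ?thesis using that[OF _ B(2,1) span_subspace[OF B(1,3) V] B(4)] by blast
qed

lemma fd_subset:
  assumes "fd_subspace scale V" "subspace U" "U \<subseteq> V"
  shows "fd_subspace scale U" "dim U \<le> dim V"
proof -
  obtain B where B: "finite B" "span B = V" "card B = dim V" using fd_basis[OF assms(1)] by metis
  then show "fd_subspace scale U" "dim U \<le> dim V"
    using assms(2,3) dim_le_card[of U B] unfolding fd_subspace_iff by auto
qed

lemma dim_zero: "dim {0} = 0"
  using dim_eq_card_independent[of "{}"] dim_span[of "{}"] by (simp add: independent_empty)

lemma fd_zero: "fd_subspace scale {0}"
  unfolding fd_subspace_iff using subspace_single_0 by (intro conjI exI[of _ "{}"]) auto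

text \<open>Composition and the other maps used below are linear only on a single subspace. A global
  linear map with the same values on \<open>V\<close> gives access to the theory of linear maps
  between whole spaces.\<close>

lemma linear_on_extend:
  assumes "vector_space t" "linear_on scale t V f" "subspace V"
  obtains g where "Vector_Spaces.linear scale t g" "\<And>x. x \<in> V \<Longrightarrow> g x = f x"
proof -
  interpret p: vector_space_pair scale t
    using assms(1) vector_space_axioms by (simp add: vector_space_pair_def)
  obtain B where B: "B \<subseteq> V" "independent B" "V \<subseteq> span B"
    by (rule maximal_independent_subset[of V])
  obtain g where g: "Vector_Spaces.linear scale t g" "\<forall>x\<in>B. g x = f x"
    using p.linear_independent_extend[OF B(2), of f] by blast
  have spB: "span B = V" by (rule span_subspace[OF B(1,3) assms(3)])
  have "x \<in> V \<and> g x = f x" if "x \<in> span B" for x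
    using that
  proof (induction rule: span_induct_alt)
    case base
    show ?case
      using linear_on_zero[OF assms(2) subspace_0[OF assms(3)]] p.linear_0[OF g(1)]
        subspace_0[OF assms(3)] by simp
  next
    case (step c x y)
    have x: "x \<in> V" "scale c x \<in> V" using step(1) B(1) subspace_scale[OF assms(3)] by auto
    have y: "y \<in> V" "g y = f y" using step(2) by auto
    have "g (scale c x + y) = t c (g x) + g y"
      by (simp only: p.linear_add[OF g(1)] p.linear_scale[OF g(1)])
    also have "\<dots> = t c (f x) + f y" using step(1) g(2) y by simp
    also have "\<dots> = f (scale c x + y)"
      using linear_on_add[OF assms(2) x(2) y(1)] linear_on_scale[OF assms(2) x(1)] by simp
    finally show ?case using subspace_add[OF assms(3) x(2) y(1)] by blast
  qed
  then show ?thesis using that[OF g(1)] spB by blast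
qed

lemma rank_nullity:
  assumes t: "vector_space t" and V: "fd_subspace scale V" and f: "linear_on scale t V f"
  shows "fd_subspace t (f ` V)"
    and "dim V = dim {x\<in>V. f x = 0} + vector_space.dim t (f ` V)"
proof -
  interpret p: vector_space_pair scale t
    using t vector_space_axioms by (simp add: vector_space_pair_def)
  have sV: "subspace V" using V by (simp add: fd_subspace_iff)
  obtain g where g: "Vector_Spaces.linear scale t g" and gf: "\<And>x. x \<in> V \<Longrightarrow> g x = f x"
    using linear_on_extend[OF t f sV] by blast
  let ?K = "{x\<in>V. f x = 0}"
  have sK: "subspace ?K" by (rule subspace_ker[OF t f sV])
  have fK: "fd_subspace scale ?K" by (rule fd_subset[OF V sK]) auto
  obtain A where A: "finite A" "independent A" "A \<subseteq> ?K" "span A = ?K" "card A = dim ?K"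
    using fd_basis[OF fK] by blast
  obtain B where B: "A \<subseteq> B" "B \<subseteq> V" "independent B" "V \<subseteq> span B"
    by (rule maximal_independent_subset_extend[of A V]) (use A in auto)
  have finB: "finite B"
  proof -
    obtain S where "finite S" "V \<subseteq> span S" using V by (auto simp: fd_subspace_iff)
    then show ?thesis using independent_span_bound[of S B] B by blast
  qed
  have spB: "span B = V" using B sV by (intro span_subspace)
  let ?C = "B - A"
  have indC: "independent ?C" using B(3) independent_mono by blast
  have spC: "span ?C \<subseteq> V" using spB span_mono[of ?C B] by auto
  have inj: "inj_on g (span ?C)"
  proof (subst p.linear_inj_on_iff_eq_0[OF g subspace_span], intro ballI impI)
    fix x assume x: "x \<in> span ?C" "g x = 0"
    then have "x \<in> span A" using spC gf A(4) by auto
    then show "x = 0"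
    proof -
      \<comment> \<open>Such an \<open>x\<close> lies in the spans of the disjoint sets
        \<open>A\<close> and \<open>B - A\<close>, so each of its coordinates with respect to
        \<open>B\<close> vanishes.\<close>
      have "representation B x = representation A x"
        using representation_extend[OF B(3) \<open>x \<in> span A\<close> B(1)] .
      moreover have "representation B x = representation ?C x"
        using representation_extend[OF B(3) x(1)] by auto
      ultimately have "representation B x b = 0" for b
        using representation_ne_zero[of A x b] representation_ne_zero[of ?C x b] by auto
      moreover have "x \<in> span B" using x(1) spC spB by auto
      ultimately show "x = 0"
        using sum_representation_eq[OF B(3) _ finB subset_refl, of x] by simp
    qed
  qed
  have im: "f ` V = p.vs2.span (g ` ?C)"
  proof -
    have "f ` V = g ` V" using gf by auto
    also have "\<dots> = p.vs2.span (g ` B)" using p.linear_span_image[OF g, of B] spB by simp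
    also have "\<dots> = p.vs2.span (g ` ?C)"
    proof -
      have "g ` B \<subseteq> insert 0 (g ` ?C)" using A(3) gf by auto
      then have "p.vs2.span (g ` B) \<subseteq> p.vs2.span (g ` ?C)"
        using p.vs2.span_mono[of "g ` B" "insert 0 (g ` ?C)"] by simp
      moreover have "p.vs2.span (g ` ?C) \<subseteq> p.vs2.span (g ` B)"
        by (intro p.vs2.span_mono) auto
      ultimately show ?thesis by blast
    qed
    finally show ?thesis .
  qed
  show "fd_subspace t (f ` V)"
    unfolding p.vs2.fd_subspace_iff using im finB
    by (intro conjI exI[of _ "g ` ?C"]) auto
  have "p.vs2.independent (g ` ?C)" using p.linear_independent_injective_image[OF g indC inj] .
  then have "p.vs2.dim (f ` V) = card (g ` ?C)"
    using im p.vs2.dim_span_eq_card_independent by simp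
  also have "\<dots> = card ?C"
    by (rule card_image[OF inj_on_subset[OF inj span_superset]])
  finally have "p.vs2.dim (f ` V) = card B - card A"
    using card_Diff_subset[OF A(1) B(1)] by simp
  moreover have "card B = dim V" using B basis_card_eq_dim by blast
  moreover have "card A \<le> card B" using B(1) finB by (simp add: card_mono)
  ultimately show "dim V = dim ?K + vector_space.dim t (f ` V)" using A(5) by simp
qed

lemma dim_inj:
  assumes t: "vector_space t" and V: "fd_subspace scale V" and f: "linear_on scale t V f"
    and "inj_on f V"
  shows "vector_space.dim t (f ` V) = dim V"
proof -
  have sV: "subspace V" using V by (simp add: fd_subspace_iff)
  have "{x\<in>V. f x = 0} = {0}"
    using linear_on_inj[OF f sV] assms(4) subspace_0[OF sV] linear_on_zero[OF f] by auto
  then show ?thesis using rank_nullity(2)[OF t V f] dim_zero by simp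
qed

text \<open>Preimages of a basis of the image, together with a spanning set of the kernel, span
  \<open>V\<close>. This serves for products and function spaces, where finite dimension is not
  inherited from a larger space.\<close>

lemma fd_if_ker_fd:
  assumes t: "vector_space t" and V: "subspace V" and f: "linear_on scale t V f"
    and K: "fd_subspace scale {x\<in>V. f x = 0}" and I: "fd_subspace t W" "f ` V \<subseteq> W"
  shows "fd_subspace scale V"
proof -
  interpret p: vector_space_pair scale t
    using t vector_space_axioms by (simp add: vector_space_pair_def)
  obtain g where g: "Vector_Spaces.linear scale t g" and gf: "\<And>x. x \<in> V \<Longrightarrow> g x = f x"
    using linear_on_extend[OF t f V] by blast
  have "p.vs2.subspace (g ` V)" using p.linear_subspace_image[OF g V] .
  then have "p.vs2.subspace (f ` V)" using gf by simp
  then have "fd_subspace t (f ` V)" using p.vs2.fd_subset(1)[OF I(1)] I(2) by blast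
  then obtain B where B: "finite B" "B \<subseteq> f ` V" "p.vs2.span B = f ` V"
    using p.vs2.fd_basis by metis
  obtain A where A: "A \<subseteq> V" "finite A" "B = f ` A"
    using finite_subset_image[OF B(1,2)] by blast
  obtain S where S: "finite S" "{x\<in>V. f x = 0} \<subseteq> span S"
    using K by (auto simp: fd_subspace_iff)
  have "V \<subseteq> span (A \<union> S)"
  proof
    fix x assume x: "x \<in> V"
    have "f x \<in> p.vs2.span (g ` A)"
    proof -
      have "g ` A = f ` A" using A(1) gf by (intro image_cong) auto
      then show ?thesis using A(3) B(3) x by auto
    qed
    then obtain a where a: "a \<in> span A" "f x = g a"
      using p.linear_span_image[OF g, of A] by auto
    have "a \<in> V" using a A V span_minimal by blast
    then have "f (x - a) = 0" using a x gf linear_on_diff[OF f V x] by simp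
    then have "x - a \<in> span S" using S x \<open>a \<in> V\<close> V subspace_diff by blast
    then have "a + (x - a) \<in> span (A \<union> S)"
      using a span_mono[of A "A \<union> S"] span_mono[of S "A \<union> S"] by (intro span_add) auto
    then show "x \<in> span (A \<union> S)" by simp
  qed
  then show ?thesis using V A S unfolding fd_subspace_iff by blast
qed

lemma dual_separates:
  assumes "subspace V" "x \<in> V" "x \<noteq> 0"
  obtains \<xi> where "\<xi> \<in> dual_space scale V" "\<xi> x \<noteq> 0"
proof -
  interpret p: vector_space_pair scale "(*) :: 'a \<Rightarrow> 'a \<Rightarrow> 'a"
    by unfold_locales (simp_all add: algebra_simps)
  have "independent {x}" using assms by simp
  then obtain g where g: "Vector_Spaces.linear scale (*) g" "\<forall>y\<in>{x}. g y = (\<lambda>_. 1) y"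
    using p.linear_independent_extend[of "{x}" "\<lambda>_. 1"] by blast
  let ?\<xi> = "\<lambda>y. if y \<in> V then g y else 0"
  have "linear_on scale (*) V ?\<xi>"
    using assms(1) p.linear_add[OF g(1)] p.linear_scale[OF g(1)]
    by (auto simp: linear_on_def subspace_add subspace_scale)
  then have "?\<xi> \<in> dual_space scale V" by (simp add: dual_space_def)
  moreover have "?\<xi> x \<noteq> 0" using g assms by simp
  ultimately show ?thesis using that by blast
qed

end

section \<open>Comparing quotient dimensions and ranks of pairings\<close>

definition prod_scale :: "('k \<Rightarrow> 'v \<Rightarrow> 'v) \<Rightarrow> ('k \<Rightarrow> 'w \<Rightarrow> 'w) \<Rightarrow> 'k \<Rightarrow> 'v \<times> 'w \<Rightarrow> 'v \<times> 'w" where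
  "prod_scale s t c x = (s c (fst x), t c (snd x))"

lemma vector_space_prod_scale:
  "vector_space s \<Longrightarrow> vector_space t \<Longrightarrow> vector_space (prod_scale s t)"
  by (simp add: vector_space_def prod_scale_def)

text \<open>This is \<open>dim (Z/B) \<le> dim (Z'/B')\<close>, written with sums: \<open>Z\<close>
  modulo the preimage of \<open>B'\<close> embeds into \<open>Z'/B'\<close>, and that preimage lies
  in \<open>B\<close>. The count applies rank and nullity to \<open>(z, b) \<mapsto> f z - b\<close>
  on \<open>Z \<times> B'\<close>, whose kernel is the graph of \<open>f\<close> over the preimage
  and so projects injectively into \<open>B\<close>.\<close>

lemma quotient_dim_le:
  fixes s :: "'k::field \<Rightarrow> 'v::ab_group_add \<Rightarrow> 'v" and t :: "'k \<Rightarrow> 'w::ab_group_add \<Rightarrow> 'w"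
  assumes s: "vector_space s" and t: "vector_space t"
    and Z: "fd_subspace s Z" and Z': "fd_subspace t Z'"
    and f: "linear_on s t Z f" "f ` Z \<subseteq> Z'"
    and B: "Modules.module.subspace s B" "B \<subseteq> Z" and B': "Modules.module.subspace t B'" "B' \<subseteq> Z'"
    and pre: "\<And>z. z \<in> Z \<Longrightarrow> f z \<in> B' \<Longrightarrow> z \<in> B"
  shows "vector_space.dim s Z + vector_space.dim t B' \<le> vector_space.dim t Z' + vector_space.dim s B"
proof -
  let ?p = "prod_scale s t"
  interpret s: vector_space s by fact
  interpret t: vector_space t by fact
  have vp: "vector_space ?p" by (rule vector_space_prod_scale[OF s t])
  interpret p: vector_space ?p by (rule vp)
  have sZ: "s.subspace Z" using Z by (simp add: s.fd_subspace_iff)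
  have sZ': "t.subspace Z'" using Z' by (simp add: t.fd_subspace_iff)
  have fB': "fd_subspace t B'" by (rule t.fd_subset[OF Z' B'])
  have fB: "fd_subspace s B" by (rule s.fd_subset[OF Z B])
  let ?P = "Z \<times> B'" and ?Q = "{0::'v} \<times> B'"
  have sP: "p.subspace ?P" "p.subspace ?Q"
    using sZ B'(1) by (auto simp: p.subspace_def s.subspace_def t.subspace_def prod_scale_def zero_prod_def)
  have lin: "linear_on ?p s A fst" "linear_on ?p t A snd" for A
    by (auto simp: linear_on_def prod_scale_def)
  have kQ: "{x\<in>?Q. snd x = 0} = {0}" using t.subspace_0[OF B'(1)] by (auto simp: zero_prod_def)
  have fQ: "fd_subspace ?p ?Q"
    by (rule p.fd_if_ker_fd[OF t sP(2) lin(2) _ fB']) (auto simp: kQ p.fd_zero)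
  have kP: "{x\<in>?P. fst x = 0} = ?Q" using s.subspace_0[OF sZ] by auto
  have fP: "fd_subspace ?p ?P"
    by (rule p.fd_if_ker_fd[OF s sP(1) lin(1) _ Z]) (auto simp: kP fQ)
  have imP: "fst ` ?P = Z" using t.subspace_0[OF B'(1)] by force
  have imQ: "snd ` ?Q = B'" by auto
  have "p.dim ?Q = t.dim B'"
    using p.rank_nullity(2)[OF t fQ lin(2)] by (simp add: kQ imQ p.dim_zero)
  then have dP: "p.dim ?P = t.dim B' + s.dim Z"
  proof -
    have "p.dim ?P = p.dim {x\<in>?P. fst x = 0} + s.dim (fst ` ?P)"
      by (rule p.rank_nullity(2)[OF s fP lin(1)])
    then show ?thesis unfolding kP imP using \<open>p.dim ?Q = t.dim B'\<close> by linarith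
  qed
  let ?F = "\<lambda>x. f (fst x) - snd x"
  have lF: "linear_on ?p t ?P ?F"
    using f(1) by (auto simp: linear_on_def prod_scale_def t.scale_right_diff_distrib)
  have "?F ` ?P \<subseteq> Z'"
  proof (rule image_subsetI)
    fix x assume "x \<in> ?P"
    then have "f (fst x) \<in> Z'" "snd x \<in> Z'" using f(2) B'(2) by auto
    then show "?F x \<in> Z'" by (rule t.subspace_diff[OF sZ'])
  qed
  moreover have "t.subspace (?F ` ?P)"
    using p.rank_nullity(1)[OF t fP lF] by (simp add: t.fd_subspace_iff)
  ultimately have d1: "t.dim (?F ` ?P) \<le> t.dim Z'" using t.fd_subset(2)[OF Z'] by blast
  let ?K = "{x\<in>?P. ?F x = 0}"
  have sK: "p.subspace ?K" by (rule p.subspace_ker[OF t lF sP(1)])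
  have fK: "fd_subspace ?p ?K" by (rule p.fd_subset[OF fP sK]) auto
  have "inj_on fst ?K"
  proof (rule inj_onI)
    fix x y assume "x \<in> ?K" "y \<in> ?K" and e: "fst x = fst y"
    then have "f (fst x) = snd x" "f (fst y) = snd y" by simp_all
    then show "x = y" using e by (metis prod.expand)
  qed
  then have "s.dim (fst ` ?K) = p.dim ?K" using p.dim_inj[OF s fK lin(1)] by blast
  moreover have "fst ` ?K \<subseteq> B" using pre by auto
  moreover have "s.subspace (fst ` ?K)"
    using p.rank_nullity(1)[OF s fK lin(1)] by (simp add: s.fd_subspace_iff)
  ultimately have d2: "p.dim ?K \<le> s.dim B" using s.fd_subset(2)[OF fB, of "fst ` ?K"] by linarith
  show ?thesis using p.rank_nullity(2)[OF t fP lF] dP d1 d2 by linarith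
qed

lemma vector_space_mult: "vector_space ((*) :: 'k::field \<Rightarrow> 'k \<Rightarrow> 'k)"
  by unfold_locales (simp_all add: algebra_simps)

text \<open>Modulo the left radical, \<open>V\<close> is a space of functionals on \<open>W\<close>.
  Evaluating \<open>w\<close> at a finite basis \<open>D\<close> of that space loses exactly the
  right radical, so the right rank is at most \<open>card D\<close>, which is the left rank.
  Exchanging the two sides gives equality.\<close>

lemma pairing_rank_le:
  fixes s :: "'k::field \<Rightarrow> 'v::ab_group_add \<Rightarrow> 'v" and t :: "'k \<Rightarrow> 'w::ab_group_add \<Rightarrow> 'w"
    and \<beta> :: "'v \<Rightarrow> 'w \<Rightarrow> 'k"
  assumes s: "vector_space s" and t: "vector_space t"
    and V: "fd_subspace s V" and W: "fd_subspace t W"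
    and l1: "\<And>v. v \<in> V \<Longrightarrow> linear_on t (*) W (\<beta> v)"
    and l2: "\<And>w. w \<in> W \<Longrightarrow> linear_on s (*) V (\<lambda>v. \<beta> v w)"
  shows "vector_space.dim t W + vector_space.dim s {v\<in>V. \<forall>w\<in>W. \<beta> v w = 0}
    \<le> vector_space.dim s V + vector_space.dim t {w\<in>W. \<forall>v\<in>V. \<beta> v w = 0}"
proof -
  interpret s: vector_space s by fact
  interpret t: vector_space t by fact
  let ?m = "(*) :: 'k \<Rightarrow> 'k \<Rightarrow> 'k"
  have vF: "vector_space (fun_scale ?m :: 'k \<Rightarrow> ('w \<Rightarrow> 'k) \<Rightarrow> _)"
    "vector_space (fun_scale ?m :: 'k \<Rightarrow> (('w \<Rightarrow> 'k) \<Rightarrow> 'k) \<Rightarrow> _)"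
    by (rule vector_space_fun_scale[OF vector_space_mult])+
  interpret F: vector_space "fun_scale ?m :: 'k \<Rightarrow> ('w \<Rightarrow> 'k) \<Rightarrow> _" by (rule vF)
  interpret G: vector_space "fun_scale ?m :: 'k \<Rightarrow> (('w \<Rightarrow> 'k) \<Rightarrow> 'k) \<Rightarrow> _" by (rule vF)
  \<comment> \<open>Values outside \<open>W\<close> are erased, so that \<open>f v = 0\<close> means
    precisely that \<open>v\<close> is in the left radical.\<close>
  define f where "f v = (\<lambda>w. if w \<in> W then \<beta> v w else 0)" for v
  have lf: "linear_on s (fun_scale (*)) V f"
    unfolding linear_on_def
  proof (intro conjI ballI allI)
    fix x y assume "x \<in> V" "y \<in> V"
    then show "f (x + y) = f x + f y"
      using linear_on_add[OF l2] by (auto simp: f_def fun_eq_iff)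
  next
    fix c x assume "x \<in> V"
    then show "f (s c x) = fun_scale (*) c (f x)"
      using linear_on_scale[OF l2] by (auto simp: f_def fun_eq_iff fun_scale_def)
  qed
  have kf: "{v\<in>V. f v = 0} = {v\<in>V. \<forall>w\<in>W. \<beta> v w = 0}" by (auto simp: f_def fun_eq_iff)
  note rf = s.rank_nullity[OF vF(1) V lf, unfolded kf]
  obtain D where D: "finite D" "D \<subseteq> f ` V" "F.span D = f ` V" "card D = F.dim (f ` V)"
    by (rule F.fd_basis[OF rf(1)])
  define g where "g w = (\<lambda>d. if d \<in> D then d w else 0)" for w
  have Dlin: "linear_on t (*) W d" if d: "d \<in> D" for d
  proof -
    obtain v where v: "v \<in> V" "d = f v" using d D(2) by auto
    have "t.subspace W" using W by (simp add: t.fd_subspace_iff)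
    then have "linear_on t (*) W d \<longleftrightarrow> linear_on t (*) W (\<beta> v)"
      by (intro linear_on_cong) (auto simp: v f_def t.subspace_add t.subspace_scale)
    then show ?thesis using l1[OF v(1)] by simp
  qed
  have lg: "linear_on t (fun_scale (*)) W g"
    unfolding linear_on_def
  proof (intro conjI ballI allI)
    fix x y assume "x \<in> W" "y \<in> W"
    then show "g (x + y) = g x + g y"
      using linear_on_add[OF Dlin] by (auto simp: g_def fun_eq_iff)
  next
    fix c x assume "x \<in> W"
    then show "g (t c x) = fun_scale (*) c (g x)"
      using linear_on_scale[OF Dlin] by (auto simp: g_def fun_eq_iff fun_scale_def)
  qed
  have kg: "{w\<in>W. g w = 0} = {w\<in>W. \<forall>v\<in>V. \<beta> v w = 0}"
  proof (intro Collect_cong conj_cong refl iffI ballI)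
    fix w v assume w: "w \<in> W" "g w = 0" and v: "v \<in> V"
    have "d w = 0" if "d \<in> F.span D" for d
      using that
    proof (induction rule: F.span_induct_alt)
      case (step c x y)
      have "x w = 0" using w(2) step(1) by (auto simp: g_def fun_eq_iff split: if_splits)
      then show ?case using step(2) by (simp add: fun_scale_def)
    qed simp
    then have "f v w = 0" using D(3) v by blast
    then show "\<beta> v w = 0" using w by (simp add: f_def)
  next
    fix w assume w: "w \<in> W" "\<forall>v\<in>V. \<beta> v w = 0"
    have "d w = 0" if "d \<in> D" for d using that D(2) w by (auto simp: f_def)
    then show "g w = 0" by (auto simp: g_def fun_eq_iff)
  qed
  define \<delta> where "\<delta> d = (\<lambda>e. if e = d then 1 else 0 :: 'k)" for d :: "'w \<Rightarrow> 'k"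
  have "g ` W \<subseteq> G.span (\<delta> ` D)"
  proof (rule image_subsetI)
    fix w
    have "g w = (\<Sum>d\<in>D. fun_scale (*) (d w) (\<delta> d))"
    proof
      fix e
      have "(\<Sum>d\<in>D. fun_scale (*) (d w) (\<delta> d)) e = (\<Sum>d\<in>D. d w * \<delta> d e)"
        by (induction D rule: infinite_finite_induct) (auto simp: fun_scale_def)
      also have "\<dots> = (\<Sum>d\<in>D. if e = d then d w else 0)"
        by (intro sum.cong) (auto simp: \<delta>_def)
      finally show "g w e = (\<Sum>d\<in>D. fun_scale (*) (d w) (\<delta> d)) e"
        using D(1) by (simp add: g_def)
    qed
    moreover have "fun_scale (*) (d w) (\<delta> d) \<in> G.span (\<delta> ` D)" if "d \<in> D" for d
      by (rule G.span_scale[OF G.span_base[OF imageI[OF that]]])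
    ultimately show "g w \<in> G.span (\<delta> ` D)" by (simp only: G.span_sum)
  qed
  then have "G.dim (g ` W) \<le> card (\<delta> ` D)" using G.dim_le_card[of "g ` W" "\<delta> ` D"] D(1) by simp
  also have "\<dots> \<le> card D" using D(1) by (rule card_image_le)
  finally show ?thesis
    using t.rank_nullity(2)[OF vF(2) W lg] rf(2) D(4) unfolding kg by linarith
qed

lemma pairing_rank_eq:
  fixes s :: "'k::field \<Rightarrow> 'v::ab_group_add \<Rightarrow> 'v" and t :: "'k \<Rightarrow> 'w::ab_group_add \<Rightarrow> 'w"
    and \<beta> :: "'v \<Rightarrow> 'w \<Rightarrow> 'k"
  assumes "vector_space s" "vector_space t" "fd_subspace s V" "fd_subspace t W"
    and "\<And>v. v \<in> V \<Longrightarrow> linear_on t (*) W (\<beta> v)" "\<And>w. w \<in> W \<Longrightarrow> linear_on s (*) V (\<lambda>v. \<beta> v w)"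
  shows "vector_space.dim t W + vector_space.dim s {v\<in>V. \<forall>w\<in>W. \<beta> v w = 0}
    = vector_space.dim s V + vector_space.dim t {w\<in>W. \<forall>v\<in>V. \<beta> v w = 0}"
  using pairing_rank_le[of s t V W \<beta>] pairing_rank_le[of t s W V "\<lambda>w v. \<beta> v w"] assms by simp

text \<open>A function in \<open>V\<close> is determined by its values at the finitely many points
  of \<open>B\<close>; the induction splits off one evaluation at a time. With \<open>B\<close> a
  basis of the source, this bounds the spaces of module homomorphisms.\<close>

lemma fd_subspace_functions:
  fixes s :: "'k::field \<Rightarrow> 'w::ab_group_add \<Rightarrow> 'w" and V :: "('a \<Rightarrow> 'w) set"
  assumes s: "vector_space s" and W: "fd_subspace s W" and B: "finite B"
    and V: "Modules.module.subspace (fun_scale s) V"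
    and "\<And>\<phi> b. \<phi> \<in> V \<Longrightarrow> b \<in> B \<Longrightarrow> \<phi> b \<in> W" and "\<And>\<phi>. \<phi> \<in> V \<Longrightarrow> \<forall>b\<in>B. \<phi> b = 0 \<Longrightarrow> \<phi> = 0"
  shows "fd_subspace (fun_scale s) V"
  using B V assms(5,6)
proof (induction B arbitrary: V rule: finite_induct)
  case empty
  interpret F: vector_space "fun_scale s :: 'k \<Rightarrow> ('a \<Rightarrow> 'w) \<Rightarrow> _" by (rule vector_space_fun_scale[OF s])
  have "\<phi> = 0" if "\<phi> \<in> V" for \<phi> by (rule empty(3)[OF that]) simp
  then have "V = {0}" using F.subspace_0[OF empty(1)] by (intro equalityI subsetI) auto
  then show ?case using F.fd_zero by simp
next
  case (insert b B)
  interpret F: vector_space "fun_scale s :: 'k \<Rightarrow> ('a \<Rightarrow> 'w) \<Rightarrow> _" by (rule vector_space_fun_scale[OF s])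
  have lin: "linear_on (fun_scale s) s V (\<lambda>\<phi>. \<phi> b)" by (simp add: linear_on_def fun_scale_def)
  have "fd_subspace (fun_scale s) {\<phi>\<in>V. \<phi> b = 0}"
    by (rule insert.IH[OF F.subspace_ker[OF s lin insert.prems(1)]]) (use insert.prems in auto)
  then show ?case
    by (rule F.fd_if_ker_fd[OF s insert.prems(1) lin _ W]) (use insert.prems in auto)
qed

section \<open>Modules and projective resolutions\<close>

abbreviation mscale :: "'k::field \<Rightarrow> ((nat \<Rightarrow> 'k) \<Rightarrow> nat \<Rightarrow> 'k) \<Rightarrow> (nat \<Rightarrow> 'k) \<Rightarrow> nat \<Rightarrow> 'k" where
  "mscale \<equiv> fun_scale vscale"

lemma vector_space_mscale: "vector_space mscale"
  by (rule vector_space_fun_scale[OF vector_space_vscale])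

global_interpretation vs: vector_space "vscale :: 'k::field \<Rightarrow> _" by (rule vector_space_vscale)
global_interpretation ms: vector_space "mscale :: 'k::field \<Rightarrow> _" by (rule vector_space_mscale)

context
  fixes A :: "('k::field, 'a::ab_group_add) alg"
begin

lemma fd_modules_fd: "M \<in> fd_modules A \<Longrightarrow> fd_subspace vscale (vecs M)"
  by (simp add: fd_modules_def)

lemma fd_modules_subspace: "M \<in> fd_modules A \<Longrightarrow> vs.subspace (vecs M)"
  by (simp add: fd_modules_def fd_subspace_def)

lemma fd_modules_zero: "M \<in> fd_modules A \<Longrightarrow> 0 \<in> vecs M"
  by (rule vs.subspace_0[OF fd_modules_subspace])

lemma fd_modules_act: "M \<in> fd_modules A \<Longrightarrow> x \<in> vecs M \<Longrightarrow> a \<in> alg_carrier A \<Longrightarrow> act M x a \<in> vecs M"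
  by (simp add: fd_modules_def)

lemma fd_modules_act_linear:
  "M \<in> fd_modules A \<Longrightarrow> a \<in> alg_carrier A \<Longrightarrow> linear_on vscale vscale (vecs M) (\<lambda>x. act M x a)"
  by (simp add: fd_modules_def)

lemma mod_hom_linear: "f \<in> mod_hom A M N \<Longrightarrow> linear_on vscale vscale (vecs M) f"
  by (simp add: mod_hom_def)

lemma mod_hom_in: "f \<in> mod_hom A M N \<Longrightarrow> x \<in> vecs M \<Longrightarrow> f x \<in> vecs N"
  by (auto simp: mod_hom_def)

lemma mod_hom_act:
  "f \<in> mod_hom A M N \<Longrightarrow> x \<in> vecs M \<Longrightarrow> a \<in> alg_carrier A \<Longrightarrow> f (act M x a) = act N (f x) a"
  by (auto simp: mod_hom_def)

lemma mod_hom_out: "f \<in> mod_hom A M N \<Longrightarrow> x \<notin> vecs M \<Longrightarrow> f x = 0"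
  by (auto simp: mod_hom_def)

lemma mod_hom_add: "f \<in> mod_hom A M N \<Longrightarrow> x \<in> vecs M \<Longrightarrow> y \<in> vecs M \<Longrightarrow> f (x + y) = f x + f y"
  by (rule linear_on_add[OF mod_hom_linear])

lemma mod_hom_diff:
  "M \<in> fd_modules A \<Longrightarrow> f \<in> mod_hom A M N \<Longrightarrow> x \<in> vecs M \<Longrightarrow> y \<in> vecs M \<Longrightarrow> f (x - y) = f x - f y"
  by (rule vs.linear_on_diff[OF mod_hom_linear fd_modules_subspace])

lemma mod_hom_zero: "M \<in> fd_modules A \<Longrightarrow> f \<in> mod_hom A M N \<Longrightarrow> f 0 = 0"
  by (rule linear_on_zero[OF mod_hom_linear fd_modules_zero])

lemma mod_hom_eqI:
  "f \<in> mod_hom A M N \<Longrightarrow> g \<in> mod_hom A M N' \<Longrightarrow> (\<And>x. x \<in> vecs M \<Longrightarrow> f x = g x) \<Longrightarrow> f = g"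
  by (rule ext) (metis mod_hom_out)

lemma mod_hom_range:
  assumes "N \<in> fd_modules A" "f \<in> mod_hom A M N"
  shows "f x \<in> vecs N"
proof (cases "x \<in> vecs M")
  case False
  show ?thesis unfolding mod_hom_out[OF assms(2) False] by (rule fd_modules_zero[OF assms(1)])
qed (rule mod_hom_in[OF assms(2)])

lemma mod_homI:
  assumes "M \<in> fd_modules A" "\<And>x. x \<in> vecs M \<Longrightarrow> f x \<in> vecs N"
    and "linear_on vscale vscale (vecs M) f"
    and "\<And>x a. x \<in> vecs M \<Longrightarrow> a \<in> alg_carrier A \<Longrightarrow> f (act M x a) = act N (f x) a"
  shows "(\<lambda>x. if x \<in> vecs M then f x else 0) \<in> mod_hom A M N"
  using assms fd_modules_act[OF assms(1)] fd_modules_subspace[OF assms(1)]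
  by (auto simp: mod_hom_def linear_on_def vs.subspace_add vs.subspace_scale)

lemma mod_hom_comp:
  assumes "M \<in> fd_modules A" "f \<in> mod_hom A L M" "g \<in> mod_hom A M N"
  shows "g \<circ> f \<in> mod_hom A L N"
proof -
  have "linear_on vscale vscale (vecs L) (\<lambda>x. g (f x))"
    by (rule linear_on_comp[OF mod_hom_linear[OF assms(2)] mod_hom_linear[OF assms(3)]])
      (use mod_hom_in[OF assms(2)] in auto)
  then show ?thesis
    using assms(2,3) mod_hom_zero[OF assms(1,3)]
    by (auto simp: mod_hom_def comp_def image_subset_iff)
qed

lemma mod_hom_subspace:
  assumes "M \<in> fd_modules A" "N \<in> fd_modules A"
  shows "ms.subspace (mod_hom A M N)"
proof -
  note sM = fd_modules_subspace[OF assms(1)] and sN = fd_modules_subspace[OF assms(2)]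
  show ?thesis
  proof (rule ms.subspaceI)
    show "0 \<in> mod_hom A M N"
      using vs.subspace_0[OF sN] linear_on_zero[OF fd_modules_act_linear[OF assms(2)] vs.subspace_0[OF sN]]
      by (auto simp: mod_hom_def linear_on_def)
  next
    fix f g assume f: "f \<in> mod_hom A M N" and g: "g \<in> mod_hom A M N"
    have "act N (f x + g x) a = act N (f x) a + act N (g x) a" if "x \<in> vecs M" "a \<in> alg_carrier A" for x a
      using linear_on_add[OF fd_modules_act_linear[OF assms(2) that(2)] mod_hom_in[OF f that(1)] mod_hom_in[OF g that(1)]] .
    then show "f + g \<in> mod_hom A M N"
      using f g vs.subspace_add[OF sN]
      by (auto simp: mod_hom_def linear_on_def vs.scale_right_distrib image_subset_iff)
  next
    fix c f assume f: "f \<in> mod_hom A M N"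
    have "act N (vscale c (f x)) a = vscale c (act N (f x) a)" if "x \<in> vecs M" "a \<in> alg_carrier A" for x a
      using linear_on_scale[OF fd_modules_act_linear[OF assms(2) that(2)] mod_hom_in[OF f that(1)]] .
    then show "mscale c f \<in> mod_hom A M N"
      using f vs.subspace_scale[OF sN] unfolding fun_scale_def[of vscale c f]
      by (auto simp: mod_hom_def linear_on_def vs.scale_right_distrib image_subset_iff vs.scale_left_commute)
  qed
qed

lemma mod_hom_fd:
  assumes "M \<in> fd_modules A" "N \<in> fd_modules A"
  shows "fd_subspace mscale (mod_hom A M N)"
proof -
  obtain B where B: "finite B" "B \<subseteq> vecs M" "vs.span B = vecs M"
    using vs.fd_basis[OF fd_modules_fd[OF assms(1)]] by metis
  show ?thesis
  proof (rule fd_subspace_functions[OF vector_space_vscale fd_modules_fd[OF assms(2)] B(1) mod_hom_subspace[OF assms]])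
    fix f b assume "f \<in> mod_hom A M N" "b \<in> B"
    then show "f b \<in> vecs N" using mod_hom_in B(2) by blast
  next
    fix f assume f: "f \<in> mod_hom A M N" "\<forall>b\<in>B. f b = 0"
    have "x \<in> vecs M \<and> f x = 0" if "x \<in> vs.span B" for x
      using that
    proof (induction rule: vs.span_induct_alt)
      case base
      show ?case using mod_hom_zero[OF assms(1) f(1)] fd_modules_zero[OF assms(1)] by blast
    next
      case (step c x y)
      have x: "x \<in> vecs M" "vscale c x \<in> vecs M"
        using step(1) B(2) vs.subspace_scale[OF fd_modules_subspace[OF assms(1)]] by auto
      have "f (vscale c x + y) = vscale c (f x) + f y"
        using linear_on_add[OF mod_hom_linear[OF f(1)] x(2)] step(2)
          linear_on_scale[OF mod_hom_linear[OF f(1)] x(1)] by simp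
      also have "\<dots> = 0"
      proof -
        have "f x = 0" "f y = 0" using f(2) step by blast+
        then show ?thesis by (simp only: vs.scale_zero_right add_0)
      qed
      finally show ?case
        using step(2) vs.subspace_add[OF fd_modules_subspace[OF assms(1)] x(2)] by blast
    qed
    then show "f = 0" using mod_hom_out[OF f(1)] B(3) by (metis ext zero_fun_apply)
  qed
qed

text \<open>For \<open>S\<close> the image of \<open>d2\<close> these are the 1-cocycles of the
  complex that defines Ext; for \<open>S = {}\<close> they are all homomorphisms. Both cases are
  needed, and one additivity argument covers them.\<close>

definition vanishing_hom ::
  "('k, 'a) rmod \<Rightarrow> (nat \<Rightarrow> 'k) set \<Rightarrow> ('k, 'a) rmod \<Rightarrow> ((nat \<Rightarrow> 'k) \<Rightarrow> nat \<Rightarrow> 'k) set" where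
  "vanishing_hom P S N = {f\<in>mod_hom A P N. \<forall>x\<in>S. f x = 0}"

lemma vanishing_hom_empty: "vanishing_hom P {} N = mod_hom A P N"
  by (simp add: vanishing_hom_def)

lemma vanishing_hom_fd:
  assumes "P \<in> fd_modules A" "N \<in> fd_modules A"
  shows "fd_subspace mscale (vanishing_hom P S N)"
proof (rule ms.fd_subset(1)[OF mod_hom_fd[OF assms]])
  show "ms.subspace (vanishing_hom P S N)"
    using mod_hom_subspace[OF assms]
    by (auto simp: ms.subspace_def vanishing_hom_def fun_scale_def zero_fun_def)
qed (auto simp: vanishing_hom_def)

lemma postcomp_linear:
  assumes "L \<in> fd_modules A" "f \<in> mod_hom A L M"
  shows "linear_on mscale mscale (mod_hom A P L) (\<lambda>h. f \<circ> h)"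
  unfolding linear_on_def
proof (intro conjI ballI allI)
  fix h h' assume h: "h \<in> mod_hom A P L" "h' \<in> mod_hom A P L"
  show "f \<circ> (h + h') = (f \<circ> h) + (f \<circ> h')"
    by (rule ext) (use mod_hom_add[OF assms(2)] h mod_hom_range[OF assms(1)] in simp)
next
  fix c h assume h: "h \<in> mod_hom A P L"
  show "f \<circ> mscale c h = mscale c (f \<circ> h)"
    unfolding fun_scale_def[of vscale c]
    by (rule ext) (use linear_on_scale[OF mod_hom_linear[OF assms(2)]] mod_hom_range[OF assms(1) h] in simp)
qed

lemma precomp_linear: "linear_on mscale mscale V (\<lambda>h. h \<circ> f)"
  by (simp add: linear_on_def fun_eq_iff fun_scale_def)

text \<open>Left exactness of Hom: a map killed by \<open>g\<close> factors uniquely through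
  \<open>f\<close>, and the factor still vanishes on \<open>S\<close> because \<open>f\<close> is
  injective. Exactness on the right is the hypothesis \<open>lift\<close>; it will come from
  projectivity of \<open>P\<close>, from a section of \<open>g\<close>, or from \<open>N\<close>
  being zero.\<close>

lemma vanishing_hom_dim_additive:
  assumes P: "P \<in> fd_modules A" and L: "L \<in> fd_modules A" and M: "M \<in> fd_modules A" and N: "N \<in> fd_modules A"
    and f: "f \<in> mod_hom A L M" and g: "g \<in> mod_hom A M N"
    and inj: "inj_on f (vecs L)" and ex: "f ` vecs L = {x\<in>vecs M. g x = 0}"
    and lift: "\<And>h. h \<in> vanishing_hom P S N \<Longrightarrow> \<exists>h'\<in>vanishing_hom P S M. g \<circ> h' = h"
  shows "mor_dim (vanishing_hom P S M) = mor_dim (vanishing_hom P S L) + mor_dim (vanishing_hom P S N)"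
proof -
  have f0: "f 0 = 0" and g0: "g 0 = 0"
    using mod_hom_zero[OF L f] mod_hom_zero[OF M g] by blast+
  have sub: "vanishing_hom P S X \<subseteq> mod_hom A P X" for X by (auto simp: vanishing_hom_def)
  note lf = linear_on_subset[OF postcomp_linear[OF L f] sub]
    and lg = linear_on_subset[OF postcomp_linear[OF M g] sub]
  have "(\<lambda>h. g \<circ> h) ` vanishing_hom P S M \<subseteq> vanishing_hom P S N"
    using mod_hom_comp[OF M _ g] g0 by (auto simp: vanishing_hom_def)
  then have im: "(\<lambda>h. g \<circ> h) ` vanishing_hom P S M = vanishing_hom P S N"
    using lift by (auto simp: image_iff) metis
  have "{h\<in>vanishing_hom P S M. g \<circ> h = 0} = (\<lambda>h. f \<circ> h) ` vanishing_hom P S L"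
  proof (intro equalityI subsetI)
    fix h assume "h \<in> (\<lambda>h. f \<circ> h) ` vanishing_hom P S L"
    then obtain k where k: "k \<in> vanishing_hom P S L" "h = f \<circ> k" by blast
    then have kL: "k \<in> mod_hom A P L" using sub by blast
    have "h \<in> vanishing_hom P S M"
      using mod_hom_comp[OF L kL f] k f0 by (simp add: vanishing_hom_def)
    moreover have gfk: "g (f (k x)) = 0" for x
    proof (cases "x \<in> vecs P")
      case True
      then show ?thesis using mod_hom_in[OF kL True] ex by blast
    next
      case False
      then show ?thesis using mod_hom_out[OF kL False] f0 g0 by (simp only:)
    qed
    moreover have "g \<circ> h = 0" unfolding k(2) by (rule ext) (simp only: comp_apply zero_fun_apply gfk)
    ultimately show "h \<in> {h\<in>vanishing_hom P S M. g \<circ> h = 0}" by blast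
  next
    fix h assume "h \<in> {h\<in>vanishing_hom P S M. g \<circ> h = 0}"
    then have h: "h \<in> vanishing_hom P S M" "h \<in> mod_hom A P M" and gh: "\<And>x. g (h x) = 0"
      using sub by (auto dest: fun_cong)
    \<comment> \<open>The factor is the pointwise preimage of \<open>h\<close> under
      \<open>f\<close>. Its linearity and compatibility with the action are checked after applying
      the injective map \<open>f\<close>.\<close>
    let ?i = "inv_into (vecs L) f"
    have i: "?i (h x) \<in> vecs L" "f (?i (h x)) = h x" if "x \<in> vecs P" for x
    proof -
      have "h x \<in> f ` vecs L" using mod_hom_in[OF h(2) that] gh[of x] ex by simp
      then show "?i (h x) \<in> vecs L" "f (?i (h x)) = h x" by (rule inv_into_into, rule f_inv_into_f)
    qed
    define k where "k x = (if x \<in> vecs P then ?i (h x) else 0)" for x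
    have "k \<in> mod_hom A P L"
      unfolding k_def
    proof (rule mod_homI[OF P i(1)])
      show "linear_on vscale vscale (vecs P) (\<lambda>x. ?i (h x))"
        unfolding linear_on_def
      proof (intro conjI ballI allI)
        fix x y assume xy: "x \<in> vecs P" "y \<in> vecs P"
        have "f (?i (h x) + ?i (h y)) = f (?i (h (x + y)))"
          using mod_hom_add[OF f i(1)[OF xy(1)] i(1)[OF xy(2)]] i(2)[OF xy(1)] i(2)[OF xy(2)]
            i(2)[OF vs.subspace_add[OF fd_modules_subspace[OF P] xy]] mod_hom_add[OF h(2) xy] by simp
        then show "?i (h (x + y)) = ?i (h x) + ?i (h y)"
          using inj_onD[OF inj, of "?i (h x) + ?i (h y)" "?i (h (x + y))"] xy i(1)
            vs.subspace_add[OF fd_modules_subspace[OF L]] vs.subspace_add[OF fd_modules_subspace[OF P]]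
          by simp
      next
        fix c x assume x: "x \<in> vecs P"
        have cx: "vscale c x \<in> vecs P" using vs.subspace_scale[OF fd_modules_subspace[OF P] x] .
        have "f (vscale c (?i (h x))) = f (?i (h (vscale c x)))"
          using linear_on_scale[OF mod_hom_linear[OF f] i(1)[OF x]] i(2)[OF x] i(2)[OF cx]
            linear_on_scale[OF mod_hom_linear[OF h(2)] x] by simp
        then show "?i (h (vscale c x)) = vscale c (?i (h x))"
          using inj_onD[OF inj, of "vscale c (?i (h x))" "?i (h (vscale c x))"] x i(1) cx
            vs.subspace_scale[OF fd_modules_subspace[OF L]]
          by simp
      qed
    next
      fix x a assume x: "x \<in> vecs P" and a: "a \<in> alg_carrier A"
      have "f (act L (?i (h x)) a) = f (?i (h (act P x a)))"
        using mod_hom_act[OF f i(1)[OF x] a] i(2)[OF x] i(2)[OF fd_modules_act[OF P x a]] mod_hom_act[OF h(2) x a]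
        by simp
      then show "?i (h (act P x a)) = act L (?i (h x)) a"
        using inj_onD[OF inj _ fd_modules_act[OF L i(1)[OF x] a] i(1)[OF fd_modules_act[OF P x a]]] by simp
    qed
    moreover have "f \<circ> k = h"
      using i(2) f0 mod_hom_out[OF h(2)] by (auto simp: k_def fun_eq_iff)
    moreover have "k x = 0" if "x \<in> S" for x
    proof -
      have "f (k x) = 0" using \<open>f \<circ> k = h\<close> h(1) that by (auto simp: vanishing_hom_def)
      moreover have "k x \<in> vecs L" using i(1) fd_modules_zero[OF L] by (auto simp: k_def)
      ultimately show ?thesis using inj_onD[OF inj _ _ fd_modules_zero[OF L], of "k x"] f0 by metis
    qed
    ultimately have "k \<in> vanishing_hom P S L" "f \<circ> k = h" by (auto simp: vanishing_hom_def)
    then show "h \<in> (\<lambda>h. f \<circ> h) ` vanishing_hom P S L" by blast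
  qed
  moreover have "inj_on (\<lambda>h. f \<circ> h) (vanishing_hom P S L)"
  proof (rule inj_onI)
    fix h k assume h: "h \<in> vanishing_hom P S L" and k: "k \<in> vanishing_hom P S L" and e: "f \<circ> h = f \<circ> k"
    show "h = k"
    proof (rule mod_hom_eqI)
      show "h \<in> mod_hom A P L" "k \<in> mod_hom A P L" using h k sub by blast+
      then show "h x = k x" if "x \<in> vecs P" for x
        using inj_onD[OF inj _ mod_hom_in mod_hom_in] e that by (metis comp_apply)
    qed
  qed
  ultimately show ?thesis
    using ms.rank_nullity(2)[OF vector_space_mscale vanishing_hom_fd[OF P M] lg]
      ms.dim_inj[OF vector_space_mscale vanishing_hom_fd[OF P L] lf] im
    by simp
qed

section \<open>Projective modules and split sequences\<close>

lemma projective_in: "projective_mod A P \<Longrightarrow> P \<in> fd_modules A"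
  by (simp add: projective_mod_def)

lemma projective_lift:
  assumes "projective_mod A P" "M \<in> fd_modules A" "N \<in> fd_modules A" "g \<in> mod_hom A M N" "h \<in> mod_hom A P N"
    "g ` vecs M = vecs N"
  obtains k where "k \<in> mod_hom A P M" "g \<circ> k = h"
proof -
  obtain k where k: "k \<in> mod_hom A P M" "\<forall>x\<in>vecs P. g (k x) = h x"
    using assms unfolding projective_mod_def by blast
  have "g \<circ> k = h"
    by (rule mod_hom_eqI[OF mod_hom_comp[OF assms(2) k(1) assms(4)] assms(5)]) (use k in simp)
  with k(1) that show ?thesis by blast
qed

lemma hom_dim_short_exact:
  assumes P: "projective_mod A P" and L: "L \<in> fd_modules A" and M: "M \<in> fd_modules A" and N: "N \<in> fd_modules A"
    and "short_exact A L M N"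
  shows "mor_dim (mod_hom A P M) = mor_dim (mod_hom A P L) + mor_dim (mod_hom A P N)"
proof -
  obtain f g where f: "f \<in> mod_hom A L M" and g: "g \<in> mod_hom A M N" and
    "inj_on f (vecs L)" "f ` vecs L = {x\<in>vecs M. g x = 0}" and s: "g ` vecs M = vecs N"
    using assms(5) unfolding short_exact_def by blast
  then show ?thesis
    using vanishing_hom_dim_additive[OF projective_in[OF P] L M N f g, of "{}"]
      projective_lift[OF P M N g _ s]
    unfolding vanishing_hom_empty by metis
qed

lemma mod_direct_sumE:
  assumes N2: "N2 \<in> fd_modules A" and s: "mod_direct_sum A N1 N2 M"
  obtains i1 i2 p2 where "i1 \<in> mod_hom A N1 M" "i2 \<in> mod_hom A N2 M" "p2 \<in> mod_hom A M N2"
    "inj_on i1 (vecs N1)" "i1 ` vecs N1 = {x\<in>vecs M. p2 x = 0}" "\<forall>x\<in>vecs N2. p2 (i2 x) = x"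
proof -
  obtain i1 i2 p1 p2 where i1: "i1 \<in> mod_hom A N1 M" and i2: "i2 \<in> mod_hom A N2 M"
    and p1: "p1 \<in> mod_hom A M N1" and p2: "p2 \<in> mod_hom A M N2"
    and a: "\<And>x. x \<in> vecs N1 \<Longrightarrow> p1 (i1 x) = x" "\<And>x. x \<in> vecs N1 \<Longrightarrow> p2 (i1 x) = 0"
     "\<And>x. x \<in> vecs N2 \<Longrightarrow> p2 (i2 x) = x" "\<And>x. x \<in> vecs M \<Longrightarrow> i1 (p1 x) + i2 (p2 x) = x"
    using s unfolding mod_direct_sum_def by blast
  have inj: "inj_on i1 (vecs N1)" by (rule inj_on_inverseI[of _ p1]) (rule a)
  have ex: "i1 ` vecs N1 = {x\<in>vecs M. p2 x = 0}"
  proof (intro equalityI subsetI)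
    fix x assume x: "x \<in> {x\<in>vecs M. p2 x = 0}"
    then have "x = i1 (p1 x) + 0" using a(4)[of x] mod_hom_zero[OF N2 i2] by simp
    then show "x \<in> i1 ` vecs N1" using mod_hom_in[OF p1] x by auto
  qed (use a mod_hom_in[OF i1] in auto)
  show ?thesis by (rule that[OF i1 i2 p2 inj ex]) (simp add: a(3))
qed

lemma short_exact_if_direct_sum:
  assumes N2: "N2 \<in> fd_modules A" and s: "mod_direct_sum A N1 N2 M"
  shows "short_exact A N1 M N2"
proof -
  obtain i1 i2 p2 where i1: "i1 \<in> mod_hom A N1 M" and i2: "i2 \<in> mod_hom A N2 M" and p2: "p2 \<in> mod_hom A M N2"
    and ex: "inj_on i1 (vecs N1)" "i1 ` vecs N1 = {x\<in>vecs M. p2 x = 0}" and pi: "\<forall>x\<in>vecs N2. p2 (i2 x) = x"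
    by (rule mod_direct_sumE[OF assms])
  have "p2 ` vecs M = vecs N2"
  proof (intro equalityI subsetI)
    fix x assume x: "x \<in> vecs N2"
    show "x \<in> p2 ` vecs M" using imageI[OF mod_hom_in[OF i2 x], of p2] pi x by simp
  qed (use mod_hom_in[OF p2] in auto)
  then show ?thesis unfolding short_exact_def using i1 p2 ex by blast
qed

lemma vanishing_hom_direct_sum:
  assumes P: "P \<in> fd_modules A" and N1: "N1 \<in> fd_modules A" and N2: "N2 \<in> fd_modules A" and M: "M \<in> fd_modules A"
    and s: "mod_direct_sum A N1 N2 M"
  shows "mor_dim (vanishing_hom P S M) = mor_dim (vanishing_hom P S N1) + mor_dim (vanishing_hom P S N2)"
proof -
  obtain i1 i2 p2 where i1: "i1 \<in> mod_hom A N1 M" and i2: "i2 \<in> mod_hom A N2 M" and p2: "p2 \<in> mod_hom A M N2"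
    and ex: "inj_on i1 (vecs N1)" "i1 ` vecs N1 = {x\<in>vecs M. p2 x = 0}" and pi: "\<forall>x\<in>vecs N2. p2 (i2 x) = x"
    by (rule mod_direct_sumE[OF N2 s])
  show ?thesis
  proof (rule vanishing_hom_dim_additive[OF P N1 M N2 i1 p2 ex])
    fix h assume h: "h \<in> vanishing_hom P S N2"
    then have h': "h \<in> mod_hom A P N2" by (simp add: vanishing_hom_def)
    have "p2 \<circ> (i2 \<circ> h) = h" by (rule ext) (simp add: pi mod_hom_range[OF N2 h'])
    moreover have "i2 \<circ> h \<in> vanishing_hom P S M"
      using mod_hom_comp[OF N2 h' i2] h mod_hom_zero[OF N2 i2] by (simp add: vanishing_hom_def)
    ultimately show "\<exists>h'\<in>vanishing_hom P S M. p2 \<circ> h' = h" by blast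
  qed
qed

lemma kernel_module:
  assumes M: "M \<in> fd_modules A" and N: "N \<in> fd_modules A" and g: "g \<in> mod_hom A M N"
  shows "M\<lparr>vecs := {x\<in>vecs M. g x = 0}\<rparr> \<in> fd_modules A"
proof -
  let ?K = "{x\<in>vecs M. g x = 0}"
  have sub: "vs.subspace ?K"
    by (rule vs.subspace_ker[OF vector_space_vscale mod_hom_linear[OF g] fd_modules_subspace[OF M]])
  have "fd_subspace vscale ?K"
    by (rule vs.fd_subset(1)[OF fd_modules_fd[OF M] sub]) auto
  moreover have "act M x a \<in> ?K" if "x \<in> ?K" "a \<in> alg_carrier A" for x a
    using that mod_hom_act[OF g, of x a] fd_modules_act[OF M, of x a]
      linear_on_zero[OF fd_modules_act_linear[OF N that(2)] fd_modules_zero[OF N]] by simp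
  ultimately show ?thesis
    using M by (auto simp: fd_modules_def linear_on_def)
qed

text \<open>Projectivity speaks of surjections only; \<open>d\<close> becomes one when its target is
  shrunk to the kernel of \<open>e\<close>.\<close>

lemma projective_lift_exact:
  assumes Q: "projective_mod A Q" and P1: "P1 \<in> fd_modules A" and P0: "P0 \<in> fd_modules A" and N: "N \<in> fd_modules A"
    and d: "d \<in> mod_hom A P1 P0" and e: "e \<in> mod_hom A P0 N" and ex: "d ` vecs P1 = {x\<in>vecs P0. e x = 0}"
    and h: "h \<in> mod_hom A Q P0" and eh: "\<And>x. x \<in> vecs Q \<Longrightarrow> e (h x) = 0"
  obtains k where "k \<in> mod_hom A Q P1" "d \<circ> k = h"
proof -
  let ?K = "P0\<lparr>vecs := {x\<in>vecs P0. e x = 0}\<rparr>"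
  have 1: "d \<in> mod_hom A P1 ?K" using d ex by (simp add: mod_hom_def)
  have 2: "h \<in> mod_hom A Q ?K" using h eh by (simp add: mod_hom_def image_subset_iff)
  have 3: "d ` vecs P1 = vecs ?K" using ex by simp
  show ?thesis
    by (rule projective_lift[OF Q P1 kernel_module[OF P0 N e] 1 2 3]) (rule that)
qed

lemma mod_hom_id: "M \<in> fd_modules A \<Longrightarrow> (\<lambda>x. if x \<in> vecs M then x else 0) \<in> mod_hom A M M"
  by (rule mod_homI) (auto simp: linear_on_def)

lemma mod_hom_minus:
  "M \<in> fd_modules A \<Longrightarrow> N \<in> fd_modules A \<Longrightarrow> f \<in> mod_hom A M N \<Longrightarrow> g \<in> mod_hom A M N \<Longrightarrow> f - g \<in> mod_hom A M N"
  by (rule ms.subspace_diff[OF mod_hom_subspace])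

lemma mod_hom_plus:
  "M \<in> fd_modules A \<Longrightarrow> N \<in> fd_modules A \<Longrightarrow> f \<in> mod_hom A M N \<Longrightarrow> g \<in> mod_hom A M N \<Longrightarrow> f + g \<in> mod_hom A M N"
  by (rule ms.subspace_add[OF mod_hom_subspace])

section \<open>The Euler form computed from any projective resolution\<close>

lemma coboundaries:
  assumes N': "N' \<in> fd_modules A" and P: "proj_resolution A N P0 P1 P2 e d1 d2"
  shows "ms.subspace ((\<lambda>h. h \<circ> d1) ` mod_hom A P0 N')"
    and "(\<lambda>h. h \<circ> d1) ` mod_hom A P0 N' \<subseteq> vanishing_hom P1 (d2 ` vecs P2) N'"
proof -
  have f: "P0 \<in> fd_modules A" "P1 \<in> fd_modules A"
    and d1: "d1 \<in> mod_hom A P1 P0" and d2: "d2 ` vecs P2 = {x\<in>vecs P1. d1 x = 0}"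
    using P by (auto simp: proj_resolution_def projective_in)
  show "ms.subspace ((\<lambda>h. h \<circ> d1) ` mod_hom A P0 N')"
    using ms.rank_nullity(1)[OF vector_space_mscale mod_hom_fd[OF f(1) N'] precomp_linear]
    by (auto simp: ms.fd_subspace_iff)
  show "(\<lambda>h. h \<circ> d1) ` mod_hom A P0 N' \<subseteq> vanishing_hom P1 (d2 ` vecs P2) N'"
  proof (rule image_subsetI)
    fix h assume h: "h \<in> mod_hom A P0 N'"
    have "d1 x = 0" if "x \<in> d2 ` vecs P2" for x using that d2 by blast
    then show "h \<circ> d1 \<in> vanishing_hom P1 (d2 ` vecs P2) N'"
      using mod_hom_comp[OF f(1) d1 h] mod_hom_zero[OF f(1) h]
      by (simp add: vanishing_hom_def)
  qed
qed

text \<open>One half of the independence of Ext from the resolution, as an instance of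
  \<open>quotient_dim_le\<close>. Projectivity gives chain maps \<open>a\<close> and
  \<open>b\<close> over the identity of \<open>N\<close> in both directions and a homotopy
  \<open>s0\<close> in degree 0. Precomposition with \<open>a1\<close> preserves cocycles, and the
  homotopy shows that a cocycle which becomes a coboundary was one already.\<close>

lemma resolution_comparison:
  assumes N: "N \<in> fd_modules A" and N': "N' \<in> fd_modules A"
    and P: "proj_resolution A N P0 P1 P2 e d1 d2" and Q: "proj_resolution A N Q0 Q1 Q2 e' d1' d2'"
  shows "mor_dim (vanishing_hom P1 (d2 ` vecs P2) N') + mor_dim ((\<lambda>h. h \<circ> d1') ` mod_hom A Q0 N')
    \<le> mor_dim (vanishing_hom Q1 (d2' ` vecs Q2) N') + mor_dim ((\<lambda>h. h \<circ> d1) ` mod_hom A P0 N')"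
proof -
  have pP: "projective_mod A P0" "projective_mod A P1" and pQ: "projective_mod A Q0" "projective_mod A Q1"
    using P Q by (auto simp: proj_resolution_def)
  have f: "P0 \<in> fd_modules A" "P1 \<in> fd_modules A" "P2 \<in> fd_modules A" "Q0 \<in> fd_modules A" "Q1 \<in> fd_modules A" "Q2 \<in> fd_modules A"
    using P Q by (auto simp: proj_resolution_def projective_in)
  have e: "e \<in> mod_hom A P0 N" "e ` vecs P0 = vecs N" and d1: "d1 \<in> mod_hom A P1 P0" "d1 ` vecs P1 = {x\<in>vecs P0. e x = 0}"
    and d2: "d2 \<in> mod_hom A P2 P1" "d2 ` vecs P2 = {x\<in>vecs P1. d1 x = 0}"
    using P by (auto simp: proj_resolution_def)
  have e': "e' \<in> mod_hom A Q0 N" "e' ` vecs Q0 = vecs N" and d1': "d1' \<in> mod_hom A Q1 Q0" "d1' ` vecs Q1 = {x\<in>vecs Q0. e' x = 0}"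
    and d2': "d2' \<in> mod_hom A Q2 Q1" "d2' ` vecs Q2 = {x\<in>vecs Q1. d1' x = 0}"
    using Q by (auto simp: proj_resolution_def)
  obtain a0 where a0: "a0 \<in> mod_hom A Q0 P0" "e \<circ> a0 = e'"
    by (rule projective_lift[OF pQ(1) f(1) N e(1) e'(1) e(2)])
  obtain b0 where b0: "b0 \<in> mod_hom A P0 Q0" "e' \<circ> b0 = e"
    by (rule projective_lift[OF pP(1) f(4) N e'(1) e(1) e'(2)])
  have ed1: "e (d1 x) = 0" if "x \<in> vecs P1" for x using d1(2) that by blast
  have ed1': "e' (d1' x) = 0" if "x \<in> vecs Q1" for x using d1'(2) that by blast
  have c0: "e (a0 x) = e' x" "e' (b0 y) = e y" for x y using a0(2) b0(2) by (auto dest: fun_cong)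
  obtain a1 where a1: "a1 \<in> mod_hom A Q1 P1" "d1 \<circ> a1 = a0 \<circ> d1'"
    by (rule projective_lift_exact[OF pQ(2) f(2) f(1) N d1(1) e(1) d1(2) mod_hom_comp[OF f(4) d1'(1) a0(1)]])
      (simp add: c0 ed1')
  obtain b1 where b1: "b1 \<in> mod_hom A P1 Q1" "d1' \<circ> b1 = b0 \<circ> d1"
    by (rule projective_lift_exact[OF pP(2) f(5) f(4) N d1'(1) e'(1) d1'(2) mod_hom_comp[OF f(1) d1(1) b0(1)]])
      (simp add: c0 ed1)
  have c1: "d1 (a1 x) = a0 (d1' x)" "d1' (b1 y) = b0 (d1 y)" for x y
    using a1(2) b1(2) by (metis comp_apply)+
  let ?i = "\<lambda>x. if x \<in> vecs P0 then x else 0"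
  let ?r = "?i - (a0 \<circ> b0)"
  have r: "?r \<in> mod_hom A P0 P0"
    by (intro mod_hom_minus mod_hom_id mod_hom_comp[OF f(4) b0(1) a0(1)] f)
  have er: "e (?r x) = 0" if "x \<in> vecs P0" for x
  proof -
    have "e (x - a0 (b0 x)) = e x - e (a0 (b0 x))"
      by (rule mod_hom_diff[OF f(1) e(1) that]) (rule mod_hom_range[OF f(1) a0(1)])
    then show ?thesis using that by (simp only: c0) (simp add: zero_fun_def)
  qed
  obtain s0 where s0: "s0 \<in> mod_hom A P0 P1" "d1 \<circ> s0 = ?r"
    by (rule projective_lift_exact[OF pP(1) f(2) f(1) N d1(1) e(1) d1(2) r er])
  let ?ZP = "vanishing_hom P1 (d2 ` vecs P2) N'" and ?ZQ = "vanishing_hom Q1 (d2' ` vecs Q2) N'"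
  let ?BP = "(\<lambda>h. h \<circ> d1) ` mod_hom A P0 N'" and ?BQ = "(\<lambda>h. h \<circ> d1') ` mod_hom A Q0 N'"
  show ?thesis
  proof (rule quotient_dim_le[OF vector_space_mscale vector_space_mscale vanishing_hom_fd[OF f(2) N']
      vanishing_hom_fd[OF f(5) N'] precomp_linear _ coboundaries[OF N' P] coboundaries[OF N' Q]])
    show "(\<lambda>h. h \<circ> a1) ` ?ZP \<subseteq> ?ZQ"
    proof (rule image_subsetI)
      fix h assume h: "h \<in> ?ZP"
      then have hh: "h \<in> mod_hom A P1 N'" by (simp add: vanishing_hom_def)
      have "a1 x \<in> d2 ` vecs P2" if "x \<in> d2' ` vecs Q2" for x
        using that d2(2) d2'(2) c1(1)[of x] mod_hom_range[OF f(2) a1(1)] mod_hom_zero[OF f(4) a0(1)] by simp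
      then have "\<forall>x\<in>d2' ` vecs Q2. h (a1 x) = 0" using h unfolding vanishing_hom_def by blast
      then show "h \<circ> a1 \<in> ?ZQ"
        using mod_hom_comp[OF f(2) a1(1) hh] unfolding vanishing_hom_def comp_apply by blast
    qed
  next
    fix h assume h: "h \<in> ?ZP" and "h \<circ> a1 \<in> ?BQ"
    then have hh: "h \<in> mod_hom A P1 N'" by (simp add: vanishing_hom_def)
    obtain k where k: "k \<in> mod_hom A Q0 N'" "h \<circ> a1 = k \<circ> d1'" using \<open>h \<circ> a1 \<in> ?BQ\<close> by blast
    have ka: "h (a1 x) = k (d1' x)" for x using k(2) by (metis comp_apply)
    \<comment> \<open>From \<open>h = h a1 b1 + h s0 d1\<close> and \<open>h a1 = k d1'\<close> one
      reads off \<open>h = (k b0 + h s0) d1\<close>.\<close>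
    let ?l = "(k \<circ> b0) + (h \<circ> s0)"
    have l: "?l \<in> mod_hom A P0 N'"
      by (intro mod_hom_plus mod_hom_comp[OF f(4) b0(1) k(1)] mod_hom_comp[OF f(2) s0(1) hh] f N')
    have "h = ?l \<circ> d1"
    proof (rule mod_hom_eqI[OF hh mod_hom_comp[OF f(1) d1(1) l]])
      fix x assume x: "x \<in> vecs P1"
      \<comment> \<open>The element \<open>?y\<close> is killed by \<open>d1\<close>, hence lies in
        the image of \<open>d2\<close>, where the cocycle \<open>h\<close> vanishes. This replaces a
        homotopy in degree 1.\<close>
      let ?y = "x - a1 (b1 x) - s0 (d1 x)"
      have v: "a1 (b1 x) \<in> vecs P1" "s0 (d1 x) \<in> vecs P1" "x - a1 (b1 x) \<in> vecs P1"
        using mod_hom_range[OF f(2) a1(1)] mod_hom_range[OF f(2) s0(1)]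
          vs.subspace_diff[OF fd_modules_subspace[OF f(2)] x] by auto
      have "d1 (s0 z) = z - a0 (b0 z)" if "z \<in> vecs P0" for z
        using fun_cong[OF s0(2), of z] that by simp
      then have "d1 (s0 (d1 x)) = d1 x - a0 (b0 (d1 x))" using mod_hom_in[OF d1(1) x] by blast
      then have "d1 ?y = 0"
        using mod_hom_diff[OF f(2) d1(1) v(3) v(2)] mod_hom_diff[OF f(2) d1(1) x v(1)] c1 by simp
      then have "h ?y = 0"
        using h d2(2) vs.subspace_diff[OF fd_modules_subspace[OF f(2)] v(3) v(2)]
        unfolding vanishing_hom_def by blast
      then have "h x = h (a1 (b1 x)) + h (s0 (d1 x))"
        using mod_hom_diff[OF f(2) hh v(3) v(2)] mod_hom_diff[OF f(2) hh x v(1)] by (simp add: diff_diff_eq)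
      then show "h x = (?l \<circ> d1) x" by (simp add: ka c1)
    qed
    then show "h \<in> ?BP" using l by blast
  qed
qed

lemma coboundary_dim_le:
  assumes N': "N' \<in> fd_modules A" and P: "proj_resolution A N P0 P1 P2 e d1 d2"
  shows "mor_dim ((\<lambda>h. h \<circ> d1) ` mod_hom A P0 N') \<le> mor_dim (vanishing_hom P1 (d2 ` vecs P2) N')"
  by (rule ms.fd_subset(2)[OF vanishing_hom_fd[OF _ N'] coboundaries[OF assms]])
    (use P in \<open>simp add: proj_resolution_def projective_in\<close>)

text \<open>Left exactness of \<open>Hom(?, N')\<close> on the presentation of \<open>N\<close>: the
  maps on \<open>P0\<close> killed by \<open>d1\<close> are those which factor through
  \<open>e\<close>, and the remaining part of \<open>Hom(P0, N')\<close> is carried isomorphically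
  onto the coboundaries.\<close>

lemma hom_dim_resolution:
  assumes N: "N \<in> fd_modules A" and N': "N' \<in> fd_modules A" and P: "proj_resolution A N P0 P1 P2 e d1 d2"
  shows "mor_dim (mod_hom A P0 N') = mor_dim (mod_hom A N N') + mor_dim ((\<lambda>h. h \<circ> d1) ` mod_hom A P0 N')"
proof -
  have f: "P0 \<in> fd_modules A" "P1 \<in> fd_modules A"
    and e: "e \<in> mod_hom A P0 N" and se: "e ` vecs P0 = vecs N" and d1: "d1 \<in> mod_hom A P1 P0"
    and ex: "d1 ` vecs P1 = {x\<in>vecs P0. e x = 0}"
    using P by (auto simp: proj_resolution_def projective_in)
  have "inj_on (\<lambda>h. h \<circ> e) (mod_hom A N N')"
  proof (rule inj_onI)
    fix h k assume h: "h \<in> mod_hom A N N'" "k \<in> mod_hom A N N'" and eq: "h \<circ> e = k \<circ> e"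
    show "h = k"
    proof (rule mod_hom_eqI[OF h])
      fix x assume "x \<in> vecs N"
      then obtain y where "x = e y" using se by blast
      then show "h x = k x" using fun_cong[OF eq, of y] by simp
    qed
  qed
  then have "mor_dim ((\<lambda>h. h \<circ> e) ` mod_hom A N N') = mor_dim (mod_hom A N N')"
    by (rule ms.dim_inj[OF vector_space_mscale mod_hom_fd[OF N N'] precomp_linear])
  moreover have "(\<lambda>h. h \<circ> e) ` mod_hom A N N' = {h\<in>mod_hom A P0 N'. h \<circ> d1 = 0}"
  proof (intro equalityI subsetI)
    fix h assume "h \<in> (\<lambda>h. h \<circ> e) ` mod_hom A N N'"
    then obtain k where k: "k \<in> mod_hom A N N'" "h = k \<circ> e" by blast
    have h: "h \<in> mod_hom A P0 N'" using mod_hom_comp[OF N e k(1)] k(2) by simp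
    have "h \<circ> d1 = 0"
    proof
      fix x
      have "e (d1 x) = 0"
      proof (cases "x \<in> vecs P1")
        case False
        show ?thesis unfolding mod_hom_out[OF d1 False] by (rule mod_hom_zero[OF f(1) e])
      qed (use ex in blast)
      then show "(h \<circ> d1) x = 0 x" using mod_hom_zero[OF N k(1)]
        unfolding k(2) comp_apply zero_fun_apply by (simp only:)
    qed
    with h show "h \<in> {h\<in>mod_hom A P0 N'. h \<circ> d1 = 0}" by blast
  next
    fix h assume "h \<in> {h\<in>mod_hom A P0 N'. h \<circ> d1 = 0}"
    then have h: "h \<in> mod_hom A P0 N'" and hd: "h (d1 x) = 0" for x by (auto dest: fun_cong)
    let ?i = "inv_into (vecs P0) e"
    have i: "?i x \<in> vecs P0" "e (?i x) = x" if "x \<in> vecs N" for x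
      using that se inv_into_into[of x e "vecs P0"] f_inv_into_f[of x e "vecs P0"] by auto
    \<comment> \<open>Because \<open>h\<close> kills the kernel of \<open>e\<close>, its value at
      the preimage chosen by \<open>?i\<close> is independent of the choice; this is what makes the
      factor linear.\<close>
    have he: "h x = h y" if "x \<in> vecs P0" "y \<in> vecs P0" "e x = e y" for x y
    proof -
      have "e (x - y) = 0" using mod_hom_diff[OF f(1) e that(1,2)] that(3) by simp
      then have "x - y \<in> d1 ` vecs P1"
        using vs.subspace_diff[OF fd_modules_subspace[OF f(1)] that(1,2)] ex by blast
      then have "h (x - y) = 0" using hd by (metis imageE)
      then show ?thesis using mod_hom_diff[OF f(1) h that(1,2)] by simp
    qed
    define k where "k x = (if x \<in> vecs N then h (?i x) else 0)" for x
    have "k \<in> mod_hom A N N'"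
      unfolding k_def
    proof (rule mod_homI[OF N])
      show "h (?i x) \<in> vecs N'" for x by (rule mod_hom_range[OF N' h])
      show "linear_on vscale vscale (vecs N) (\<lambda>x. h (?i x))"
        unfolding linear_on_def
      proof (intro conjI ballI allI)
        fix x y assume x: "x \<in> vecs N" and y: "y \<in> vecs N"
        have xy: "x + y \<in> vecs N" by (rule vs.subspace_add[OF fd_modules_subspace[OF N] x y])
        have "h (?i (x + y)) = h (?i x + ?i y)"
          by (rule he[OF i(1)[OF xy] vs.subspace_add[OF fd_modules_subspace[OF f(1)] i(1)[OF x] i(1)[OF y]]])
            (simp add: i(2)[OF xy] mod_hom_add[OF e i(1)[OF x] i(1)[OF y]] i(2)[OF x] i(2)[OF y])
        then show "h (?i (x + y)) = h (?i x) + h (?i y)"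
          using mod_hom_add[OF h i(1)[OF x] i(1)[OF y]] by simp
      next
        fix c x assume x: "x \<in> vecs N"
        have cx: "vscale c x \<in> vecs N" by (rule vs.subspace_scale[OF fd_modules_subspace[OF N] x])
        have "h (?i (vscale c x)) = h (vscale c (?i x))"
          by (rule he[OF i(1)[OF cx] vs.subspace_scale[OF fd_modules_subspace[OF f(1)] i(1)[OF x]]])
            (simp add: i(2)[OF cx] linear_on_scale[OF mod_hom_linear[OF e] i(1)[OF x]] i(2)[OF x])
        then show "h (?i (vscale c x)) = vscale c (h (?i x))"
          using linear_on_scale[OF mod_hom_linear[OF h] i(1)[OF x]] by simp
      qed
      fix x a assume x: "x \<in> vecs N" and a: "a \<in> alg_carrier A"
      note xa = fd_modules_act[OF N x a]
      have "h (?i (act N x a)) = h (act P0 (?i x) a)"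
        by (rule he[OF i(1)[OF xa] fd_modules_act[OF f(1) i(1)[OF x] a]])
          (simp add: i(2)[OF xa] mod_hom_act[OF e i(1)[OF x] a] i(2)[OF x])
      then show "h (?i (act N x a)) = act N' (h (?i x)) a"
        using mod_hom_act[OF h i(1)[OF x] a] by simp
    qed
    moreover have "h = k \<circ> e"
    proof (rule mod_hom_eqI[OF h mod_hom_comp[OF N e \<open>k \<in> _\<close>]])
      fix x assume x: "x \<in> vecs P0"
      have "h x = h (?i (e x))"
        by (rule he[OF x i(1)[OF mod_hom_in[OF e x]]]) (simp add: i(2)[OF mod_hom_in[OF e x]])
      then show "h x = (k \<circ> e) x" using mod_hom_in[OF e x] by (simp add: k_def)
    qed
    ultimately show "h \<in> (\<lambda>h. h \<circ> e) ` mod_hom A N N'" by blast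
  qed
  ultimately show ?thesis
    using ms.rank_nullity(2)[OF vector_space_mscale mod_hom_fd[OF f(1) N'] precomp_linear, of d1] by simp
qed

text \<open>The comparison of resolutions in both directions makes the definite description
  single-valued; \<open>coboundary_dim_le\<close> ensures that the subtraction of natural numbers
  does not truncate.\<close>

lemma ext1_dim_resolution:
  assumes N: "N \<in> fd_modules A" and N': "N' \<in> fd_modules A" and P: "proj_resolution A N P0 P1 P2 e d1 d2"
  shows "ext1_dim A N N' = mor_dim (vanishing_hom P1 (d2 ` vecs P2) N')
     - mor_dim ((\<lambda>h. h \<circ> d1) ` mod_hom A P0 N')"
proof -
  have v: "{f\<in>mod_hom A P1 N'. \<forall>x\<in>vecs P2. f (d2 x) = 0} = vanishing_hom P1 (d2 ` vecs P2) N'" for P1 P2 d2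
    by (auto simp: vanishing_hom_def)
  show ?thesis
    unfolding ext1_dim_def v
  proof (rule the_equality)
    fix n assume "\<exists>Q0 Q1 Q2 e' d1' d2'. proj_resolution A N Q0 Q1 Q2 e' d1' d2' \<and>
      n = mor_dim (vanishing_hom Q1 (d2' ` vecs Q2) N') - mor_dim ((\<lambda>h. h \<circ> d1') ` mod_hom A Q0 N')"
    then obtain Q0 Q1 Q2 e' d1' d2' where Q: "proj_resolution A N Q0 Q1 Q2 e' d1' d2'" and
      n: "n = mor_dim (vanishing_hom Q1 (d2' ` vecs Q2) N') - mor_dim ((\<lambda>h. h \<circ> d1') ` mod_hom A Q0 N')"
      by blast
    show "n = mor_dim (vanishing_hom P1 (d2 ` vecs P2) N') - mor_dim ((\<lambda>h. h \<circ> d1) ` mod_hom A P0 N')"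
      using resolution_comparison[OF N N' P Q] resolution_comparison[OF N N' Q P]
        coboundary_dim_le[OF N' P] coboundary_dim_le[OF N' Q] n by linarith
  qed (use P in blast)
qed

text \<open>The coboundaries occur once in \<open>dim Hom(P0, N')\<close> and once in the dimension
  of the cocycles, and cancel. Both remaining terms are left exact in \<open>N'\<close>, which makes
  additivity on direct sums immediate.\<close>

lemma euler_form_resolution:
  assumes N: "N \<in> fd_modules A" and N': "N' \<in> fd_modules A" and P: "proj_resolution A N P0 P1 P2 e d1 d2"
  shows "euler_form A N N' =
    int (mor_dim (mod_hom A P0 N')) - int (mor_dim (vanishing_hom P1 (d2 ` vecs P2) N'))"
  using hom_dim_resolution[OF assms] coboundary_dim_le[OF assms(2,3)]
  unfolding euler_form_def ext1_dim_resolution[OF assms] by simp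

end

section \<open>Exact sequences in a triangulated category\<close>

sublocale linear_category \<subseteq> m: vector_space "Scale C" by (rule vector_space_mor)

section \<open>Bilinear composition and retracts of powers of an object\<close>

context linear_category
begin

lemma Hom_zero: "0 \<in> Hom C X Y"
  by (rule m.subspace_0[OF subspace_Hom])

lemma Hom_add: "f \<in> Hom C X Y \<Longrightarrow> g \<in> Hom C X Y \<Longrightarrow> f + g \<in> Hom C X Y"
  by (rule m.subspace_add[OF subspace_Hom])

lemma Hom_diff: "f \<in> Hom C X Y \<Longrightarrow> g \<in> Hom C X Y \<Longrightarrow> f - g \<in> Hom C X Y"
  by (rule m.subspace_diff[OF subspace_Hom])

lemma Hom_neg: "f \<in> Hom C X Y \<Longrightarrow> - f \<in> Hom C X Y"
  by (rule m.subspace_neg[OF subspace_Hom])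

lemma Hom_scale: "f \<in> Hom C X Y \<Longrightarrow> Scale C c f \<in> Hom C X Y"
  by (rule m.subspace_scale[OF subspace_Hom])

lemma Hom_sum: "(\<And>i. i \<in> I \<Longrightarrow> f i \<in> Hom C X Y) \<Longrightarrow> sum f I \<in> Hom C X Y"
  by (rule m.subspace_sum[OF subspace_Hom])

lemma Comp_add_left:
  "f \<in> Hom C X Y \<Longrightarrow> g \<in> Hom C Y Z \<Longrightarrow> h \<in> Hom C Y Z \<Longrightarrow> (g + h) \<cdot> f = g \<cdot> f + h \<cdot> f"
  by (rule linear_on_add[OF linear_Comp_left])

lemma Comp_add_right:
  "g \<in> Hom C Y Z \<Longrightarrow> f \<in> Hom C X Y \<Longrightarrow> h \<in> Hom C X Y \<Longrightarrow> g \<cdot> (f + h) = g \<cdot> f + g \<cdot> h"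
  by (rule linear_on_add[OF linear_Comp_right])

lemma Comp_zero_left: "f \<in> Hom C X Y \<Longrightarrow> 0 \<cdot> f = 0"
  by (rule linear_on_zero[OF linear_Comp_left Hom_zero])

lemma Comp_zero_right: "g \<in> Hom C Y Z \<Longrightarrow> g \<cdot> 0 = 0"
  by (rule linear_on_zero[OF linear_Comp_right Hom_zero])

lemma Comp_neg_left: "f \<in> Hom C X Y \<Longrightarrow> g \<in> Hom C Y Z \<Longrightarrow> (- g) \<cdot> f = - (g \<cdot> f)"
  by (rule m.linear_on_neg[OF linear_Comp_left subspace_Hom])

lemma Comp_neg_right: "g \<in> Hom C Y Z \<Longrightarrow> f \<in> Hom C X Y \<Longrightarrow> g \<cdot> (- f) = - (g \<cdot> f)"
  by (rule m.linear_on_neg[OF linear_Comp_right subspace_Hom])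

lemma Comp_diff_right:
  "g \<in> Hom C Y Z \<Longrightarrow> f \<in> Hom C X Y \<Longrightarrow> h \<in> Hom C X Y \<Longrightarrow> g \<cdot> (f - h) = g \<cdot> f - g \<cdot> h"
  by (rule m.linear_on_diff[OF linear_Comp_right subspace_Hom])

lemma Comp_sum_left:
  "f \<in> Hom C X Y \<Longrightarrow> (\<And>i. i \<in> I \<Longrightarrow> g i \<in> Hom C Y Z) \<Longrightarrow> (\<Sum>i\<in>I. g i) \<cdot> f = (\<Sum>i\<in>I. g i \<cdot> f)"
  by (rule m.linear_on_sum[OF linear_Comp_left subspace_Hom])

lemma Comp_sum_right:
  "g \<in> Hom C Y Z \<Longrightarrow> (\<And>i. i \<in> I \<Longrightarrow> f i \<in> Hom C X Y) \<Longrightarrow> g \<cdot> (\<Sum>i\<in>I. f i) = (\<Sum>i\<in>I. g \<cdot> f i)"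
  by (rule m.linear_on_sum[OF linear_Comp_right subspace_Hom])

lemma Comp_scale_left: "f \<in> Hom C X Y \<Longrightarrow> g \<in> Hom C Y Z \<Longrightarrow> Scale C c g \<cdot> f = Scale C c (g \<cdot> f)"
  by (rule linear_on_scale[OF linear_Comp_left])

lemma Comp_scale_right: "g \<in> Hom C Y Z \<Longrightarrow> f \<in> Hom C X Y \<Longrightarrow> g \<cdot> Scale C c f = Scale C c (g \<cdot> f)"
  by (rule linear_on_scale[OF linear_Comp_right])

text \<open>A decomposition of the identity into maps through \<open>T\<close> exhibits
  \<open>S\<close> as a retract of a power of \<open>T\<close> without naming that power or a
  complement. In this form membership passes easily to suspensions and biproducts, and maps from or
  to \<open>S\<close> can be tested on \<open>T\<close>.\<close>

definition in_add :: "'o \<Rightarrow> 'o \<Rightarrow> bool" where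
  "in_add T S \<longleftrightarrow> (\<exists>n \<iota> \<pi>. (\<forall>i<n. \<iota> i \<in> Hom C T S \<and> \<pi> i \<in> Hom C S T) \<and>
     (\<Sum>i<(n::nat). \<iota> i \<cdot> \<pi> i) = Id C S)"

lemma in_addI:
  "(\<And>i. i < (n::nat) \<Longrightarrow> \<iota> i \<in> Hom C T S) \<Longrightarrow> (\<And>i. i < n \<Longrightarrow> \<pi> i \<in> Hom C S T) \<Longrightarrow>
    (\<Sum>i<n. \<iota> i \<cdot> \<pi> i) = Id C S \<Longrightarrow> in_add T S"
  unfolding in_add_def by (intro exI[of _ n] exI[of _ \<iota>] exI[of _ \<pi>]) simp

lemma in_addE:
  assumes "in_add T S"
  obtains n \<iota> \<pi> where "\<forall>i<(n::nat). \<iota> i \<in> Hom C T S \<and> \<pi> i \<in> Hom C S T" "(\<Sum>i<n. \<iota> i \<cdot> \<pi> i) = Id C S"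
  using assms unfolding in_add_def by blast

lemma in_add_expand_from:
  assumes "\<And>i. i < (n::nat) \<Longrightarrow> \<iota> i \<in> Hom C T S" "\<And>i. i < n \<Longrightarrow> \<pi> i \<in> Hom C S T"
    "(\<Sum>i<n. \<iota> i \<cdot> \<pi> i) = Id C S" and f: "f \<in> Hom C S Y"
  shows "f = (\<Sum>i<n. (f \<cdot> \<iota> i) \<cdot> \<pi> i)"
proof -
  have "f = f \<cdot> (\<Sum>i<n. \<iota> i \<cdot> \<pi> i)" unfolding assms(3) by (rule Comp_Id[OF f, symmetric])
  also have "\<dots> = (\<Sum>i<n. f \<cdot> (\<iota> i \<cdot> \<pi> i))"
    by (rule Comp_sum_right[OF f]) (auto intro: Comp_closed[OF assms(2,1)])
  also have "\<dots> = (\<Sum>i<n. (f \<cdot> \<iota> i) \<cdot> \<pi> i)"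
    by (intro sum.cong refl) (simp add: Comp_assoc[OF assms(2) assms(1) f])
  finally show ?thesis .
qed

lemma in_add_expand_to:
  assumes "\<And>i. i < (n::nat) \<Longrightarrow> \<iota> i \<in> Hom C T S" "\<And>i. i < n \<Longrightarrow> \<pi> i \<in> Hom C S T"
    "(\<Sum>i<n. \<iota> i \<cdot> \<pi> i) = Id C S" and f: "f \<in> Hom C Y S"
  shows "f = (\<Sum>i<n. \<iota> i \<cdot> (\<pi> i \<cdot> f))"
proof -
  have "f = (\<Sum>i<n. \<iota> i \<cdot> \<pi> i) \<cdot> f" unfolding assms(3) by (rule Id_Comp[OF f, symmetric])
  also have "\<dots> = (\<Sum>i<n. (\<iota> i \<cdot> \<pi> i) \<cdot> f)"
    by (rule Comp_sum_left[OF f]) (auto intro: Comp_closed[OF assms(2,1)])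
  also have "\<dots> = (\<Sum>i<n. \<iota> i \<cdot> (\<pi> i \<cdot> f))"
    by (intro sum.cong refl) (simp add: Comp_assoc[OF f assms(2) assms(1)])
  finally show ?thesis .
qed

lemma in_add_zero_from:
  assumes "in_add T S" and f: "f \<in> Hom C S Y" and z: "\<And>t. t \<in> Hom C T S \<Longrightarrow> f \<cdot> t = 0"
  shows "f = 0"
proof -
  obtain n \<iota> \<pi> where a': "\<forall>i<(n::nat). \<iota> i \<in> Hom C T S \<and> \<pi> i \<in> Hom C S T"
    "(\<Sum>i<n. \<iota> i \<cdot> \<pi> i) = Id C S" by (rule in_addE[OF assms(1)])
  then have a: "\<And>i. i < n \<Longrightarrow> \<iota> i \<in> Hom C T S" "\<And>i. i < n \<Longrightarrow> \<pi> i \<in> Hom C S T"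
    "(\<Sum>i<n. \<iota> i \<cdot> \<pi> i) = Id C S" by simp_all
  have "f = (\<Sum>i<n. (f \<cdot> \<iota> i) \<cdot> \<pi> i)" by (rule in_add_expand_from[OF a f])
  also have "\<dots> = 0"
    by (rule sum.neutral) (use z a(1) a(2)[THEN Comp_zero_left] in auto)
  finally show ?thesis .
qed

lemma in_add_zero_to:
  assumes "in_add T S" and f: "f \<in> Hom C Y S" and z: "\<And>t. t \<in> Hom C S T \<Longrightarrow> t \<cdot> f = 0"
  shows "f = 0"
proof -
  obtain n \<iota> \<pi> where a': "\<forall>i<(n::nat). \<iota> i \<in> Hom C T S \<and> \<pi> i \<in> Hom C S T"
    "(\<Sum>i<n. \<iota> i \<cdot> \<pi> i) = Id C S" by (rule in_addE[OF assms(1)])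
  then have a: "\<And>i. i < n \<Longrightarrow> \<iota> i \<in> Hom C T S" "\<And>i. i < n \<Longrightarrow> \<pi> i \<in> Hom C S T"
    "(\<Sum>i<n. \<iota> i \<cdot> \<pi> i) = Id C S" by simp_all
  have "f = (\<Sum>i<n. \<iota> i \<cdot> (\<pi> i \<cdot> f))" by (rule in_add_expand_to[OF a f])
  also have "\<dots> = 0"
    by (rule sum.neutral) (use z a(2) a(1)[THEN Comp_zero_right] in auto)
  finally show ?thesis .
qed

lemma in_add_zero_object:
  assumes "zero_object C Z"
  shows "in_add T Z"
proof -
  have "Id C Z = 0" using assms Id_closed[of Z] by (auto simp: zero_object_def)
  then show ?thesis unfolding in_add_def by (intro exI[of _ 0]) simp
qed

lemma biproductE:
  assumes "is_biproduct C X Y Z"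
  obtains i1 i2 p1 p2 where "i1 \<in> Hom C X Z" "i2 \<in> Hom C Y Z" "p1 \<in> Hom C Z X" "p2 \<in> Hom C Z Y"
    "p1 \<cdot> i1 = Id C X" "p2 \<cdot> i2 = Id C Y" "p1 \<cdot> i2 = 0" "p2 \<cdot> i1 = 0" "i1 \<cdot> p1 + i2 \<cdot> p2 = Id C Z"
proof -
  obtain \<iota> \<pi> where 1: "\<forall>i<2. \<iota> i \<in> Hom C (if i = 0 then X else Y) Z \<and> \<pi> i \<in> Hom C Z (if i = 0 then X else Y)"
    and 2: "\<forall>i<2. \<forall>j<2. \<pi> i \<cdot> \<iota> j = (if i = j then Id C (if i = 0 then X else Y) else 0)"
    and 3: "(\<Sum>i<(2::nat). \<iota> i \<cdot> \<pi> i) = Id C Z"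
    using assms[unfolded is_biproduct_def is_direct_sum_def] by (elim exE conjE)
  show ?thesis
  proof (rule that[of "\<iota> 0" "\<iota> 1" "\<pi> 0" "\<pi> 1"])
    show "\<iota> 0 \<in> Hom C X Z" "\<pi> 0 \<in> Hom C Z X" using 1[rule_format, of 0] by simp_all
    show "\<iota> 1 \<in> Hom C Y Z" "\<pi> 1 \<in> Hom C Z Y" using 1[rule_format, of 1] by simp_all
    show "\<pi> 0 \<cdot> \<iota> 0 = Id C X" using 2[rule_format, of 0 0] by simp
    show "\<pi> 1 \<cdot> \<iota> 1 = Id C Y" using 2[rule_format, of 1 1] by simp
    show "\<pi> 0 \<cdot> \<iota> 1 = 0" using 2[rule_format, of 0 1] by simp
    show "\<pi> 1 \<cdot> \<iota> 0 = 0" using 2[rule_format, of 1 0] by simp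
    show "\<iota> 0 \<cdot> \<pi> 0 + \<iota> 1 \<cdot> \<pi> 1 = Id C Z" using 3 by (simp add: numeral_2_eq_2)
  qed
qed

lemma in_add_biproduct:
  assumes S: "in_add T S" and h: "i1 \<in> Hom C S Z" "i2 \<in> Hom C T Z" "p1 \<in> Hom C Z S" "p2 \<in> Hom C Z T"
    and e: "i1 \<cdot> p1 + i2 \<cdot> p2 = Id C Z"
  shows "in_add T Z"
proof -
  obtain n \<iota> \<pi> where a': "\<forall>i<(n::nat). \<iota> i \<in> Hom C T S \<and> \<pi> i \<in> Hom C S T"
    "(\<Sum>i<n. \<iota> i \<cdot> \<pi> i) = Id C S" by (rule in_addE[OF S])
  then have a: "\<And>i. i < n \<Longrightarrow> \<iota> i \<in> Hom C T S" "\<And>i. i < n \<Longrightarrow> \<pi> i \<in> Hom C S T"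
    "(\<Sum>i<n. \<iota> i \<cdot> \<pi> i) = Id C S" by simp_all
  have "i1 \<cdot> p1 = (\<Sum>i<n. (i1 \<cdot> \<iota> i) \<cdot> \<pi> i) \<cdot> p1"
    by (rule arg_cong[OF in_add_expand_from[OF a h(1)], of "\<lambda>x. x \<cdot> p1"])
  also have "\<dots> = (\<Sum>i<n. ((i1 \<cdot> \<iota> i) \<cdot> \<pi> i) \<cdot> p1)"
    by (rule Comp_sum_left[OF h(3)]) (auto intro: Comp_closed[OF a(2) Comp_closed[OF a(1) h(1)]])
  also have "\<dots> = (\<Sum>i<n. (i1 \<cdot> \<iota> i) \<cdot> (\<pi> i \<cdot> p1))"
  proof (intro sum.cong refl)
    fix i assume "i \<in> {..<n}"
    then show "((i1 \<cdot> \<iota> i) \<cdot> \<pi> i) \<cdot> p1 = (i1 \<cdot> \<iota> i) \<cdot> (\<pi> i \<cdot> p1)"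
      using Comp_assoc[OF h(3) a(2) Comp_closed[OF a(1) h(1)], of i i] by simp
  qed
  finally have p: "i1 \<cdot> p1 = (\<Sum>i<n. (i1 \<cdot> \<iota> i) \<cdot> (\<pi> i \<cdot> p1))" .
  define \<iota>' where "\<iota>' i = (if i < n then i1 \<cdot> \<iota> i else i2)" for i
  define \<pi>' where "\<pi>' i = (if i < n then \<pi> i \<cdot> p1 else p2)" for i
  have "(\<Sum>i<Suc n. \<iota>' i \<cdot> \<pi>' i) = (\<Sum>i<n. \<iota>' i \<cdot> \<pi>' i) + i2 \<cdot> p2"
    by (simp add: \<iota>'_def \<pi>'_def)
  also have "(\<Sum>i<n. \<iota>' i \<cdot> \<pi>' i) = i1 \<cdot> p1"
    unfolding p by (intro sum.cong refl) (simp add: \<iota>'_def \<pi>'_def)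
  finally have "(\<Sum>i<Suc n. \<iota>' i \<cdot> \<pi>' i) = Id C Z" using e by (rule trans)
  moreover have "\<iota>' i \<in> Hom C T Z \<and> \<pi>' i \<in> Hom C Z T" for i
    using h Comp_closed[OF a(1) h(1), of i] Comp_closed[OF h(3) a(2), of i]
    by (cases "i < n") (simp_all add: \<iota>'_def \<pi>'_def)
  ultimately show ?thesis unfolding in_add_def by (intro exI[of _ "Suc n"] exI[of _ \<iota>'] exI[of _ \<pi>']) simp
qed

lemma in_add_closure:
  assumes "X \<in> add_closure C T"
  shows "in_add T X"
proof -
  obtain n Y Z where Z: "is_direct_sum C n (\<lambda>_. T) Z" "is_biproduct C X Y Z"
    using assms unfolding add_closure_def mem_Collect_eq by (elim exE conjE)
  obtain \<iota> \<pi> where a: "\<forall>i<n. \<iota> i \<in> Hom C T Z \<and> \<pi> i \<in> Hom C Z T"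
    "\<forall>i<n. \<forall>j<n. \<pi> i \<cdot> \<iota> j = (if i = j then Id C T else 0)" "(\<Sum>i<n. \<iota> i \<cdot> \<pi> i) = Id C Z"
    using Z(1)[unfolded is_direct_sum_def] by (elim exE conjE)
  have \<iota>\<pi>: "\<iota> i \<in> Hom C T Z" "\<pi> i \<in> Hom C Z T" if "i < n" for i using a(1) that by simp_all
  obtain i1 i2 p1 p2 where h: "i1 \<in> Hom C X Z" "p1 \<in> Hom C Z X" "p1 \<cdot> i1 = Id C X"
    by (rule biproductE[OF Z(2)]) (rule that)
  have "p1 = (\<Sum>i<n. (p1 \<cdot> \<iota> i) \<cdot> \<pi> i)" by (rule in_add_expand_from[OF _ _ a(3) h(2)]) (use a(1) in auto)
  then have "Id C X = (\<Sum>i<n. (p1 \<cdot> \<iota> i) \<cdot> \<pi> i) \<cdot> i1"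
    unfolding h(3)[symmetric] by (rule arg_cong[of _ _ "\<lambda>x. x \<cdot> i1"])
  also have "\<dots> = (\<Sum>i<n. ((p1 \<cdot> \<iota> i) \<cdot> \<pi> i) \<cdot> i1)"
    by (rule Comp_sum_left[OF h(1)]) (auto intro: Comp_closed[OF \<iota>\<pi>(2) Comp_closed[OF \<iota>\<pi>(1) h(2)]])
  also have "\<dots> = (\<Sum>i<n. (p1 \<cdot> \<iota> i) \<cdot> (\<pi> i \<cdot> i1))"
    by (intro sum.cong refl) (simp add: Comp_assoc[OF h(1) \<iota>\<pi>(2) Comp_closed[OF \<iota>\<pi>(1) h(2)]])
  finally have e: "Id C X = (\<Sum>i<n. (p1 \<cdot> \<iota> i) \<cdot> (\<pi> i \<cdot> i1))" .
  show ?thesis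
    by (rule in_addI[OF Comp_closed[OF \<iota>\<pi>(1) h(2)] Comp_closed[OF h(1) \<iota>\<pi>(2)] e[symmetric]])
qed

end

section \<open>Hom functors applied to distinguished triangles\<close>

context triangulated_category
begin

abbreviation S :: "'o \<Rightarrow> 'o" where "S \<equiv> Susp C"
abbreviation SM :: "'m \<Rightarrow> 'm" where "SM \<equiv> SuspM C"

lemma SM_closed: "f \<in> Hom C X Y \<Longrightarrow> SM f \<in> Hom C (S X) (S Y)"
  by (rule bij_betw_apply[OF bij_SuspM])

lemma SM_inj: "f \<in> Hom C X Y \<Longrightarrow> g \<in> Hom C X Y \<Longrightarrow> SM f = SM g \<Longrightarrow> f = g"
  by (rule inj_onD[OF bij_betw_imp_inj_on[OF bij_SuspM]])

lemma SM_surj: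
  assumes "h \<in> Hom C (S X) (S Y)"
  obtains f where "f \<in> Hom C X Y" "h = SM f"
proof -
  have "h \<in> SM ` Hom C X Y" using assms bij_betw_imp_surj_on[OF bij_SuspM] by simp
  then show ?thesis using that by (elim imageE)
qed

lemma SM_zero: "SM 0 = 0"
  by (rule linear_on_zero[OF linear_SuspM Hom_zero])

lemma SM_neg: "f \<in> Hom C X Y \<Longrightarrow> SM (- f) = - SM f"
  by (rule m.linear_on_neg[OF linear_SuspM subspace_Hom])

lemma SM_eq_zero: "f \<in> Hom C X Y \<Longrightarrow> SM f = 0 \<Longrightarrow> f = 0"
  using SM_inj[OF _ Hom_zero] SM_zero by simp

lemma zero_object_Susp:
  assumes "zero_object C Z"
  shows "zero_object C (S Z)"
proof -
  have "Id C Z = 0" using assms Id_closed[of Z] by (auto simp: zero_object_def)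
  then have I: "Id C (S Z) = 0" using SuspM_Id[of Z] SM_zero by simp
  have "f = 0" if "f \<in> Hom C X (S Z)" for f X using Id_Comp[OF that] Comp_zero_left[OF that] I by simp
  moreover have "f = 0" if "f \<in> Hom C (S Z) X" for f X using Comp_Id[OF that] Comp_zero_right[OF that] I by simp
  ultimately show ?thesis unfolding zero_object_def using Hom_zero by blast
qed

lemma in_add_Susp:
  assumes "in_add T X"
  shows "in_add (S T) (S X)"
proof -
  obtain n \<iota> \<pi> where a': "\<forall>i<(n::nat). \<iota> i \<in> Hom C T X \<and> \<pi> i \<in> Hom C X T"
    "(\<Sum>i<n. \<iota> i \<cdot> \<pi> i) = Id C X" by (rule in_addE[OF assms])
  then have a: "\<And>i. i < n \<Longrightarrow> \<iota> i \<in> Hom C T X" "\<And>i. i < n \<Longrightarrow> \<pi> i \<in> Hom C X T"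
    "(\<Sum>i<n. \<iota> i \<cdot> \<pi> i) = Id C X" by simp_all
  have "Id C (S X) = SM (\<Sum>i<n. \<iota> i \<cdot> \<pi> i)" using a(3) SuspM_Id by simp
  also have "\<dots> = (\<Sum>i<n. SM (\<iota> i \<cdot> \<pi> i))"
    by (rule m.linear_on_sum[OF linear_SuspM subspace_Hom]) (auto intro: Comp_closed[OF a(2,1)])
  also have "\<dots> = (\<Sum>i<n. SM (\<iota> i) \<cdot> SM (\<pi> i))"
    by (intro sum.cong refl) (simp add: SuspM_Comp[OF a(2,1)])
  finally have e: "Id C (S X) = (\<Sum>i<n. SM (\<iota> i) \<cdot> SM (\<pi> i))" .
  show ?thesis by (rule in_addI[OF SM_closed[OF a(1)] SM_closed[OF a(2)] e[symmetric]])
qed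

lemma Dist_in:
  assumes "Dist C X Y Z u v w"
  shows "u \<in> Hom C X Y" "v \<in> Hom C Y Z" "w \<in> Hom C Z (S X)"
  using Dist_Hom[OF assms] by auto

lemma Dist_rot:
  assumes "Dist C X Y Z u v w"
  shows "Dist C Y Z (S X) v w (- SM u)"
  using Dist_rotate[OF Dist_in[OF assms]] assms by simp

lemma Dist_comp_zero:
  assumes "Dist C X Y Z u v w"
  shows "v \<cdot> u = 0"
proof -
  obtain Z0 where Z0: "zero_object C Z0" using ex_zero_object by blast
  note h = Dist_in[OF assms]
  obtain c where "c \<in> Hom C Z0 Z" "v \<cdot> u = c \<cdot> 0"
    using Dist_morphism[OF Dist_Id[OF Z0] assms Id_closed h(1)] Comp_Id[OF h(1)] by auto
  then show ?thesis using Comp_zero_right by simp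
qed

lemma Dist_Susp_comp_zero:
  assumes "Dist C X Y Z u v w"
  shows "SM u \<cdot> w = 0"
  using Dist_comp_zero[OF Dist_rot[OF Dist_rot[OF assms]]]
    Comp_neg_left[OF Dist_in(3)[OF assms] SM_closed[OF Dist_in(1)[OF assms]]] by simp

text \<open>The completion axiom produces the third component of a morphism of triangles. The
  trivial triangle on \<open>A\<close> is therefore rotated to
  \<open>A \<rightarrow> 0 \<rightarrow> \<Sigma>A\<close>; the filler is a map
  \<open>\<Sigma>A \<rightarrow> \<Sigma>X\<close>, which comes from a map
  \<open>A \<rightarrow> X\<close> by fullness of the suspension. The two minus signs
  cancel.\<close>

lemma Dist_exact_cov:
  assumes D: "Dist C X Y Z u v w" and g: "g \<in> Hom C A Y" and z: "v \<cdot> g = 0"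
  obtains f where "f \<in> Hom C A X" "g = u \<cdot> f"
proof -
  obtain Z0 where Z0: "zero_object C Z0" using ex_zero_object by blast
  note h = Dist_in[OF D]
  have D2: "Dist C A Z0 (S A) 0 0 (- SM (Id C A))" by (rule Dist_rot[OF Dist_Id[OF Z0]])
  have "v \<cdot> g = 0 \<cdot> 0" using z Comp_zero_right[OF Hom_zero] by simp
  from Dist_morphism[OF D2 Dist_rot[OF D] g Hom_zero this]
  obtain c where c: "c \<in> Hom C (S A) (S X)" "(- SM u) \<cdot> c = SM g \<cdot> (- SM (Id C A))" by blast
  obtain f where f: "f \<in> Hom C A X" "c = SM f" by (rule SM_surj[OF c(1)])
  have "SM g \<cdot> SM (Id C A) = SM u \<cdot> SM f"
    using c(2) f Comp_neg_left[OF SM_closed[OF f(1)] SM_closed[OF h(1)]]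
      Comp_neg_right[OF SM_closed[OF g] SM_closed[OF Id_closed]] by simp
  then have "SM (g \<cdot> Id C A) = SM (u \<cdot> f)"
    using SuspM_Comp[OF Id_closed g] SuspM_Comp[OF f(1) h(1)] by simp
  then have "SM g = SM (u \<cdot> f)" using Comp_Id[OF g] by simp
  then have "g = u \<cdot> f" using SM_inj[OF g Comp_closed[OF f(1) h(1)]] by simp
  with f(1) show ?thesis by (rule that)
qed

text \<open>Backward rotation applies when the third vertex is literally a suspension. Hence the
  trivial triangle on \<open>A\<close> is taken with the zero object \<open>\<Sigma>Z0\<close>; it
  becomes \<open>Z0 \<rightarrow> A \<rightarrow> A \<rightarrow> \<Sigma>Z0\<close>, and the filler
  for the square formed by \<open>0\<close> and \<open>g\<close> is the factorization.\<close>

lemma Dist_exact_contra: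
  assumes D: "Dist C X Y Z u v w" and g: "g \<in> Hom C Y A" and z: "g \<cdot> u = 0"
  obtains f where "f \<in> Hom C Z A" "g = f \<cdot> v"
proof -
  obtain Z0 where Z0: "zero_object C Z0" using ex_zero_object by blast
  note h = Dist_in[OF D]
  have "Dist C A A (S Z0) (Id C A) 0 (- SM 0)"
    using Dist_Id[OF zero_object_Susp[OF Z0], of A] SM_zero by simp
  then have "Dist C Z0 A A 0 (Id C A) 0"
    using Dist_rotate[OF Hom_zero[of Z0 A] Id_closed[of A] Hom_zero[of A "S Z0"]] by simp
  from Dist_morphism[OF D this Hom_zero g]
  obtain c where "c \<in> Hom C Z A" "Id C A \<cdot> g = c \<cdot> v"
    using z Comp_zero_left[OF Hom_zero] by auto
  then show ?thesis using that Id_Comp[OF g] by simp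
qed

text \<open>Three rotations suspend a triangle and reverse the signs of all its maps; six suspend it
  twice and restore them.\<close>

lemma Dist_Susp2:
  assumes D: "Dist C X Y Z u v w"
  shows "Dist C (S (S X)) (S (S Y)) (S (S Z)) (SM (SM u)) (SM (SM v)) (SM (SM w))"
proof -
  note h = Dist_in[OF D]
  have "Dist C (S X) (S Y) (S Z) (- SM u) (- SM v) (- SM w)"
    by (rule Dist_rot[OF Dist_rot[OF Dist_rot[OF D]]])
  then have "Dist C (S (S X)) (S (S Y)) (S (S Z)) (- SM (- SM u)) (- SM (- SM v)) (- SM (- SM w))"
    by (rule Dist_rot[OF Dist_rot[OF Dist_rot]])
  then show ?thesis
    using SM_neg[OF SM_closed[OF h(1)]] SM_neg[OF SM_closed[OF h(2)]] SM_neg[OF SM_closed[OF h(3)]] by simp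
qed

text \<open>Essential surjectivity of the suspension, used twice, replaces the third vertex by an
  isomorphic double suspension. A coresolution of \<open>W\<close> then becomes, after
  \<open>Dist_Susp2\<close>, a triangle starting at that vertex.\<close>

lemma Dist_to_Susp2:
  assumes D: "Dist C X Y Z u v w"
  obtains W v' w' where "Dist C X Y (S (S W)) u v' w'"
proof -
  note h = Dist_in[OF D]
  obtain V f where f: "iso_mor C (S V) Z f" using Susp_ess_surj by blast
  obtain W g where g: "iso_mor C (S W) V g" using Susp_ess_surj by blast
  obtain f' where f': "f \<in> Hom C (S V) Z" "f' \<in> Hom C Z (S V)" "f' \<cdot> f = Id C (S V)" "f \<cdot> f' = Id C Z"
    using f by (auto simp: iso_mor_def)
  obtain g' where g': "g \<in> Hom C (S W) V" "g' \<in> Hom C V (S W)" "g' \<cdot> g = Id C (S W)" "g \<cdot> g' = Id C V"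
    using g by (auto simp: iso_mor_def)
  let ?c = "SM g' \<cdot> f'" and ?c' = "f \<cdot> SM g"
  have c: "?c \<in> Hom C Z (S (S W))" "?c' \<in> Hom C (S (S W)) Z"
    using Comp_closed SM_closed f' g' by blast+
  have "?c' \<cdot> ?c = f \<cdot> (SM g \<cdot> (SM g' \<cdot> f'))"
    by (rule Comp_assoc[OF c(1) SM_closed[OF g'(1)] f'(1)])
  also have "SM g \<cdot> (SM g' \<cdot> f') = (SM g \<cdot> SM g') \<cdot> f'"
    by (rule Comp_assoc[OF f'(2) SM_closed[OF g'(2)] SM_closed[OF g'(1)], symmetric])
  also have "\<dots> = f'" using SuspM_Comp[OF g'(2,1)] g'(4) SuspM_Id Id_Comp[OF f'(2)] by simp
  finally have 1: "?c' \<cdot> ?c = Id C Z" using f'(4) by simp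
  have "?c \<cdot> ?c' = SM g' \<cdot> (f' \<cdot> (f \<cdot> SM g))"
    by (rule Comp_assoc[OF c(2) f'(2) SM_closed[OF g'(2)]])
  also have "f' \<cdot> (f \<cdot> SM g) = (f' \<cdot> f) \<cdot> SM g"
    by (rule Comp_assoc[OF SM_closed[OF g'(1)] f'(1,2), symmetric])
  also have "\<dots> = SM g" using f'(3) Id_Comp[OF SM_closed[OF g'(1)]] by simp
  finally have 2: "?c \<cdot> ?c' = Id C (S (S W))" using SuspM_Comp[OF g'(1,2)] g'(3) SuspM_Id by simp
  have i: "iso_mor C A A (Id C A)" for A
    unfolding iso_mor_def using Id_closed Comp_Id[OF Id_closed] by blast
  have ic: "iso_mor C Z (S (S W)) ?c" unfolding iso_mor_def using c 1 2 by blast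
  have "Dist C X Y (S (S W)) u (?c \<cdot> v) (w \<cdot> ?c')"
  proof (rule Dist_iso[OF D i i ic h(1) Comp_closed[OF h(2) c(1)] Comp_closed[OF c(2) h(3)]])
    show "u \<cdot> Id C X = Id C Y \<cdot> u" using Comp_Id Id_Comp h by simp
    show "(?c \<cdot> v) \<cdot> Id C Y = ?c \<cdot> v" by (rule Comp_Id[OF Comp_closed[OF h(2) c(1)]])
    have "(w \<cdot> ?c') \<cdot> ?c = w" using Comp_assoc[OF c(1,2) h(3)] 1 Comp_Id[OF h(3)] by simp
    then show "(w \<cdot> ?c') \<cdot> ?c = SM (Id C X) \<cdot> w" using SuspM_Id Id_Comp[OF h(3)] by simp
  qed
  then show ?thesis by (rule that)
qed

end

section \<open>Approximations by the cluster-tilting object\<close>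

locale cluster_tilted = triangulated_category C
  for C :: "('k::field, 'o, 'm::ab_group_add) tri_cat" (structure) +
  fixes T :: 'o
  assumes hom_finite: "hom_finite C"
    and calabi_yau: "two_calabi_yau C"
    and cluster_tilting: "cluster_tilting C T"
begin

abbreviation \<Lambda> :: "('k, 'm) alg" where "\<Lambda> \<equiv> End_alg C T"

lemma End_alg_simps [simp]:
  "alg_carrier \<Lambda> = Hom C T T" "alg_scale \<Lambda> = Scale C" "alg_mult \<Lambda> = Comp C" "alg_one \<Lambda> = Id C T"
  by (simp_all add: End_alg_def)

lemma fd_Hom: "fd_subspace (Scale C) (Hom C X Y)"
  using hom_finite by (simp add: hom_finite_def)

lemma rigid_T: "f \<in> Hom C T (S T) \<Longrightarrow> f = 0"
  using cluster_tilting by (simp add: cluster_tilting_def)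

lemma rigid:
  assumes X: "in_add T X" and Y: "in_add T Y" and f: "f \<in> Hom C X (S Y)"
  shows "f = 0"
proof (rule in_add_zero_from[OF X f])
  fix t assume t: "t \<in> Hom C T X"
  show "f \<cdot> t = 0"
  proof (rule in_add_zero_to[OF in_add_Susp[OF Y] Comp_closed[OF t f]])
    fix s assume "s \<in> Hom C (S Y) (S T)"
    then show "s \<cdot> (f \<cdot> t) = 0" by (rule rigid_T[OF Comp_closed[OF Comp_closed[OF t f]]])
  qed
qed

text \<open>The module map out of a power of \<open>T\<close> that sends one generator to each
  element of \<open>B\<close>. The right action is abstract because both modules inside
  \<open>nat \<Rightarrow> 'k\<close> and submodules of \<open>\<C>(T, X)\<close> have to be
  covered.\<close>

lemma finite_cover:
  fixes s :: "'k \<Rightarrow> 'v::ab_group_add \<Rightarrow> 'v" and act :: "'v \<Rightarrow> 'm \<Rightarrow> 'v"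
  assumes s: "vector_space s" and B: "finite B" "B \<subseteq> V" and V: "Modules.module.subspace s V"
    and act: "\<And>b t. b \<in> V \<Longrightarrow> t \<in> Hom C T T \<Longrightarrow> act b t \<in> V"
    and lin: "\<And>b. b \<in> V \<Longrightarrow> linear_on (Scale C) s (Hom C T T) (act b)"
    and lin2: "\<And>a. a \<in> Hom C T T \<Longrightarrow> linear_on s s V (\<lambda>b. act b a)"
    and one: "\<And>b. b \<in> V \<Longrightarrow> act b (Id C T) = b"
    and assoc: "\<And>b t a. b \<in> V \<Longrightarrow> t \<in> Hom C T T \<Longrightarrow> a \<in> Hom C T T \<Longrightarrow> act b (t \<cdot> a) = act (act b t) a"
  shows "\<exists>X p. in_add T X \<and> (\<forall>t\<in>Hom C T X. p t \<in> V) \<and> linear_on (Scale C) s (Hom C T X) p \<and>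
    (\<forall>t\<in>Hom C T X. \<forall>a\<in>Hom C T T. p (t \<cdot> a) = act (p t) a) \<and> B \<subseteq> p ` Hom C T X"
  using B
proof (induction B rule: finite_induct)
  case empty
  interpret s: vector_space s by fact
  obtain Z where Z: "zero_object C Z" using ex_zero_object by blast
  have "act 0 a = 0" if "a \<in> Hom C T T" for a
    by (rule linear_on_zero[OF lin2[OF that] s.subspace_0[OF V]])
  then show ?case
    using in_add_zero_object[OF Z] s.subspace_0[OF V]
    by (intro exI[of _ Z] exI[of _ "\<lambda>_. 0"]) (auto simp: linear_on_def)
next
  case (insert b B)
  interpret s: vector_space s by fact
  obtain X p where X: "in_add T X" and p: "\<forall>t\<in>Hom C T X. p t \<in> V" "linear_on (Scale C) s (Hom C T X) p"
    "\<forall>t\<in>Hom C T X. \<forall>a\<in>Hom C T T. p (t \<cdot> a) = act (p t) a" "B \<subseteq> p ` Hom C T X"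
    using insert.IH insert.prems by auto
  have b: "b \<in> V" using insert.prems by simp
  obtain Z where Z: "is_biproduct C X T Z" using ex_biproduct by blast
  obtain i1 i2 p1 p2 where h: "i1 \<in> Hom C X Z" "i2 \<in> Hom C T Z" "p1 \<in> Hom C Z X" "p2 \<in> Hom C Z T"
    "p1 \<cdot> i1 = Id C X" "p2 \<cdot> i2 = Id C T" "p1 \<cdot> i2 = 0" "p2 \<cdot> i1 = 0" "i1 \<cdot> p1 + i2 \<cdot> p2 = Id C Z"
    by (rule biproductE[OF Z])
  \<comment> \<open>The new summand \<open>T\<close> acts on \<open>b\<close>: the inclusion
    \<open>i2\<close> is sent to \<open>b\<close>, and on the old summand nothing changes.\<close>
  let ?q = "\<lambda>t. p (p1 \<cdot> t) + act b (p2 \<cdot> t)"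
  have c: "p1 \<cdot> t \<in> Hom C T X" "p2 \<cdot> t \<in> Hom C T T" if "t \<in> Hom C T Z" for t
    using Comp_closed[OF that h(3)] Comp_closed[OF that h(4)] by auto
  have "?q t \<in> V" if "t \<in> Hom C T Z" for t
    using s.subspace_add[OF V] p(1) act[OF b] c[OF that] by simp
  moreover have "linear_on (Scale C) s (Hom C T Z) ?q"
    unfolding linear_on_def
  proof (intro conjI ballI allI)
    fix x y assume x: "x \<in> Hom C T Z" and y: "y \<in> Hom C T Z"
    show "?q (x + y) = ?q x + ?q y"
      by (simp add: Comp_add_right[OF h(3) x y] Comp_add_right[OF h(4) x y]
          linear_on_add[OF p(2) c(1)[OF x] c(1)[OF y]] linear_on_add[OF lin[OF b] c(2)[OF x] c(2)[OF y]])
  next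
    fix k x assume x: "x \<in> Hom C T Z"
    show "?q (Scale C k x) = s k (?q x)"
      by (simp add: Comp_scale_right[OF h(3) x] Comp_scale_right[OF h(4) x] s.scale_right_distrib
          linear_on_scale[OF p(2) c(1)[OF x]] linear_on_scale[OF lin[OF b] c(2)[OF x]])
  qed
  moreover have "?q (t \<cdot> a) = act (?q t) a" if t: "t \<in> Hom C T Z" and a: "a \<in> Hom C T T" for t a
  proof -
    have "act (?q t) a = act (p (p1 \<cdot> t)) a + act (act b (p2 \<cdot> t)) a"
      using p(1) c(1)[OF t] by (intro linear_on_add[OF lin2[OF a]] act[OF b c(2)[OF t]]) simp
    moreover have "p (p1 \<cdot> (t \<cdot> a)) = act (p (p1 \<cdot> t)) a"
      using p(3)[rule_format, OF c(1)[OF t] a] unfolding Comp_assoc[OF a t h(3)] .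
    ultimately show ?thesis
      using assoc[OF b c(2)[OF t] a] unfolding Comp_assoc[OF a t h(4)] by simp
  qed
  moreover have "insert b B \<subseteq> ?q ` Hom C T Z"
  proof
    fix x assume "x \<in> insert b B"
    then consider "x = b" | t where "t \<in> Hom C T X" "x = p t" using p(4) by auto
    then show "x \<in> ?q ` Hom C T Z"
    proof cases
      case 1
      have "?q i2 = b" using h(6,7) one[OF b] linear_on_zero[OF p(2) Hom_zero] by simp
      then show ?thesis using h(2) 1 by (intro image_eqI[of _ _ i2]) simp_all
    next
      case 2
      have "p1 \<cdot> (i1 \<cdot> t) = t" "p2 \<cdot> (i1 \<cdot> t) = 0"
        using Comp_assoc[OF 2(1) h(1) h(3)] Comp_assoc[OF 2(1) h(1) h(4)] h(5,8) Id_Comp[OF 2(1)]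
          Comp_zero_left[OF 2(1)] by simp_all
      then have "?q (i1 \<cdot> t) = x" using 2(2) linear_on_zero[OF lin[OF b] Hom_zero] by simp
      then show ?thesis using Comp_closed[OF 2(1) h(1)] by (intro image_eqI[of _ _ "i1 \<cdot> t"]) simp_all
    qed
  qed
  ultimately show ?case using in_add_biproduct[OF X h(1-4,9)] by (intro exI[of _ Z] exI[of _ ?q]) simp
qed

text \<open>\<open>V\<close> is a submodule of \<open>\<C>(T, X)\<close>. Its cover by
  \<open>\<C>(T, Y)\<close> is composition with a morphism because \<open>Y\<close> is in
  \<open>add T\<close>: that morphism is the sum of the
  \<open>p (\<iota> i) \<cdot> \<pi> i\<close>. Applied to kernels, this yields the next term of a
  presentation.\<close>

lemma right_approximation:
  assumes V: "m.subspace V" "V \<subseteq> Hom C T X" and act: "\<And>t a. t \<in> V \<Longrightarrow> a \<in> Hom C T T \<Longrightarrow> t \<cdot> a \<in> V"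
  obtains Y u where "in_add T Y" "u \<in> Hom C Y X" "(\<lambda>t. u \<cdot> t) ` Hom C T Y = V"
proof -
  have fV: "fd_subspace (Scale C) V" by (rule m.fd_subset(1)[OF fd_Hom V])
  obtain B where B: "finite B" "B \<subseteq> V" "m.span B = V"
    by (rule m.fd_basis[OF fV])
  have "\<exists>Y p. in_add T Y \<and> (\<forall>t\<in>Hom C T Y. p t \<in> V) \<and> linear_on (Scale C) (Scale C) (Hom C T Y) p \<and>
    (\<forall>t\<in>Hom C T Y. \<forall>a\<in>Hom C T T. p (t \<cdot> a) = p t \<cdot> a) \<and> B \<subseteq> p ` Hom C T Y"
  proof (rule finite_cover[OF vector_space_mor B(1,2) V(1) act])
    show "linear_on (Scale C) (Scale C) (Hom C T T) (Comp C b)" if "b \<in> V" for b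
      using linear_Comp_right[of b T X T] that V(2) by blast
    show "linear_on (Scale C) (Scale C) V (\<lambda>b. b \<cdot> a)" if "a \<in> Hom C T T" for a
      by (rule linear_on_subset[OF linear_Comp_left[OF that] V(2)])
    show "b \<cdot> Id C T = b" if "b \<in> V" for b using Comp_Id that V(2) by blast
    show "b \<cdot> (t \<cdot> a) = (b \<cdot> t) \<cdot> a" if "b \<in> V" "t \<in> Hom C T T" "a \<in> Hom C T T" for b t a
      using Comp_assoc[OF that(3,2), of b X] that(1) V(2) by auto
  qed
  then obtain Y p where Y: "in_add T Y" and p: "\<forall>t\<in>Hom C T Y. p t \<in> V" "linear_on (Scale C) (Scale C) (Hom C T Y) p"
    "\<forall>t\<in>Hom C T Y. \<forall>a\<in>Hom C T T. p (t \<cdot> a) = p t \<cdot> a" "B \<subseteq> p ` Hom C T Y" by (elim exE conjE)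
  obtain n \<iota> \<pi> where a': "\<forall>i<(n::nat). \<iota> i \<in> Hom C T Y \<and> \<pi> i \<in> Hom C Y T"
    "(\<Sum>i<n. \<iota> i \<cdot> \<pi> i) = Id C Y" by (rule in_addE[OF Y])
  then have a: "\<And>i. i < n \<Longrightarrow> \<iota> i \<in> Hom C T Y" "\<And>i. i < n \<Longrightarrow> \<pi> i \<in> Hom C Y T"
    "(\<Sum>i<n. \<iota> i \<cdot> \<pi> i) = Id C Y" by simp_all
  have pi: "p (\<iota> i) \<in> Hom C T X" if "i < n" for i using p(1) a(1)[OF that] V(2) by blast
  define u where "u = (\<Sum>i<n. p (\<iota> i) \<cdot> \<pi> i)"
  have u: "u \<in> Hom C Y X" unfolding u_def by (rule Hom_sum) (auto intro: Comp_closed[OF a(2) pi])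
  have ut: "u \<cdot> t = p t" if t: "t \<in> Hom C T Y" for t
  proof -
    have c: "\<pi> i \<cdot> t \<in> Hom C T T" if "i < n" for i by (rule Comp_closed[OF t a(2)[OF that]])
    have "u \<cdot> t = (\<Sum>i<n. (p (\<iota> i) \<cdot> \<pi> i) \<cdot> t)"
      unfolding u_def by (rule Comp_sum_left[OF t]) (auto intro: Comp_closed[OF a(2) pi])
    also have "\<dots> = (\<Sum>i<n. p (\<iota> i \<cdot> (\<pi> i \<cdot> t)))"
      using p(3) a(1) c by (intro sum.cong refl) (simp add: Comp_assoc[OF t a(2) pi])
    also have "\<dots> = p (\<Sum>i<n. \<iota> i \<cdot> (\<pi> i \<cdot> t))"
      by (rule m.linear_on_sum[OF p(2) subspace_Hom, symmetric]) (auto intro: Comp_closed[OF c a(1)])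
    also have "(\<Sum>i<n. \<iota> i \<cdot> (\<pi> i \<cdot> t)) = t" by (rule in_add_expand_to[OF a t, symmetric])
    finally show ?thesis .
  qed
  have im: "(\<lambda>t. u \<cdot> t) ` Hom C T Y = p ` Hom C T Y" using ut by simp
  have sp: "m.subspace (p ` Hom C T Y)"
    using m.rank_nullity(1)[OF vector_space_mor fd_Hom p(2)] by (simp add: m.fd_subspace_iff)
  have "V \<subseteq> p ` Hom C T Y" using m.span_minimal[OF p(4) sp] B(3) by simp
  moreover have "p ` Hom C T Y \<subseteq> V" using p(1) by blast
  ultimately have "(\<lambda>t. u \<cdot> t) ` Hom C T Y = V" using im by simp
  then show ?thesis using that[OF Y u] by simp
qed

text \<open>The components of \<open>p\<close> are a basis of \<open>\<C>(W, T)\<close>; the maps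
  that factor through \<open>p\<close> form a subspace containing this basis.\<close>

lemma left_approximation:
  obtains Y p where "in_add T Y" "p \<in> Hom C W Y" "\<forall>r\<in>Hom C W T. \<exists>r'\<in>Hom C Y T. r = r' \<cdot> p"
proof -
  obtain B where B: "finite B" "B \<subseteq> Hom C W T" "m.span B = Hom C W T"
    by (rule m.fd_basis[OF fd_Hom])
  have "\<exists>Y. in_add T Y \<and> (\<exists>p\<in>Hom C W Y. \<forall>b\<in>B. \<exists>r'\<in>Hom C Y T. b = r' \<cdot> p)"
    using B(1,2)
  proof (induction B rule: finite_induct)
    case empty
    obtain Z where Z: "zero_object C Z" using ex_zero_object by blast
    then show ?case using in_add_zero_object[OF Z] Hom_zero by blast
  next
    case (insert b B)
    obtain X p where X: "in_add T X" and p: "p \<in> Hom C W X" "\<forall>b\<in>B. \<exists>r'\<in>Hom C X T. b = r' \<cdot> p"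
      using insert.IH insert.prems by auto
    have b: "b \<in> Hom C W T" using insert.prems by simp
    obtain Z where Z: "is_biproduct C X T Z" using ex_biproduct by blast
    obtain i1 i2 p1 p2 where h: "i1 \<in> Hom C X Z" "i2 \<in> Hom C T Z" "p1 \<in> Hom C Z X" "p2 \<in> Hom C Z T"
      "p1 \<cdot> i1 = Id C X" "p2 \<cdot> i2 = Id C T" "p1 \<cdot> i2 = 0" "p2 \<cdot> i1 = 0" "i1 \<cdot> p1 + i2 \<cdot> p2 = Id C Z"
      by (rule biproductE[OF Z])
    let ?q = "i1 \<cdot> p + i2 \<cdot> b"
    note c = Comp_closed[OF p(1) h(1)] Comp_closed[OF b h(2)]
    have q: "?q \<in> Hom C W Z" by (rule Hom_add[OF c])
    have 1: "p1 \<cdot> ?q = p"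
      using Comp_add_right[OF h(3) c] Comp_assoc[OF p(1) h(1) h(3)] Comp_assoc[OF b h(2) h(3)] h(5,7)
        Id_Comp[OF p(1)] Comp_zero_left[OF b] by simp
    have 2: "p2 \<cdot> ?q = b"
      using Comp_add_right[OF h(4) c] Comp_assoc[OF p(1) h(1) h(4)] Comp_assoc[OF b h(2) h(4)] h(6,8)
        Id_Comp[OF b] Comp_zero_left[OF p(1)] by simp
    have "\<exists>r'\<in>Hom C Z T. x = r' \<cdot> ?q" if "x \<in> insert b B" for x
    proof (cases "x = b")
      case True
      then show ?thesis using 2 h(4) by (intro bexI[of _ p2]) simp_all
    next
      case False
      then obtain r where r: "r \<in> Hom C X T" "x = r \<cdot> p" using p(2) \<open>x \<in> insert b B\<close> by blast
      have "x = (r \<cdot> p1) \<cdot> ?q" using Comp_assoc[OF q h(3) r(1)] 1 r(2) by simp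
      then show ?thesis using Comp_closed[OF h(3) r(1)] by blast
    qed
    then show ?case using in_add_biproduct[OF X h(1-4,9)] q by blast
  qed
  then obtain Y p where Y: "in_add T Y" and p: "p \<in> Hom C W Y" "\<forall>b\<in>B. \<exists>r'\<in>Hom C Y T. b = r' \<cdot> p" by (elim exE conjE bexE)
  have "m.subspace ((\<lambda>r. r \<cdot> p) ` Hom C Y T)"
    using m.rank_nullity(1)[OF vector_space_mor fd_Hom linear_Comp_left[OF p(1)]] by (simp add: m.fd_subspace_iff)
  moreover have "B \<subseteq> (\<lambda>r. r \<cdot> p) ` Hom C Y T" using p(2) by blast
  ultimately have "Hom C W T \<subseteq> (\<lambda>r. r \<cdot> p) ` Hom C Y T" using m.span_minimal B(3) by metis
  then show ?thesis using that[OF Y p(1)] by (auto simp: image_subset_iff)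
qed

end

section \<open>Modules represented by objects\<close>

text \<open>Coordinates with respect to a finite basis, placed at distinct natural numbers. This
  moves Hom spaces into the ambient space in which modules live.\<close>

lemma (in vector_space) fd_subspace_embedding:
  assumes "fd_subspace scale V"
  obtains \<theta> :: "'b \<Rightarrow> nat \<Rightarrow> 'a" where "linear_on scale vscale V \<theta>" "inj_on \<theta> V"
proof -
  obtain B where B: "finite B" "independent B" "B \<subseteq> V" "span B = V"
    by (rule fd_basis[OF assms])
  obtain b where b: "inj_on b B" "b ` B \<subseteq> (UNIV :: nat set)"
    using finite_imp_inj_to_nat_seg[OF B(1)] by blast
  define \<theta> where "\<theta> x = (\<lambda>i. if i \<in> b ` B then representation B x (inv_into B b i) else 0)" for x
  have "linear_on scale vscale V \<theta>"
    unfolding linear_on_def \<theta>_def fun_scale_def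
    using representation_add[OF B(2)] representation_scale[OF B(2)] B(4) by (auto simp: fun_eq_iff)
  moreover have "inj_on \<theta> V"
  proof (rule inj_onI)
    fix x y assume x: "x \<in> V" and y: "y \<in> V" and e: "\<theta> x = \<theta> y"
    have "representation B x v = representation B y v" if "v \<in> B" for v
      using fun_cong[OF e, of "b v"] that inv_into_f_f[OF b(1) that] by (simp add: \<theta>_def)
    then have "(\<Sum>v\<in>B. scale (representation B x v) v) = (\<Sum>v\<in>B. scale (representation B y v) v)"
      by (intro sum.cong) simp_all
    then show "x = y"
      using sum_representation_eq[OF B(2) _ B(1) subset_refl] B(4) x y by simp
  qed
  ultimately show ?thesis by (rule that)
qed

context cluster_tilted
begin

text \<open>\<open>\<theta>\<close> is an isomorphism from \<open>F X = \<C>(T, X)\<close>, on which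
  \<open>\<Lambda>\<close> acts by precomposition, to \<open>N\<close>. The map is recorded because
  modules are confined to subspaces of \<open>nat \<Rightarrow> 'k\<close>.\<close>

definition represents :: "('k, 'm) rmod \<Rightarrow> 'o \<Rightarrow> ('m \<Rightarrow> nat \<Rightarrow> 'k) \<Rightarrow> bool" where
  "represents N X \<theta> \<longleftrightarrow> N \<in> fd_modules \<Lambda> \<and> bij_betw \<theta> (Hom C T X) (vecs N) \<and>
     linear_on (Scale C) vscale (Hom C T X) \<theta> \<and>
     (\<forall>t\<in>Hom C T X. \<forall>a\<in>Hom C T T. \<theta> (t \<cdot> a) = act N (\<theta> t) a)"

lemma represents_fd: "represents N X \<theta> \<Longrightarrow> N \<in> fd_modules \<Lambda>"
  by (simp add: represents_def)

lemma represents_linear: "represents N X \<theta> \<Longrightarrow> linear_on (Scale C) vscale (Hom C T X) \<theta>"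
  by (simp add: represents_def)

lemma represents_act:
  "represents N X \<theta> \<Longrightarrow> t \<in> Hom C T X \<Longrightarrow> a \<in> Hom C T T \<Longrightarrow> \<theta> (t \<cdot> a) = act N (\<theta> t) a"
  by (simp add: represents_def)

lemma represents_inj: "represents N X \<theta> \<Longrightarrow> inj_on \<theta> (Hom C T X)"
  by (simp add: represents_def bij_betw_def)

lemma represents_image: "represents N X \<theta> \<Longrightarrow> \<theta> ` Hom C T X = vecs N"
  by (simp add: represents_def bij_betw_def)

lemma represents_in: "represents N X \<theta> \<Longrightarrow> t \<in> Hom C T X \<Longrightarrow> \<theta> t \<in> vecs N"
  using represents_image by blast

lemma represents_zero_iff: "represents N X \<theta> \<Longrightarrow> t \<in> Hom C T X \<Longrightarrow> \<theta> t = 0 \<longleftrightarrow> t = 0"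
  using represents_inj[of N X \<theta>] linear_on_zero[OF represents_linear Hom_zero]
    m.linear_on_inj[OF represents_linear subspace_Hom] by metis

lemma represents_cases:
  assumes "represents N X \<theta>" "x \<in> vecs N"
  obtains t where "t \<in> Hom C T X" "x = \<theta> t"
  using assms(2) unfolding represents_image[OF assms(1), symmetric] by (elim imageE)

lemma represents_exists:
  obtains N \<theta> where "represents N X \<theta>"
proof -
  let ?H = "Hom C T X"
  obtain \<theta> :: "'m \<Rightarrow> nat \<Rightarrow> 'k" where l: "linear_on (Scale C) vscale ?H \<theta>" and inj: "inj_on \<theta> ?H"
    by (rule m.fd_subspace_embedding[OF fd_Hom])
  let ?i = "inv_into ?H \<theta>"
  have i: "?i (\<theta> t) = t" if "t \<in> ?H" for t by (rule inv_into_f_f[OF inj that])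
  define N :: "('k, 'm) rmod" where "N = \<lparr>vecs = \<theta> ` ?H, act = (\<lambda>x a. \<theta> (?i x \<cdot> a))\<rparr>"
  have act: "act N (\<theta> t) a = \<theta> (t \<cdot> a)" if "t \<in> ?H" for t a using i[OF that] by (simp add: N_def)
  have v: "vecs N = \<theta> ` ?H" by (simp add: N_def)
  have la: "linear_on vscale vscale (vecs N) (\<lambda>x. act N x a)" if a: "a \<in> Hom C T T" for a
    unfolding linear_on_def v ball_simps
  proof (intro conjI ballI allI)
    fix x y assume x: "x \<in> ?H" and y: "y \<in> ?H"
    have "act N (\<theta> x + \<theta> y) a = act N (\<theta> (x + y)) a" using linear_on_add[OF l x y] by simp
    also have "\<dots> = \<theta> ((x + y) \<cdot> a)" by (rule act[OF Hom_add[OF x y]])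
    also have "\<dots> = \<theta> (x \<cdot> a) + \<theta> (y \<cdot> a)"
      unfolding Comp_add_left[OF a x y] by (rule linear_on_add[OF l Comp_closed[OF a x] Comp_closed[OF a y]])
    finally show "act N (\<theta> x + \<theta> y) a = act N (\<theta> x) a + act N (\<theta> y) a" using act[OF x] act[OF y] by simp
  next
    fix c x assume x: "x \<in> ?H"
    have "act N (vscale c (\<theta> x)) a = act N (\<theta> (Scale C c x)) a" using linear_on_scale[OF l x] by simp
    also have "\<dots> = \<theta> (Scale C c x \<cdot> a)" by (rule act[OF Hom_scale[OF x]])
    also have "\<dots> = vscale c (\<theta> (x \<cdot> a))"
      unfolding Comp_scale_left[OF a x] by (rule linear_on_scale[OF l Comp_closed[OF a x]])
    finally show "act N (vscale c (\<theta> x)) a = vscale c (act N (\<theta> x) a)" using act[OF x] by simp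
  qed
  have la2: "linear_on (Scale C) vscale (Hom C T T) (act N (\<theta> x))" if x: "x \<in> ?H" for x
    unfolding linear_on_def act[OF x]
  proof (intro conjI ballI allI)
    fix a b assume a: "a \<in> Hom C T T" and b: "b \<in> Hom C T T"
    show "\<theta> (x \<cdot> (a + b)) = \<theta> (x \<cdot> a) + \<theta> (x \<cdot> b)"
      unfolding Comp_add_right[OF x a b] by (rule linear_on_add[OF l Comp_closed[OF a x] Comp_closed[OF b x]])
  next
    fix c a assume a: "a \<in> Hom C T T"
    show "\<theta> (x \<cdot> Scale C c a) = vscale c (\<theta> (x \<cdot> a))"
      unfolding Comp_scale_right[OF x a] by (rule linear_on_scale[OF l Comp_closed[OF a x]])
  qed
  have "N \<in> fd_modules \<Lambda>"
    unfolding fd_modules_def mem_Collect_eq End_alg_simps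
  proof (intro conjI)
    show "fd_subspace vscale (vecs N)"
      unfolding v by (rule m.rank_nullity(1)[OF vector_space_vscale fd_Hom l])
    show "\<forall>x\<in>vecs N. \<forall>a\<in>Hom C T T. act N x a \<in> vecs N"
      unfolding v ball_simps using act Comp_closed by simp
    show "\<forall>a\<in>Hom C T T. linear_on vscale vscale (vecs N) (\<lambda>x. act N x a)" using la by simp
    show "\<forall>x\<in>vecs N. linear_on (Scale C) vscale (Hom C T T) (act N x)"
      unfolding v ball_simps using la2 by simp
    show "\<forall>x\<in>vecs N. act N x (Id C T) = x" unfolding v ball_simps using act Comp_Id by simp
    show "\<forall>x\<in>vecs N. \<forall>a\<in>Hom C T T. \<forall>b\<in>Hom C T T. act N (act N x a) b = act N x (a \<cdot> b)"
      unfolding v ball_simps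
    proof (intro ballI)
      fix t a b assume t: "t \<in> ?H" and a: "a \<in> Hom C T T" and b: "b \<in> Hom C T T"
      show "act N (act N (\<theta> t) a) b = act N (\<theta> t) (a \<cdot> b)"
        unfolding act[OF t] act[OF Comp_closed[OF a t]] Comp_assoc[OF b a t] by simp
    qed
  qed
  then have "represents N X \<theta>"
    unfolding represents_def bij_betw_def using inj l act v by simp
  then show ?thesis by (rule that)
qed

text \<open>The image \<open>F f\<close> of a morphism under the functor \<open>F\<close>, that is
  \<open>t \<mapsto> f \<cdot> t\<close>, read through \<open>\<theta>\<close> and
  \<open>\<theta>'\<close>.\<close>

definition hom_map where
  "hom_map X \<theta> N \<theta>' f = (\<lambda>x. if x \<in> vecs N then \<theta>' (f \<cdot> inv_into (Hom C T X) \<theta> x) else 0)"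

lemma hom_map_apply:
  assumes "represents N X \<theta>" "t \<in> Hom C T X"
  shows "hom_map X \<theta> N \<theta>' f (\<theta> t) = \<theta>' (f \<cdot> t)"
  using represents_in[OF assms] inv_into_f_f[OF represents_inj[OF assms(1)] assms(2)] by (simp add: hom_map_def)

lemma hom_map_mod_hom:
  assumes r: "represents N X \<theta>" and r': "represents N' Y \<theta>'" and f: "f \<in> Hom C X Y"
  shows "hom_map X \<theta> N \<theta>' f \<in> mod_hom \<Lambda> N N'"
proof -
  let ?h = "hom_map X \<theta> N \<theta>' f"
  note ap = hom_map_apply[OF r, of _ \<theta>' f] and l = represents_linear[OF r] and l' = represents_linear[OF r']
  note v = represents_image[OF r, symmetric]
  have c: "f \<cdot> t \<in> Hom C T Y" if "t \<in> Hom C T X" for t by (rule Comp_closed[OF that f])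
  show ?thesis
    unfolding mod_hom_def mem_Collect_eq End_alg_simps
  proof (intro conjI)
    show "?h ` vecs N \<subseteq> vecs N'" unfolding v using represents_in[OF r' c] ap by auto
    show "\<forall>x. x \<notin> vecs N \<longrightarrow> ?h x = 0" by (simp add: hom_map_def)
    show "linear_on vscale vscale (vecs N) ?h"
      unfolding linear_on_def v ball_simps
    proof (intro conjI ballI allI)
      fix x y assume x: "x \<in> Hom C T X" and y: "y \<in> Hom C T X"
      have "?h (\<theta> x + \<theta> y) = \<theta>' (f \<cdot> (x + y))"
        using ap[OF Hom_add[OF x y]] linear_on_add[OF l x y] by simp
      then show "?h (\<theta> x + \<theta> y) = ?h (\<theta> x) + ?h (\<theta> y)"
        unfolding Comp_add_right[OF f x y] linear_on_add[OF l' c[OF x] c[OF y]] ap[OF x] ap[OF y] .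
    next
      fix k x assume x: "x \<in> Hom C T X"
      have "?h (vscale k (\<theta> x)) = \<theta>' (f \<cdot> Scale C k x)"
        using ap[OF Hom_scale[OF x]] linear_on_scale[OF l x] by simp
      then show "?h (vscale k (\<theta> x)) = vscale k (?h (\<theta> x))"
        unfolding Comp_scale_right[OF f x] linear_on_scale[OF l' c[OF x]] ap[OF x] .
    qed
    show "\<forall>x\<in>vecs N. \<forall>a\<in>Hom C T T. ?h (act N x a) = act N' (?h x) a"
      unfolding v ball_simps
    proof (intro ballI)
      fix t a assume t: "t \<in> Hom C T X" and a: "a \<in> Hom C T T"
      have "?h (act N (\<theta> t) a) = \<theta>' (f \<cdot> (t \<cdot> a))"
        using ap[OF Comp_closed[OF a t]] represents_act[OF r t a] by simp
      also have "\<dots> = \<theta>' ((f \<cdot> t) \<cdot> a)" using Comp_assoc[OF a t f] by simp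
      also have "\<dots> = act N' (?h (\<theta> t)) a" using represents_act[OF r' c[OF t] a] ap[OF t] by simp
      finally show "?h (act N (\<theta> t) a) = act N' (?h (\<theta> t)) a" .
    qed
  qed
qed

lemma hom_map_linear:
  assumes r: "represents N X \<theta>" and r': "represents N' Y \<theta>'"
  shows "linear_on (Scale C) mscale (Hom C X Y) (hom_map X \<theta> N \<theta>')"
proof -
  have i: "inv_into (Hom C T X) \<theta> x \<in> Hom C T X" if "x \<in> vecs N" for x
    using that unfolding represents_image[OF r, symmetric] by (rule inv_into_into)
  note l' = represents_linear[OF r']
  show ?thesis
    unfolding linear_on_def
  proof (intro conjI ballI allI)
    fix f g assume f: "f \<in> Hom C X Y" and g: "g \<in> Hom C X Y"
    show "hom_map X \<theta> N \<theta>' (f + g) = hom_map X \<theta> N \<theta>' f + hom_map X \<theta> N \<theta>' g"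
      by (rule ext) (simp add: hom_map_def Comp_add_left[OF i f g] linear_on_add[OF l' Comp_closed[OF i f] Comp_closed[OF i g]])
  next
    fix c f assume f: "f \<in> Hom C X Y"
    show "hom_map X \<theta> N \<theta>' (Scale C c f) = mscale c (hom_map X \<theta> N \<theta>' f)"
      unfolding fun_scale_def[of vscale c]
      by (rule ext) (simp add: hom_map_def Comp_scale_left[OF i f] linear_on_scale[OF l' Comp_closed[OF i f]])
  qed
qed

text \<open>For \<open>X\<close> in \<open>add T\<close> the elements \<open>\<iota> i\<close>
  generate \<open>\<C>(T, X)\<close> as a right module, with coefficients
  \<open>\<pi> i \<cdot> t\<close>.\<close>

lemma mod_hom_expand:
  assumes a: "\<And>i. i < (n::nat) \<Longrightarrow> \<iota> i \<in> Hom C T X" "\<And>i. i < n \<Longrightarrow> \<pi> i \<in> Hom C X T"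
    "(\<Sum>i<n. \<iota> i \<cdot> \<pi> i) = Id C X"
    and r: "represents P X \<theta>" and h: "h \<in> mod_hom \<Lambda> P N" and t: "t \<in> Hom C T X"
  shows "h (\<theta> t) = (\<Sum>i<n. act N (h (\<theta> (\<iota> i))) (\<pi> i \<cdot> t))"
proof -
  have c: "\<pi> i \<cdot> t \<in> Hom C T T" if "i < n" for i by (rule Comp_closed[OF t a(2)[OF that]])
  have "h (\<theta> t) = h (\<theta> (\<Sum>i<n. \<iota> i \<cdot> (\<pi> i \<cdot> t)))" using in_add_expand_to[OF a t] by simp
  also have "\<theta> (\<Sum>i<n. \<iota> i \<cdot> (\<pi> i \<cdot> t)) = (\<Sum>i<n. \<theta> (\<iota> i \<cdot> (\<pi> i \<cdot> t)))"
    by (rule m.linear_on_sum[OF represents_linear[OF r] subspace_Hom]) (auto intro: Comp_closed[OF c a(1)])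
  also have "h \<dots> = (\<Sum>i<n. h (\<theta> (\<iota> i \<cdot> (\<pi> i \<cdot> t))))"
    by (rule vs.linear_on_sum[OF mod_hom_linear[OF h] fd_modules_subspace[OF represents_fd[OF r]]])
      (auto intro: represents_in[OF r Comp_closed[OF c a(1)]])
  also have "\<dots> = (\<Sum>i<n. act N (h (\<theta> (\<iota> i))) (\<pi> i \<cdot> t))"
  proof (intro sum.cong refl)
    fix i assume "i \<in> {..<n}"
    then have i: "i < n" by simp
    show "h (\<theta> (\<iota> i \<cdot> (\<pi> i \<cdot> t))) = act N (h (\<theta> (\<iota> i))) (\<pi> i \<cdot> t)"
      unfolding represents_act[OF r a(1)[OF i] c[OF i]]
      by (rule mod_hom_act[OF h represents_in[OF r a(1)[OF i]]]) (simp add: c[OF i])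
  qed
  finally show ?thesis .
qed

text \<open>The Yoneda lemma, extended from \<open>T\<close> to \<open>add T\<close> in the first
  argument. A homomorphism \<open>h\<close> comes from the sum of the
  \<open>y i \<cdot> \<pi> i\<close>, where \<open>y i\<close> corresponds to the value of
  \<open>h\<close> at the generator \<open>\<iota> i\<close>.\<close>

lemma hom_map_bij:
  assumes X: "in_add T X" and r: "represents N X \<theta>" and r': "represents N' Y \<theta>'"
  shows "bij_betw (hom_map X \<theta> N \<theta>') (Hom C X Y) (mod_hom \<Lambda> N N')"
  unfolding bij_betw_def
proof (intro conjI equalityI subsetI)
  show "inj_on (hom_map X \<theta> N \<theta>') (Hom C X Y)"
    unfolding m.linear_on_inj[OF hom_map_linear[OF r r'] subspace_Hom]
  proof (intro ballI impI)
    fix f assume f: "f \<in> Hom C X Y" and z: "hom_map X \<theta> N \<theta>' f = 0"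
    show "f = 0"
    proof (rule in_add_zero_from[OF X f])
      fix t assume t: "t \<in> Hom C T X"
      have "\<theta>' (f \<cdot> t) = 0"
        using fun_cong[OF z, of "\<theta> t"] unfolding hom_map_apply[OF r t] zero_fun_apply .
      then show "f \<cdot> t = 0" using represents_zero_iff[OF r' Comp_closed[OF t f]] by simp
    qed
  qed
  fix h assume "h \<in> hom_map X \<theta> N \<theta>' ` Hom C X Y"
  then show "h \<in> mod_hom \<Lambda> N N'" using hom_map_mod_hom[OF r r'] by (elim imageE) simp
next
  fix h assume h: "h \<in> mod_hom \<Lambda> N N'"
  obtain n \<iota> \<pi> where a': "\<forall>i<(n::nat). \<iota> i \<in> Hom C T X \<and> \<pi> i \<in> Hom C X T"
    "(\<Sum>i<n. \<iota> i \<cdot> \<pi> i) = Id C X" by (rule in_addE[OF X])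
  then have a: "\<And>i. i < n \<Longrightarrow> \<iota> i \<in> Hom C T X" "\<And>i. i < n \<Longrightarrow> \<pi> i \<in> Hom C X T"
    "(\<Sum>i<n. \<iota> i \<cdot> \<pi> i) = Id C X" by simp_all
  define y where "y i = inv_into (Hom C T Y) \<theta>' (h (\<theta> (\<iota> i)))" for i
  have y: "y i \<in> Hom C T Y" "\<theta>' (y i) = h (\<theta> (\<iota> i))" if "i < n" for i
  proof -
    have "h (\<theta> (\<iota> i)) \<in> \<theta>' ` Hom C T Y"
      using mod_hom_in[OF h represents_in[OF r a(1)[OF that]]] represents_image[OF r'] by simp
    then show "y i \<in> Hom C T Y" "\<theta>' (y i) = h (\<theta> (\<iota> i))"
      unfolding y_def by (rule inv_into_into, rule f_inv_into_f)
  qed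
  define f where "f = (\<Sum>i<n. y i \<cdot> \<pi> i)"
  have f: "f \<in> Hom C X Y" unfolding f_def by (rule Hom_sum) (auto intro: Comp_closed[OF a(2) y(1)])
  have "h = hom_map X \<theta> N \<theta>' f"
  proof (rule mod_hom_eqI[OF h hom_map_mod_hom[OF r r' f]])
    fix x assume "x \<in> vecs N"
    then obtain t where t: "t \<in> Hom C T X" "x = \<theta> t" by (rule represents_cases[OF r])
    have c: "\<pi> i \<cdot> t \<in> Hom C T T" if "i < n" for i by (rule Comp_closed[OF t(1) a(2)[OF that]])
    have "h x = (\<Sum>i<n. act N' (h (\<theta> (\<iota> i))) (\<pi> i \<cdot> t))"
      unfolding t(2) by (rule mod_hom_expand[OF a r h t(1)])
    also have "\<dots> = (\<Sum>i<n. \<theta>' ((y i \<cdot> \<pi> i) \<cdot> t))"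
    proof (intro sum.cong refl)
      fix i assume "i \<in> {..<n}"
      then have i: "i < n" by simp
      show "act N' (h (\<theta> (\<iota> i))) (\<pi> i \<cdot> t) = \<theta>' ((y i \<cdot> \<pi> i) \<cdot> t)"
        unfolding Comp_assoc[OF t(1) a(2)[OF i] y(1)[OF i]] y(2)[OF i, symmetric]
        by (rule represents_act[OF r' y(1)[OF i] c[OF i], symmetric])
    qed
    also have "\<dots> = \<theta>' (\<Sum>i<n. (y i \<cdot> \<pi> i) \<cdot> t)"
      by (rule m.linear_on_sum[OF represents_linear[OF r'] subspace_Hom, symmetric])
        (auto intro: Comp_closed[OF t(1) Comp_closed[OF a(2) y(1)]])
    also have "(\<Sum>i<n. (y i \<cdot> \<pi> i) \<cdot> t) = f \<cdot> t"
      unfolding f_def by (rule Comp_sum_left[OF t(1), symmetric]) (auto intro: Comp_closed[OF a(2) y(1)])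
    finally show "h x = hom_map X \<theta> N \<theta>' f x" unfolding t(2) hom_map_apply[OF r t(1)] .
  qed
  then show "h \<in> hom_map X \<theta> N \<theta>' ` Hom C X Y" using f by (rule image_eqI)
qed

lemma hom_dim_add:
  assumes X: "in_add T X" and r: "represents N X \<theta>" and r': "represents N' Y \<theta>'"
  shows "mor_dim (mod_hom \<Lambda> N N') = m.dim (Hom C X Y)"
  using m.dim_inj[OF vector_space_mscale fd_Hom hom_map_linear[OF r r']] hom_map_bij[OF assms]
  by (simp add: bij_betw_def)

end

section \<open>Presentations by objects\<close>

context cluster_tilted
begin

lemma in_add_self: "in_add T T"
  by (rule in_addI[where n = 1 and \<iota> = "\<lambda>_. Id C T" and \<pi> = "\<lambda>_. Id C T"]) (simp_all add: Id_closed Comp_Id[OF Id_closed])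

text \<open>Essential surjectivity of \<open>F\<close>, together with a triangle. \<open>N\<close>
  is covered by \<open>\<C>(T, T0)\<close> and the kernel by \<open>\<C>(T, T1)\<close>; as
  \<open>\<C>(T, \<Sigma>T1) = 0\<close>, the functor \<open>F\<close> takes the cone of the
  resulting map \<open>u\<close> to the cokernel of \<open>F u\<close>, which is
  \<open>N\<close>.\<close>

lemma presentation:
  assumes N: "N \<in> fd_modules \<Lambda>"
  obtains T1 T0 W u v w \<theta> where "in_add T T1" "in_add T T0" "Dist C T1 T0 (S (S W)) u v w"
    "represents N (S (S W)) \<theta>"
proof -
  obtain B where B: "finite B" "B \<subseteq> vecs N" "vs.span B = vecs N"
    by (rule vs.fd_basis[OF fd_modules_fd[OF N]])
  have "\<exists>X p. in_add T X \<and> (\<forall>t\<in>Hom C T X. p t \<in> vecs N) \<and> linear_on (Scale C) vscale (Hom C T X) p \<and>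
    (\<forall>t\<in>Hom C T X. \<forall>a\<in>Hom C T T. p (t \<cdot> a) = act N (p t) a) \<and> B \<subseteq> p ` Hom C T X"
    by (rule finite_cover[OF vector_space_vscale B(1,2) fd_modules_subspace[OF N]])
      (use N in \<open>simp_all add: fd_modules_def\<close>)
  then obtain T0 p where T0: "in_add T T0" and p: "\<forall>t\<in>Hom C T T0. p t \<in> vecs N"
    and lp: "linear_on (Scale C) vscale (Hom C T T0) p"
    and ap: "\<forall>t\<in>Hom C T T0. \<forall>a\<in>Hom C T T. p (t \<cdot> a) = act N (p t) a" and Bp: "B \<subseteq> p ` Hom C T T0"
    by (elim exE conjE)
  have "vs.subspace (p ` Hom C T T0)"
    using m.rank_nullity(1)[OF vector_space_vscale fd_Hom lp] by (simp add: vs.fd_subspace_iff)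
  then have "vecs N \<subseteq> p ` Hom C T T0" using vs.span_minimal[OF Bp] B(3) by simp
  with p have imp: "p ` Hom C T T0 = vecs N" by blast
  let ?V = "{t\<in>Hom C T T0. p t = 0}"
  have sV: "m.subspace ?V" by (rule m.subspace_ker[OF vector_space_vscale lp subspace_Hom])
  have "t \<cdot> a \<in> ?V" if t: "t \<in> ?V" and a: "a \<in> Hom C T T" for t a
  proof -
    have "p (t \<cdot> a) = act N 0 a" using ap t a by simp
    also have "\<dots> = 0"
      by (rule linear_on_zero[OF fd_modules_act_linear[OF N] fd_modules_zero[OF N]]) (simp add: a)
    finally show ?thesis using Comp_closed[OF a] t by simp
  qed
  then obtain T1 u where T1: "in_add T T1" and u: "u \<in> Hom C T1 T0" "(\<lambda>t. u \<cdot> t) ` Hom C T T1 = ?V"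
    using right_approximation[OF sV] by (metis (no_types, lifting) mem_Collect_eq subsetI)
  obtain Z v' w' where "Dist C T1 T0 Z u v' w'" using Dist_cone[OF u(1)] by blast
  then obtain W v w where D: "Dist C T1 T0 (S (S W)) u v w" by (rule Dist_to_Susp2)
  note h = Dist_in[OF D]
  let ?X = "S (S W)"
  \<comment> \<open>\<open>\<sigma> g\<close> is some lift of \<open>g\<close> along
    \<open>v\<close>. Two lifts differ by an element of the image of \<open>u\<close>, which is the
    kernel of \<open>p\<close>, so \<open>p (\<sigma> g)\<close> is independent of the choice and
    hence linear in \<open>g\<close>.\<close>
  define \<sigma> where "\<sigma> g = (SOME t. t \<in> Hom C T T0 \<and> g = v \<cdot> t)" for g
  have \<sigma>: "\<sigma> g \<in> Hom C T T0" "g = v \<cdot> \<sigma> g" if g: "g \<in> Hom C T ?X" for g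
  proof -
    have "w \<cdot> g = 0" by (rule rigid[OF in_add_self T1 Comp_closed[OF g h(3)]])
    then obtain t where "t \<in> Hom C T T0" "g = v \<cdot> t" by (rule Dist_exact_cov[OF Dist_rot[OF D] g])
    then have "\<exists>t. t \<in> Hom C T T0 \<and> g = v \<cdot> t" by blast
    from someI_ex[OF this] show "\<sigma> g \<in> Hom C T T0" "g = v \<cdot> \<sigma> g" unfolding \<sigma>_def by simp_all
  qed
  define \<theta> where "\<theta> g = p (\<sigma> g)" for g
  have \<theta>v: "\<theta> (v \<cdot> t) = p t" if t: "t \<in> Hom C T T0" for t
  proof -
    note s = \<sigma>[OF Comp_closed[OF t h(2)]]
    have "v \<cdot> (\<sigma> (v \<cdot> t) - t) = 0" using Comp_diff_right[OF h(2) s(1) t] s(2) by simp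
    then obtain f where "f \<in> Hom C T T1" "\<sigma> (v \<cdot> t) - t = u \<cdot> f"
      by (rule Dist_exact_cov[OF D Hom_diff[OF s(1) t]])
    then have "\<sigma> (v \<cdot> t) - t \<in> ?V" using u(2) by blast
    then show ?thesis using m.linear_on_diff[OF lp subspace_Hom s(1) t] by (simp add: \<theta>_def)
  qed
  have l\<theta>: "linear_on (Scale C) vscale (Hom C T ?X) \<theta>"
    unfolding linear_on_def
  proof (intro conjI ballI allI)
    fix x y assume x: "x \<in> Hom C T ?X" and y: "y \<in> Hom C T ?X"
    have "\<theta> (v \<cdot> \<sigma> x + v \<cdot> \<sigma> y) = p (\<sigma> x + \<sigma> y)"
      using \<theta>v[OF Hom_add[OF \<sigma>(1)[OF x] \<sigma>(1)[OF y]]] Comp_add_right[OF h(2) \<sigma>(1)[OF x] \<sigma>(1)[OF y]] by simp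
    then show "\<theta> (x + y) = \<theta> x + \<theta> y"
      unfolding \<sigma>(2)[OF x, symmetric] \<sigma>(2)[OF y, symmetric] linear_on_add[OF lp \<sigma>(1)[OF x] \<sigma>(1)[OF y]] \<theta>_def .
  next
    fix c x assume x: "x \<in> Hom C T ?X"
    have "\<theta> (Scale C c (v \<cdot> \<sigma> x)) = p (Scale C c (\<sigma> x))"
      using \<theta>v[OF Hom_scale[OF \<sigma>(1)[OF x]]] Comp_scale_right[OF h(2) \<sigma>(1)[OF x]] by simp
    then show "\<theta> (Scale C c x) = vscale c (\<theta> x)"
      unfolding \<sigma>(2)[OF x, symmetric] linear_on_scale[OF lp \<sigma>(1)[OF x]] \<theta>_def .
  qed
  have a\<theta>: "\<theta> (t \<cdot> a) = act N (\<theta> t) a" if t: "t \<in> Hom C T ?X" and a: "a \<in> Hom C T T" for t a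
  proof -
    have "t \<cdot> a = v \<cdot> (\<sigma> t \<cdot> a)" using Comp_assoc[OF a \<sigma>(1)[OF t] h(2)] \<sigma>(2)[OF t] by simp
    then show ?thesis using \<theta>v[OF Comp_closed[OF a \<sigma>(1)[OF t]]] ap \<sigma>(1)[OF t] a by (simp add: \<theta>_def)
  qed
  have "inj_on \<theta> (Hom C T ?X)"
    unfolding m.linear_on_inj[OF l\<theta> subspace_Hom]
  proof (intro ballI impI)
    fix g assume g: "g \<in> Hom C T ?X" and "\<theta> g = 0"
    then have "\<sigma> g \<in> ?V" using \<sigma>(1) by (simp add: \<theta>_def)
    then obtain f where f: "f \<in> Hom C T T1" "\<sigma> g = u \<cdot> f" using u(2) by blast
    have "g = (v \<cdot> u) \<cdot> f" using Comp_assoc[OF f(1) h(1,2)] f(2) \<sigma>(2)[OF g] by simp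
    then show "g = 0" using Dist_comp_zero[OF D] Comp_zero_left[OF f(1)] by simp
  qed
  moreover have "\<theta> ` Hom C T ?X = vecs N"
  proof (intro equalityI subsetI)
    fix x assume "x \<in> vecs N"
    then obtain t where t: "t \<in> Hom C T T0" "x = p t" using imp by blast
    then show "x \<in> \<theta> ` Hom C T ?X" using \<theta>v[OF t(1)] Comp_closed[OF t(1) h(2)] by (intro image_eqI[of _ _ "v \<cdot> t"]) simp_all
  next
    fix x assume "x \<in> \<theta> ` Hom C T ?X"
    then show "x \<in> vecs N" using p \<sigma>(1) unfolding \<theta>_def by (elim imageE) simp
  qed
  ultimately have "represents N ?X \<theta>"
    unfolding represents_def bij_betw_def using N l\<theta> a\<theta> by simp
  then show ?thesis by (rule that[OF T1 T0 D])
qed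

text \<open>The cone \<open>Y1\<close> of a left approximation is in \<open>add T\<close> by the
  maximality of \<open>T\<close>. A map \<open>Y1 \<rightarrow> \<Sigma>T\<close> kills
  \<open>q\<close> by rigidity, so it factors through \<open>z\<close> by some
  \<open>\<Sigma>r\<close>; the approximation factors \<open>r\<close> through \<open>p\<close>, and
  \<open>SM p \<cdot> z = 0\<close>.\<close>

lemma coresolution:
  obtains Y0 Y1 p q z where "in_add T Y0" "in_add T Y1" "Dist C W Y0 Y1 p q z"
proof -
  obtain Y0 p where Y0: "in_add T Y0" and p: "p \<in> Hom C W Y0" "\<forall>r\<in>Hom C W T. \<exists>r'\<in>Hom C Y0 T. r = r' \<cdot> p"
    by (rule left_approximation)
  obtain Y1 q z where D: "Dist C W Y0 Y1 p q z" using Dist_cone[OF p(1)] by blast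
  note h = Dist_in[OF D]
  have "f = 0" if f: "f \<in> Hom C Y1 (S T)" for f
  proof -
    have "f \<cdot> q = 0" by (rule rigid[OF Y0 in_add_self Comp_closed[OF h(2) f]])
    then obtain f' where f': "f' \<in> Hom C (S W) (S T)" "f = f' \<cdot> z"
      by (rule Dist_exact_contra[OF Dist_rot[OF D] f])
    obtain r where r: "r \<in> Hom C W T" "f' = SM r" by (rule SM_surj[OF f'(1)])
    obtain r' where r': "r' \<in> Hom C Y0 T" "r = r' \<cdot> p" using p(2) r(1) by blast
    have "f = (SM r' \<cdot> SM p) \<cdot> z" using f'(2) r(2) r'(2) SuspM_Comp[OF h(1) r'(1)] by simp
    also have "\<dots> = SM r' \<cdot> (SM p \<cdot> z)" by (rule Comp_assoc[OF h(3) SM_closed[OF h(1)] SM_closed[OF r'(1)]])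
    finally show "f = 0" using Dist_Susp_comp_zero[OF D] Comp_zero_right[OF SM_closed[OF r'(1)]] by simp
  qed
  then have "Hom C Y1 (S T) = {0}" using Hom_zero by blast
  then have "Y1 \<in> add_closure C T" using cluster_tilting by (simp add: cluster_tilting_def)
  then show ?thesis by (rule that[OF Y0 in_add_closure D])
qed

text \<open>The images of the generators \<open>\<iota> i\<close> are lifted along \<open>g\<close>
  one by one. Representing \<open>M\<close> by an object makes it possible to assemble these lifts
  into a single morphism \<open>k\<close>, whose image under \<open>F\<close> is the required
  homomorphism.\<close>

lemma projective_if_in_add:
  assumes X: "in_add T X" and r: "represents P X \<theta>"
  shows "projective_mod \<Lambda> P"
  unfolding projective_mod_def
proof (intro conjI ballI impI)
  fix M N g f assume M: "M \<in> fd_modules \<Lambda>" and N: "N \<in> fd_modules \<Lambda>" and g: "g \<in> mod_hom \<Lambda> M N"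
    and f: "f \<in> mod_hom \<Lambda> P N" and s: "g ` vecs M = vecs N"
  obtain T1 T0 W u v w \<theta>M where "in_add T T1" "in_add T T0" "Dist C T1 T0 (S (S W)) u v w"
    and rM: "represents M (S (S W)) \<theta>M"
    by (rule presentation[OF M])
  obtain n \<iota> \<pi> where a': "\<forall>i<(n::nat). \<iota> i \<in> Hom C T X \<and> \<pi> i \<in> Hom C X T"
    "(\<Sum>i<n. \<iota> i \<cdot> \<pi> i) = Id C X" by (rule in_addE[OF X])
  then have a: "\<And>i. i < n \<Longrightarrow> \<iota> i \<in> Hom C T X" "\<And>i. i < n \<Longrightarrow> \<pi> i \<in> Hom C X T"
    "(\<Sum>i<n. \<iota> i \<cdot> \<pi> i) = Id C X" by simp_all
  let ?Y = "S (S W)"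
  have "\<exists>y. i < n \<longrightarrow> y \<in> Hom C T ?Y \<and> g (\<theta>M y) = f (\<theta> (\<iota> i))" for i
  proof (cases "i < n")
    case i: True
    have "f (\<theta> (\<iota> i)) \<in> g ` (\<theta>M ` Hom C T ?Y)"
      using mod_hom_in[OF f represents_in[OF r a(1)[OF i]]] s represents_image[OF rM] by simp
    then obtain y where y: "f (\<theta> (\<iota> i)) = g (\<theta>M y)" "y \<in> Hom C T ?Y" unfolding image_image by (rule imageE)
    show ?thesis by (intro exI[of _ y] impI conjI y(2) y(1)[symmetric])
  qed simp
  then have "\<forall>i. \<exists>y. i < n \<longrightarrow> y \<in> Hom C T ?Y \<and> g (\<theta>M y) = f (\<theta> (\<iota> i))" by (rule allI)
  from choice[OF this] obtain y where y': "\<forall>i. i < n \<longrightarrow> y i \<in> Hom C T ?Y \<and> g (\<theta>M (y i)) = f (\<theta> (\<iota> i))"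
    by (elim exE)
  then have y: "\<And>i. i < n \<Longrightarrow> y i \<in> Hom C T ?Y" "\<And>i. i < n \<Longrightarrow> g (\<theta>M (y i)) = f (\<theta> (\<iota> i))"
    by simp_all
  define k where "k = (\<Sum>i<n. y i \<cdot> \<pi> i)"
  have k: "k \<in> Hom C X ?Y" unfolding k_def by (rule Hom_sum) (auto intro: Comp_closed[OF a(2) y(1)])
  have gk: "g (hom_map X \<theta> P \<theta>M k x) = f x" if x: "x \<in> vecs P" for x
  proof -
    obtain t where t: "t \<in> Hom C T X" "x = \<theta> t" by (rule represents_cases[OF r x])
    have c: "\<pi> i \<cdot> t \<in> Hom C T T" if "i < n" for i by (rule Comp_closed[OF t(1) a(2)[OF that]])
    have "f x = (\<Sum>i<n. act N (f (\<theta> (\<iota> i))) (\<pi> i \<cdot> t))"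
      unfolding t(2) by (rule mod_hom_expand[OF a r f t(1)])
    also have "\<dots> = (\<Sum>i<n. g (\<theta>M (y i \<cdot> (\<pi> i \<cdot> t))))"
    proof (intro sum.cong refl)
      fix i assume "i \<in> {..<n}"
      then have i: "i < n" by simp
      have "act N (f (\<theta> (\<iota> i))) (\<pi> i \<cdot> t) = g (act M (\<theta>M (y i)) (\<pi> i \<cdot> t))"
        unfolding y(2)[OF i, symmetric]
        by (rule mod_hom_act[OF g represents_in[OF rM y(1)[OF i]], symmetric]) (simp add: c[OF i])
      then show "act N (f (\<theta> (\<iota> i))) (\<pi> i \<cdot> t) = g (\<theta>M (y i \<cdot> (\<pi> i \<cdot> t)))"
        unfolding represents_act[OF rM y(1)[OF i] c[OF i]] .
    qed
    also have "\<dots> = g (\<Sum>i<n. \<theta>M (y i \<cdot> (\<pi> i \<cdot> t)))"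
      by (rule vs.linear_on_sum[OF mod_hom_linear[OF g] fd_modules_subspace[OF M], symmetric])
        (auto intro: represents_in[OF rM Comp_closed[OF c y(1)]])
    also have "(\<Sum>i<n. \<theta>M (y i \<cdot> (\<pi> i \<cdot> t))) = \<theta>M (\<Sum>i<n. y i \<cdot> (\<pi> i \<cdot> t))"
      by (rule m.linear_on_sum[OF represents_linear[OF rM] subspace_Hom, symmetric]) (auto intro: Comp_closed[OF c y(1)])
    also have "(\<Sum>i<n. y i \<cdot> (\<pi> i \<cdot> t)) = (\<Sum>i<n. (y i \<cdot> \<pi> i) \<cdot> t)"
      by (intro sum.cong refl) (simp add: Comp_assoc[OF t(1) a(2) y(1)])
    also have "\<dots> = k \<cdot> t"
      unfolding k_def by (rule Comp_sum_left[OF t(1), symmetric]) (auto intro: Comp_closed[OF a(2) y(1)])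
    finally show ?thesis unfolding t(2) hom_map_apply[OF r t(1)] by (rule sym)
  qed
  show "\<exists>h\<in>mod_hom \<Lambda> P M. \<forall>x\<in>vecs P. g (h x) = f x"
    by (intro bexI[OF _ hom_map_mod_hom[OF r rM k]] ballI gk)
qed (rule represents_fd[OF r])

lemma hom_map_image:
  assumes "represents N X \<theta>" "U \<subseteq> Hom C T X"
  shows "hom_map X \<theta> N \<theta>' f ` \<theta> ` U = \<theta>' ` (\<lambda>t. f \<cdot> t) ` U"
  unfolding image_image using hom_map_apply[OF assms(1)] assms(2) by (intro image_cong) auto

lemma hom_map_zero_iff:
  assumes "represents N X \<theta>" "represents N' Y \<theta>'" "f \<in> Hom C X Y" "t \<in> Hom C T X"
  shows "hom_map X \<theta> N \<theta>' f (\<theta> t) = 0 \<longleftrightarrow> f \<cdot> t = 0"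
  unfolding hom_map_apply[OF assms(1,4)] by (rule represents_zero_iff[OF assms(2) Comp_closed[OF assms(4,3)]])

lemma Collect_image_conj: "{x \<in> g ` A. Q x} = g ` {t \<in> A. Q (g t)}"
  by blast

lemma ball_image_Collect: "(\<forall>x\<in>g ` {t\<in>A. P t}. Q x) \<longleftrightarrow> (\<forall>t\<in>A. P t \<longrightarrow> Q (g t))"
  by blast

lemma hom_map_kernel:
  assumes r: "represents N X \<theta>" and r': "represents N' Y \<theta>'" and f: "f \<in> Hom C X Y"
  shows "{x\<in>vecs N. hom_map X \<theta> N \<theta>' f x = 0} = \<theta> ` {t\<in>Hom C T X. f \<cdot> t = 0}"
  unfolding represents_image[OF r, symmetric] Collect_image_conj
  by (intro arg_cong[of _ _ "image \<theta>"] Collect_cong conj_cong refl hom_map_zero_iff[OF r r' f])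

text \<open>\<open>F\<close> turns the triangle into a presentation of \<open>N\<close>; one more
  approximation, of the kernel of \<open>F u\<close>, supplies \<open>P2\<close>. The last
  conclusion expresses the image of \<open>d2\<close> by \<open>u\<close>, so that \<open>P2\<close>
  disappears from all later formulas.\<close>

lemma resolution:
  assumes T1: "in_add T T1" and T0: "in_add T T0" and D: "Dist C T1 T0 X u v w" and r: "represents N X \<theta>"
  obtains P0 P1 P2 e d1 d2 \<theta>0 \<theta>1 where "proj_resolution \<Lambda> N P0 P1 P2 e d1 d2"
    "represents P0 T0 \<theta>0" "represents P1 T1 \<theta>1" "d2 ` vecs P2 = \<theta>1 ` {t\<in>Hom C T T1. u \<cdot> t = 0}"
proof -
  note h = Dist_in[OF D]
  let ?V = "{t\<in>Hom C T T1. u \<cdot> t = 0}"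
  have sV: "m.subspace ?V" by (rule m.subspace_ker[OF vector_space_mor linear_Comp_right[OF h(1)] subspace_Hom])
  have "t \<cdot> a \<in> ?V" if t: "t \<in> ?V" and a: "a \<in> Hom C T T" for t a
  proof -
    have t': "t \<in> Hom C T T1" "u \<cdot> t = 0" using t by simp_all
    then show ?thesis using Comp_closed[OF a t'(1)] Comp_assoc[OF a t'(1) h(1)] Comp_zero_left[OF a] by simp
  qed
  then obtain T2 u2 where T2: "in_add T T2" and u2: "u2 \<in> Hom C T2 T1" "(\<lambda>t. u2 \<cdot> t) ` Hom C T T2 = ?V"
    using right_approximation[OF sV] by (metis (no_types, lifting) mem_Collect_eq subsetI)
  obtain P0 \<theta>0 where r0: "represents P0 T0 \<theta>0" by (rule represents_exists)
  obtain P1 \<theta>1 where r1: "represents P1 T1 \<theta>1" by (rule represents_exists)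
  obtain P2 \<theta>2 where r2: "represents P2 T2 \<theta>2" by (rule represents_exists)
  let ?e = "hom_map T0 \<theta>0 P0 \<theta> v" and ?d1 = "hom_map T1 \<theta>1 P1 \<theta>0 u" and ?d2 = "hom_map T2 \<theta>2 P2 \<theta>1 u2"
  have d2: "?d2 ` vecs P2 = \<theta>1 ` ?V"
    using hom_map_image[OF r2 subset_refl, of \<theta>1 u2] unfolding u2(2) represents_image[OF r2] .
  have "(\<lambda>t. v \<cdot> t) ` Hom C T T0 = Hom C T X"
  proof (intro equalityI subsetI)
    fix g assume g: "g \<in> Hom C T X"
    have "w \<cdot> g = 0" by (rule rigid[OF in_add_self T1 Comp_closed[OF g h(3)]])
    then obtain t where "t \<in> Hom C T T0" "g = v \<cdot> t" by (rule Dist_exact_cov[OF Dist_rot[OF D] g])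
    then show "g \<in> (\<lambda>t. v \<cdot> t) ` Hom C T T0" by blast
  qed (auto intro: Comp_closed[OF _ h(2)])
  then have e: "?e ` vecs P0 = vecs N"
    using hom_map_image[OF r0 subset_refl, of \<theta> v]
    unfolding represents_image[OF r0] represents_image[OF r, symmetric] by (simp only:)
  have "(\<lambda>t. u \<cdot> t) ` Hom C T T1 = {t\<in>Hom C T T0. v \<cdot> t = 0}"
  proof (intro equalityI subsetI)
    fix g assume "g \<in> (\<lambda>t. u \<cdot> t) ` Hom C T T1"
    then obtain t where t: "t \<in> Hom C T T1" "g = u \<cdot> t" by (elim imageE)
    have "v \<cdot> g = 0"
      using Comp_assoc[OF t(1) h(1,2)] Dist_comp_zero[OF D] Comp_zero_left[OF t(1)] t(2) by simp
    then show "g \<in> {t\<in>Hom C T T0. v \<cdot> t = 0}" using Comp_closed[OF t(1) h(1)] t(2) by simp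
  next
    fix g assume "g \<in> {t\<in>Hom C T T0. v \<cdot> t = 0}"
    then have g: "g \<in> Hom C T T0" "v \<cdot> g = 0" by simp_all
    obtain t where "t \<in> Hom C T T1" "g = u \<cdot> t" by (rule Dist_exact_cov[OF D g])
    then show "g \<in> (\<lambda>t. u \<cdot> t) ` Hom C T T1" by blast
  qed
  then have d1: "?d1 ` vecs P1 = {x\<in>vecs P0. ?e x = 0}"
    using hom_map_image[OF r1 subset_refl, of \<theta>0 u]
    unfolding represents_image[OF r1] hom_map_kernel[OF r0 r h(2)] by (simp only:)
  have "proj_resolution \<Lambda> N P0 P1 P2 ?e ?d1 ?d2"
    unfolding proj_resolution_def
    using projective_if_in_add[OF T0 r0] projective_if_in_add[OF T1 r1] projective_if_in_add[OF T2 r2]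
      hom_map_mod_hom[OF r0 r h(2)] hom_map_mod_hom[OF r1 r0 h(1)] hom_map_mod_hom[OF r2 r1 u2(1)]
      e d1 d2 hom_map_kernel[OF r1 r0 h(1)] by simp
  then show ?thesis using that r0 r1 d2 by blast
qed

lemma cocycles_fd: "fd_subspace (Scale C) {f\<in>Hom C T1 Y. \<forall>t\<in>Hom C T T1. u \<cdot> t = 0 \<longrightarrow> f \<cdot> t = 0}"
  (is "fd_subspace _ ?Z")
proof (rule m.fd_subset(1)[OF fd_Hom])
  show "m.subspace ?Z"
  proof (rule m.subspaceI)
    show "0 \<in> ?Z" using Hom_zero Comp_zero_left by auto
    show "x + y \<in> ?Z" if "x \<in> ?Z" "y \<in> ?Z" for x y
      using that Hom_add Comp_add_left[of _ T T1 x Y y] by auto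
    show "Scale C c x \<in> ?Z" if "x \<in> ?Z" for c x
      using that Hom_scale Comp_scale_left[of _ T T1 x Y c] by auto
  qed
qed auto

text \<open>The set on the right consists of the 1-cocycles, seen through the Yoneda bijection as
  morphisms \<open>T1 \<rightarrow> Y\<close>.\<close>

lemma euler_form_cocycles:
  assumes T1: "in_add T T1" and T0: "in_add T T0" and D: "Dist C T1 T0 X u v w" and r: "represents N X \<theta>"
    and r': "represents N' Y \<theta>'"
  shows "euler_form \<Lambda> N N' = int (m.dim (Hom C T0 Y)) -
    int (m.dim {f\<in>Hom C T1 Y. \<forall>t\<in>Hom C T T1. u \<cdot> t = 0 \<longrightarrow> f \<cdot> t = 0})"
proof -
  obtain P0 P1 P2 e d1 d2 \<theta>0 \<theta>1 where P: "proj_resolution \<Lambda> N P0 P1 P2 e d1 d2"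
    and r0: "represents P0 T0 \<theta>0" and r1: "represents P1 T1 \<theta>1"
    and d2: "d2 ` vecs P2 = \<theta>1 ` {t\<in>Hom C T T1. u \<cdot> t = 0}"
    by (rule resolution[OF T1 T0 D r])
  let ?Z = "{f\<in>Hom C T1 Y. \<forall>t\<in>Hom C T T1. u \<cdot> t = 0 \<longrightarrow> f \<cdot> t = 0}" and ?m = "hom_map T1 \<theta>1 P1 \<theta>'"
  have b: "?m ` Hom C T1 Y = mod_hom \<Lambda> P1 N'" and inj: "inj_on ?m (Hom C T1 Y)"
    using hom_map_bij[OF T1 r1 r'] by (simp_all add: bij_betw_def)
  have im: "vanishing_hom \<Lambda> P1 (d2 ` vecs P2) N' = ?m ` ?Z"
  proof -
    have iff: "(\<forall>x\<in>d2 ` vecs P2. ?m f x = 0) \<longleftrightarrow> (\<forall>t\<in>Hom C T T1. u \<cdot> t = 0 \<longrightarrow> f \<cdot> t = 0)"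
      if f: "f \<in> Hom C T1 Y" for f
    proof -
      have "(\<forall>x\<in>d2 ` vecs P2. ?m f x = 0) \<longleftrightarrow> (\<forall>t\<in>Hom C T T1. u \<cdot> t = 0 \<longrightarrow> ?m f (\<theta>1 t) = 0)"
        unfolding d2 by (rule ball_image_Collect)
      also have "\<dots> \<longleftrightarrow> (\<forall>t\<in>Hom C T T1. u \<cdot> t = 0 \<longrightarrow> f \<cdot> t = 0)"
        by (intro ball_cong refl imp_cong hom_map_zero_iff[OF r1 r' f])
      finally show ?thesis .
    qed
    show ?thesis
      unfolding vanishing_hom_def b[symmetric] Collect_image_conj
      by (intro arg_cong[of _ _ "image ?m"] Collect_cong conj_cong refl iff)
  qed
  have "mor_dim (?m ` ?Z) = m.dim ?Z"
  proof (rule m.dim_inj[OF vector_space_mscale])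
    show "fd_subspace (Scale C) ?Z" by (rule cocycles_fd)
    show "linear_on (Scale C) mscale ?Z ?m" by (rule linear_on_subset[OF hom_map_linear[OF r1 r']]) auto
    show "inj_on ?m ?Z" by (rule inj_on_subset[OF inj]) auto
  qed
  then show ?thesis
    unfolding euler_form_resolution[OF represents_fd[OF r] represents_fd[OF r'] P] im
      hom_dim_add[OF T0 r0 r'] by simp
qed

end

section \<open>The Euler form in the triangulated category\<close>

context cluster_tilted
begin

text \<open>\<open>annihilating T X (S Y)\<close> and \<open>annihilating (S T) X (S Y)\<close> are
  the spaces \<open>K(X, \<Sigma>Y)\<close> and \<open>K'(X, \<Sigma>Y)\<close> of the overview. The
  target is left arbitrary since \<open>annihilating T X Y\<close>, the kernel of \<open>F\<close>
  on \<open>\<C>(X, Y)\<close>, occurs too.\<close>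

definition annihilating where
  "annihilating V X Y = {f\<in>Hom C X Y. \<forall>t\<in>Hom C V X. f \<cdot> t = 0}"

lemma annihilatingI:
  "f \<in> Hom C X Y \<Longrightarrow> (\<And>t. t \<in> Hom C V X \<Longrightarrow> f \<cdot> t = 0) \<Longrightarrow> f \<in> annihilating V X Y"
  by (simp add: annihilating_def)

lemma annihilatingD:
  assumes "f \<in> annihilating V X Y"
  shows "f \<in> Hom C X Y" "t \<in> Hom C V X \<Longrightarrow> f \<cdot> t = 0"
  using assms by (simp_all add: annihilating_def)

lemma annihilating_subspace: "m.subspace (annihilating V X Y)"
proof (rule m.subspaceI)
  show "0 \<in> annihilating V X Y" by (rule annihilatingI[OF Hom_zero Comp_zero_left])
  show "x + y \<in> annihilating V X Y" if x: "x \<in> annihilating V X Y" and y: "y \<in> annihilating V X Y" for x y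
    by (rule annihilatingI[OF Hom_add[OF annihilatingD(1)[OF x] annihilatingD(1)[OF y]]])
      (simp add: Comp_add_left[OF _ annihilatingD(1)[OF x] annihilatingD(1)[OF y]] annihilatingD(2)[OF x] annihilatingD(2)[OF y])
  show "Scale C c x \<in> annihilating V X Y" if x: "x \<in> annihilating V X Y" for c x
    by (rule annihilatingI[OF Hom_scale[OF annihilatingD(1)[OF x]]])
      (simp add: Comp_scale_left[OF _ annihilatingD(1)[OF x]] annihilatingD(2)[OF x])
qed

lemma annihilating_fd: "fd_subspace (Scale C) (annihilating V X Y)"
  by (rule m.fd_subset(1)[OF fd_Hom annihilating_subspace]) (auto dest: annihilatingD)

lemma annihilating_add:
  assumes f: "f \<in> annihilating V X Y" and A: "in_add V A" and t: "t \<in> Hom C A X"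
  shows "f \<cdot> t = 0"
proof (rule in_add_zero_from[OF A Comp_closed[OF t annihilatingD(1)[OF f]]])
  fix s assume s: "s \<in> Hom C V A"
  show "(f \<cdot> t) \<cdot> s = 0"
    unfolding Comp_assoc[OF s t annihilatingD(1)[OF f]] by (rule annihilatingD(2)[OF f Comp_closed[OF s t]])
qed

section \<open>The long exact sequence of the first triangle\<close>

context
  fixes T1 T0 X u v w
  assumes T1: "in_add T T1" and T0: "in_add T T0" and D: "Dist C T1 T0 X u v w"
begin

lemmas uvw_in = Dist_in[OF D]

lemma annihilating_iff:
  assumes f: "f \<in> Hom C X Y"
  shows "f \<in> annihilating T X Y \<longleftrightarrow> f \<cdot> v = 0"
proof
  assume "f \<in> annihilating T X Y"
  then show "f \<cdot> v = 0" by (rule annihilating_add[OF _ T0 uvw_in(2)])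
next
  assume z: "f \<cdot> v = 0"
  show "f \<in> annihilating T X Y"
  proof (rule annihilatingI[OF f])
    fix t assume t: "t \<in> Hom C T X"
    have "w \<cdot> t = 0" by (rule rigid[OF in_add_self T1 Comp_closed[OF t uvw_in(3)]])
    then obtain s where s: "s \<in> Hom C T T0" "t = v \<cdot> s" by (rule Dist_exact_cov[OF Dist_rot[OF D] t])
    have "f \<cdot> t = (f \<cdot> v) \<cdot> s" unfolding s(2) by (rule Comp_assoc[OF s(1) uvw_in(2) f, symmetric])
    then show "f \<cdot> t = 0" using z Comp_zero_left[OF s(1)] by simp
  qed
qed

text \<open>\<open>f \<mapsto> SM f \<cdot> w\<close> is the connecting map in \<open>\<C>(T0, Y)
  \<rightarrow> \<C>(T1, Y) \<rightarrow> \<C>(X, \<Sigma>Y) \<rightarrow> \<C>(T0,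
  \<Sigma>Y)\<close>. Its kernel consists of the coboundaries; its image is the kernel of
  composition with \<open>v\<close>, which is \<open>K(X, \<Sigma>Y)\<close> by
  \<open>annihilating_iff\<close>.\<close>

lemma cokernel_map_linear: "linear_on (Scale C) (Scale C) (Hom C T1 Y) (\<lambda>f. SM f \<cdot> w)"
  by (rule linear_on_comp[OF linear_SuspM linear_Comp_left[OF uvw_in(3)]]) (auto intro: SM_closed)

lemma cokernel_map_kernel:
  "{f\<in>Hom C T1 Y. SM f \<cdot> w = 0} = (\<lambda>f. f \<cdot> u) ` Hom C T0 Y"
proof (intro equalityI subsetI)
  fix f assume "f \<in> {f\<in>Hom C T1 Y. SM f \<cdot> w = 0}"
  then have f: "f \<in> Hom C T1 Y" "SM f \<cdot> w = 0" by simp_all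
  obtain k where k: "k \<in> Hom C (S T0) (S Y)" "SM f = k \<cdot> (- SM u)"
    by (rule Dist_exact_contra[OF Dist_rot[OF Dist_rot[OF D]] SM_closed[OF f(1)] f(2)])
  obtain g where g: "g \<in> Hom C T0 Y" "k = SM g" by (rule SM_surj[OF k(1)])
  have "SM f = SM (- g \<cdot> u)"
    using k(2) g SuspM_Comp[OF uvw_in(1) g(1)] Comp_neg_right[OF SM_closed[OF g(1)] SM_closed[OF uvw_in(1)]]
      SM_neg[OF Comp_closed[OF uvw_in(1) g(1)]] Comp_neg_left[OF uvw_in(1) g(1)] by simp
  then have "f = - g \<cdot> u" by (rule SM_inj[OF f(1) Comp_closed[OF uvw_in(1) Hom_neg[OF g(1)]]])
  then show "f \<in> (\<lambda>f. f \<cdot> u) ` Hom C T0 Y" using Hom_neg[OF g(1)] by (rule image_eqI)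
next
  fix f assume "f \<in> (\<lambda>f. f \<cdot> u) ` Hom C T0 Y"
  then obtain g where g: "f = g \<cdot> u" "g \<in> Hom C T0 Y" by (rule imageE)
  have "SM f \<cdot> w = SM g \<cdot> (SM u \<cdot> w)"
    unfolding g(1) SuspM_Comp[OF uvw_in(1) g(2)] by (rule Comp_assoc[OF uvw_in(3) SM_closed[OF uvw_in(1)] SM_closed[OF g(2)]])
  then show "f \<in> {f\<in>Hom C T1 Y. SM f \<cdot> w = 0}"
    using Dist_Susp_comp_zero[OF D] Comp_zero_right[OF SM_closed[OF g(2)]] Comp_closed[OF uvw_in(1) g(2)] g(1) by simp
qed

lemma cokernel_map_image:
  "(\<lambda>f. SM f \<cdot> w) ` Hom C T1 Y = annihilating T X (S Y)"
proof (intro equalityI subsetI)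
  fix g assume "g \<in> (\<lambda>f. SM f \<cdot> w) ` Hom C T1 Y"
  then obtain f where f: "g = SM f \<cdot> w" "f \<in> Hom C T1 Y" by (rule imageE)
  have wv: "w \<cdot> v = 0" by (rule Dist_comp_zero[OF Dist_rot[OF D]])
  have g: "g \<in> Hom C X (S Y)" unfolding f(1) by (rule Comp_closed[OF uvw_in(3) SM_closed[OF f(2)]])
  have "g \<cdot> v = 0"
    unfolding f(1) Comp_assoc[OF uvw_in(2,3) SM_closed[OF f(2)]] wv by (rule Comp_zero_right[OF SM_closed[OF f(2)]])
  then show "g \<in> annihilating T X (S Y)" using annihilating_iff[OF g] by simp
next
  fix g assume g: "g \<in> annihilating T X (S Y)"
  note g' = annihilatingD(1)[OF g]
  have "g \<cdot> v = 0" using g annihilating_iff[OF g'] by simp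
  then obtain k where k: "k \<in> Hom C (S T1) (S Y)" "g = k \<cdot> w"
    by (rule Dist_exact_contra[OF Dist_rot[OF D] g'])
  obtain f where f: "f \<in> Hom C T1 Y" "k = SM f" by (rule SM_surj[OF k(1)])
  show "g \<in> (\<lambda>f. SM f \<cdot> w) ` Hom C T1 Y"
    unfolding k(2) f(2) by (rule imageI[OF f(1)])
qed

text \<open>By exactness at \<open>\<Sigma>T1\<close>, the maps \<open>t\<close> with
  \<open>u \<cdot> t = 0\<close> are, up to suspension, the composites of \<open>w\<close> with maps
  \<open>\<Sigma>T \<rightarrow> X\<close>. So the cocycle condition turns into vanishing on
  \<open>\<Sigma>T\<close>, and the connecting map identifies cocycles modulo coboundaries with
  \<open>K \<inter> K'\<close>.\<close>

lemma cokernel_map_annihilating: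
  assumes f: "f \<in> Hom C T1 Y"
  shows "(\<forall>t\<in>Hom C T T1. u \<cdot> t = 0 \<longrightarrow> f \<cdot> t = 0) \<longleftrightarrow> SM f \<cdot> w \<in> annihilating (S T) X (S Y)"
proof
  assume z: "\<forall>t\<in>Hom C T T1. u \<cdot> t = 0 \<longrightarrow> f \<cdot> t = 0"
  show "SM f \<cdot> w \<in> annihilating (S T) X (S Y)"
  proof (rule annihilatingI[OF Comp_closed[OF uvw_in(3) SM_closed[OF f]]])
    fix s assume s: "s \<in> Hom C (S T) X"
    obtain t where t: "t \<in> Hom C T T1" "w \<cdot> s = SM t" by (rule SM_surj[OF Comp_closed[OF s uvw_in(3)]])
    have "SM (u \<cdot> t) = (SM u \<cdot> w) \<cdot> s"
      unfolding SuspM_Comp[OF t(1) uvw_in(1)] t(2)[symmetric] by (rule Comp_assoc[OF s uvw_in(3) SM_closed[OF uvw_in(1)], symmetric])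
    then have "SM (u \<cdot> t) = 0" using Dist_Susp_comp_zero[OF D] Comp_zero_left[OF s] by simp
    then have "u \<cdot> t = 0" by (rule SM_eq_zero[OF Comp_closed[OF t(1) uvw_in(1)]])
    then have "f \<cdot> t = 0" using z t(1) by blast
    then show "(SM f \<cdot> w) \<cdot> s = 0"
      unfolding Comp_assoc[OF s uvw_in(3) SM_closed[OF f]] t(2) SuspM_Comp[OF t(1) f, symmetric] by (simp add: SM_zero)
  qed
next
  assume z: "SM f \<cdot> w \<in> annihilating (S T) X (S Y)"
  show "\<forall>t\<in>Hom C T T1. u \<cdot> t = 0 \<longrightarrow> f \<cdot> t = 0"
  proof (intro ballI impI)
    fix t assume t: "t \<in> Hom C T T1" and ut: "u \<cdot> t = 0"
    have "(- SM u) \<cdot> SM t = 0"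
      using Comp_neg_left[OF SM_closed[OF t] SM_closed[OF uvw_in(1)]] SuspM_Comp[OF t uvw_in(1)] ut SM_zero by simp
    then obtain s where s: "s \<in> Hom C (S T) X" "SM t = w \<cdot> s"
      by (rule Dist_exact_cov[OF Dist_rot[OF Dist_rot[OF D]] SM_closed[OF t]])
    have "SM (f \<cdot> t) = (SM f \<cdot> w) \<cdot> s"
      unfolding SuspM_Comp[OF t f] s(2) by (rule Comp_assoc[OF s(1) uvw_in(3) SM_closed[OF f], symmetric])
    also have "\<dots> = 0" by (rule annihilatingD(2)[OF z s(1)])
    finally show "f \<cdot> t = 0" by (rule SM_eq_zero[OF Comp_closed[OF t f]])
  qed
qed

text \<open>The dimension of the coboundaries is eliminated in two ways: by
  \<open>\<C>(T1, Y)\<close>, which is an extension of \<open>K(X, \<Sigma>Y)\<close> by the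
  coboundaries, and by \<open>\<C>(T0, Y)\<close>, which is an extension of the coboundaries by
  \<open>\<C>(X, Y)\<close> modulo \<open>K(X, Y)\<close>. The first version is meant for
  \<langle>N, N'\<rangle>, the second for \<langle>N', N\<rangle>.\<close>

lemma euler_form_annihilating:
  assumes r: "represents N X \<theta>" and r': "represents N' Y \<theta>'"
  shows "euler_form \<Lambda> N N' = int (m.dim (Hom C T0 Y)) - int (m.dim (Hom C T1 Y))
      + int (m.dim (annihilating T X (S Y)))
      - int (m.dim (annihilating T X (S Y) \<inter> annihilating (S T) X (S Y)))" (is ?A)
    and "euler_form \<Lambda> N N' = int (m.dim (Hom C X Y)) - int (m.dim (annihilating T X Y))
      - int (m.dim (annihilating T X (S Y) \<inter> annihilating (S T) X (S Y)))" (is ?E2)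
proof -
  let ?Z = "{f\<in>Hom C T1 Y. \<forall>t\<in>Hom C T T1. u \<cdot> t = 0 \<longrightarrow> f \<cdot> t = 0}"
  let ?\<psi> = "\<lambda>f. SM f \<cdot> w" and ?B = "(\<lambda>f. f \<cdot> u) ` Hom C T0 Y"
  have Z: "?Z = {f\<in>Hom C T1 Y. ?\<psi> f \<in> annihilating (S T) X (S Y)}"
    by (intro Collect_cong conj_cong refl cokernel_map_annihilating)
  have imZ: "?\<psi> ` ?Z = annihilating T X (S Y) \<inter> annihilating (S T) X (S Y)"
    unfolding Z cokernel_map_image[symmetric] by blast
  have kerZ: "{f\<in>?Z. ?\<psi> f = 0} = ?B"
    unfolding Z cokernel_map_kernel[symmetric] using m.subspace_0[OF annihilating_subspace] by auto
  have fZ: "fd_subspace (Scale C) ?Z" by (rule cocycles_fd)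
  have dZ: "m.dim ?Z = m.dim ?B + m.dim (annihilating T X (S Y) \<inter> annihilating (S T) X (S Y))"
    using m.rank_nullity(2)[OF vector_space_mor fZ linear_on_subset[OF cokernel_map_linear]]
    unfolding kerZ imZ by blast
  have d1: "m.dim (Hom C T1 Y) = m.dim ?B + m.dim (annihilating T X (S Y))"
    using m.rank_nullity(2)[OF vector_space_mor fd_Hom cokernel_map_linear]
    unfolding cokernel_map_kernel cokernel_map_image .
  note e = euler_form_cocycles[OF T1 T0 D r r']
  show ?A using e dZ d1 by simp
  have k0: "{f\<in>Hom C T0 Y. f \<cdot> u = 0} = (\<lambda>f. f \<cdot> v) ` Hom C X Y"
  proof (intro equalityI subsetI)
    fix f assume "f \<in> {f\<in>Hom C T0 Y. f \<cdot> u = 0}"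
    then have f: "f \<in> Hom C T0 Y" "f \<cdot> u = 0" by simp_all
    obtain g where "g \<in> Hom C X Y" "f = g \<cdot> v" by (rule Dist_exact_contra[OF D f])
    then show "f \<in> (\<lambda>f. f \<cdot> v) ` Hom C X Y" by blast
  next
    fix f assume "f \<in> (\<lambda>f. f \<cdot> v) ` Hom C X Y"
    then obtain g where g: "f = g \<cdot> v" "g \<in> Hom C X Y" by (rule imageE)
    have "f \<cdot> u = g \<cdot> (v \<cdot> u)" unfolding g(1) by (rule Comp_assoc[OF uvw_in(1,2) g(2)])
    then show "f \<in> {f\<in>Hom C T0 Y. f \<cdot> u = 0}"
      using Dist_comp_zero[OF D] Comp_zero_right[OF g(2)] Comp_closed[OF uvw_in(2) g(2)] g(1) by simp
  qed
  have kX: "{f\<in>Hom C X Y. f \<cdot> v = 0} = annihilating T X Y"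
    using annihilating_iff annihilatingD(1) by blast
  have "m.dim (Hom C T0 Y) = m.dim ((\<lambda>f. f \<cdot> v) ` Hom C X Y) + m.dim ?B"
    using m.rank_nullity(2)[OF vector_space_mor fd_Hom linear_Comp_left[OF uvw_in(1), of Y]] unfolding k0 .
  moreover have "m.dim (Hom C X Y) = m.dim (annihilating T X Y) + m.dim ((\<lambda>f. f \<cdot> v) ` Hom C X Y)"
    using m.rank_nullity(2)[OF vector_space_mor fd_Hom linear_Comp_left[OF uvw_in(2), of Y]] unfolding kX .
  ultimately show ?E2 using e dZ by simp
qed

end

end

section \<open>Calabi-Yau duality\<close>

locale cy_pairing = cluster_tilted C T
  for C :: "('k::field, 'o, 'm::ab_group_add) tri_cat" (structure) and T :: 'o +
  fixes \<phi> :: "'o \<Rightarrow> 'o \<Rightarrow> 'm \<Rightarrow> 'm \<Rightarrow> 'k"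
  assumes bij: "bij_betw (\<phi> X Y) (Hom C X (Susp C Y)) (dual_space (Scale C) (Hom C Y (Susp C X)))"
    and lin: "linear_on (Scale C) (fun_scale (*)) (Hom C X (Susp C Y)) (\<phi> X Y)"
    and nat1: "a \<in> Hom C X' X \<Longrightarrow> f \<in> Hom C X (Susp C Y) \<Longrightarrow> g \<in> Hom C Y (Susp C X') \<Longrightarrow>
      \<phi> X' Y (f \<cdot> a) g = \<phi> X Y f (SuspM C a \<cdot> g)"
    and nat2: "b \<in> Hom C Y Y' \<Longrightarrow> f \<in> Hom C X (Susp C Y) \<Longrightarrow> g \<in> Hom C Y' (Susp C X) \<Longrightarrow>
      \<phi> X Y' (SuspM C b \<cdot> f) g = \<phi> X Y f (g \<cdot> b)"
begin

lemma pairing_dual: "f \<in> Hom C X (S Y) \<Longrightarrow> \<phi> X Y f \<in> dual_space (Scale C) (Hom C Y (S X))"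
  by (rule bij_betw_apply[OF bij])

lemma pairing_linear_right: "f \<in> Hom C X (S Y) \<Longrightarrow> linear_on (Scale C) (*) (Hom C Y (S X)) (\<phi> X Y f)"
  using pairing_dual by (simp add: dual_space_def)

lemma pairing_linear_left: "linear_on (Scale C) (*) (Hom C X (S Y)) (\<lambda>f. \<phi> X Y f g)"
  using linear_on_add[OF lin] linear_on_scale[OF lin] by (simp add: linear_on_def fun_scale_def)

lemma pairing_zero_left: "\<phi> X Y 0 g = 0"
  by (rule linear_on_zero[OF pairing_linear_left Hom_zero])

lemma pairing_zero_right: "f \<in> Hom C X (S Y) \<Longrightarrow> \<phi> X Y f 0 = 0"
  by (rule linear_on_zero[OF pairing_linear_right Hom_zero])

lemma pairing_nondegenerate_left:
  assumes f: "f \<in> Hom C X (S Y)" and z: "\<And>g. g \<in> Hom C Y (S X) \<Longrightarrow> \<phi> X Y f g = 0"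
  shows "f = 0"
proof (rule inj_onD[OF bij_betw_imp_inj_on[OF bij] _ f Hom_zero])
  show "\<phi> X Y f = \<phi> X Y 0"
  proof
    fix g
    show "\<phi> X Y f g = \<phi> X Y 0 g"
      using z pairing_dual[OF f] pairing_zero_left by (cases "g \<in> Hom C Y (S X)") (simp_all add: dual_space_def)
  qed
qed

lemma pairing_nondegenerate_right:
  assumes g: "g \<in> Hom C Y (S X)" and z: "\<And>f. f \<in> Hom C X (S Y) \<Longrightarrow> \<phi> X Y f g = 0"
  shows "g = 0"
proof (rule ccontr)
  assume "g \<noteq> 0"
  then obtain \<xi> where \<xi>: "\<xi> \<in> dual_space (Scale C) (Hom C Y (S X))" "\<xi> g \<noteq> 0"
    by (rule m.dual_separates[OF subspace_Hom g])
  then have "\<xi> \<in> \<phi> X Y ` Hom C X (S Y)" using bij_betw_imp_surj_on[OF bij] by simp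
  then obtain f where f: "\<xi> = \<phi> X Y f" "f \<in> Hom C X (S Y)" by (rule imageE)
  then show False using z[OF f(2)] \<xi>(2) by simp
qed

lemma dim_Hom_Susp: "m.dim (Hom C Y (S X)) = m.dim (Hom C X (S Y))"
proof -
  have "{f\<in>Hom C X (S Y). \<forall>g\<in>Hom C Y (S X). \<phi> X Y f g = 0} = {0}"
    using pairing_nondegenerate_left Hom_zero pairing_zero_left by auto
  moreover have "{g\<in>Hom C Y (S X). \<forall>f\<in>Hom C X (S Y). \<phi> X Y f g = 0} = {0}"
    using pairing_nondegenerate_right Hom_zero pairing_zero_right by auto
  ultimately show ?thesis
    using pairing_rank_eq[OF vector_space_mor vector_space_mor fd_Hom fd_Hom pairing_linear_right pairing_linear_left, of X Y]
      m.dim_zero by simp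
qed

lemma dim_Hom_Susp2: "m.dim (Hom C Y (S (S X))) = m.dim (Hom C X Y)"
proof -
  have "m.dim (Hom C (S X) (S Y)) = m.dim (Hom C X Y)"
    using m.dim_inj[OF vector_space_mor fd_Hom linear_SuspM bij_betw_imp_inj_on[OF bij_SuspM]]
      bij_betw_imp_surj_on[OF bij_SuspM] by metis
  then show ?thesis using dim_Hom_Susp by simp
qed

text \<open>The dual of \<open>\<C>(Y, \<Sigma>\<^sup>2V)\<close> is \<open>\<C>(V, Y)\<close> up to
  suspension, and by naturality the pairing of \<open>q\<close> with \<open>SM t\<close> depends
  only on \<open>q \<cdot> t\<close>.\<close>

lemma zero_if_annihilating:
  assumes q: "q \<in> Hom C Y (S (S V))" and z: "\<And>t. t \<in> Hom C V Y \<Longrightarrow> q \<cdot> t = 0"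
  shows "q = 0"
proof (rule pairing_nondegenerate_left[OF q])
  fix g assume "g \<in> Hom C (S V) (S Y)"
  then obtain t where t: "t \<in> Hom C V Y" "g = SM t" by (rule SM_surj)
  have "\<phi> Y (S V) q g = \<phi> V (S V) (q \<cdot> t) (Id C (S V))"
    using nat1[OF t(1) q Id_closed] Comp_Id[OF SM_closed[OF t(1)]] t(2) by simp
  then show "\<phi> Y (S V) q g = 0" using z[OF t(1)] pairing_zero_left by simp
qed

lemma rigid_Susp:
  assumes "in_add T A" and f: "f \<in> Hom C (S T) (S (S A))"
  shows "f = 0"
proof -
  obtain g where g: "g \<in> Hom C T (S A)" "f = SM g" by (rule SM_surj[OF f])
  then show ?thesis using rigid[OF in_add_self assms(1) g(1)] SM_zero by simp
qed

section \<open>The long exact sequence of the second triangle\<close>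

context
  fixes W Y0 Y1 p q z
  assumes Y0: "in_add T Y0" and Y1: "in_add T Y1" and D: "Dist C W Y0 Y1 p q z"
begin

lemmas pqz_in = Dist_in[OF D]

text \<open>The coresolution of \<open>W\<close>, suspended twice, is the second triangle of the
  overview, with \<open>Y0\<close> and \<open>Y1\<close> for \<open>U\<^sub>0\<close> and
  \<open>U\<^sub>1\<close>.\<close>

abbreviation X where "X \<equiv> S (S W)"
abbreviation P where "P \<equiv> SM (SM p)"
abbreviation Q where "Q \<equiv> SM (SM q)"
abbreviation Z where "Z \<equiv> SM (SM z)"

lemma Dist_PQZ: "Dist C X (S (S Y0)) (S (S Y1)) P Q Z"
  by (rule Dist_Susp2[OF D])

lemmas PQZ_in = Dist_in[OF Dist_PQZ]

text \<open>The neighbouring triangle in which \<open>X\<close> is the middle vertex, reached by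
  five rotations of \<open>D\<close>: it factors maps killed by \<open>P\<close> through
  \<open>\<Sigma>Y1\<close>.\<close>

lemma Dist_left: "Dist C (S Y1) X (S (S Y0)) (- SM z) P (- SM (- SM q))"
proof -
  have "Dist C (S Y0) (S Y1) X (- SM q) (- SM z) (- SM (- SM p))"
    by (rule Dist_rot[OF Dist_rot[OF Dist_rot[OF Dist_rot[OF D]]]])
  moreover have "- SM (- SM p) = P" using SM_neg[OF SM_closed[OF pqz_in(1)]] by simp
  ultimately show ?thesis using Dist_rot by simp
qed

text \<open>A map killed by \<open>P\<close> factors through \<open>\<Sigma>Y1\<close> and so kills
  all maps from \<open>T\<close> by rigidity. Conversely, if \<open>f\<close> kills maps from
  \<open>T\<close>, it kills maps from \<open>Y0\<close>; then \<open>P \<cdot> f\<close>, with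
  target \<open>\<Sigma>\<^sup>2Y0\<close>, vanishes by duality.\<close>

lemma kernel_P: "{f\<in>Hom C Y X. P \<cdot> f = 0} = annihilating T Y X"
proof (intro equalityI subsetI)
  fix f assume "f \<in> {f\<in>Hom C Y X. P \<cdot> f = 0}"
  then have f: "f \<in> Hom C Y X" "P \<cdot> f = 0" by simp_all
  obtain g where g: "g \<in> Hom C Y (S Y1)" "f = (- SM z) \<cdot> g" by (rule Dist_exact_cov[OF Dist_left f])
  show "f \<in> annihilating T Y X"
  proof (rule annihilatingI[OF f(1)])
    fix t assume t: "t \<in> Hom C T Y"
    have "g \<cdot> t = 0" by (rule rigid[OF in_add_self Y1 Comp_closed[OF t g(1)]])
    then show "f \<cdot> t = 0"
      unfolding g(2) Comp_assoc[OF t g(1) Hom_neg[OF SM_closed[OF pqz_in(3)]]]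
      by (simp add: Comp_zero_right[OF Hom_neg[OF SM_closed[OF pqz_in(3)]]])
  qed
next
  fix f assume f: "f \<in> annihilating T Y X"
  note f' = annihilatingD(1)[OF f]
  have "P \<cdot> f = 0"
  proof (rule zero_if_annihilating[OF Comp_closed[OF f' PQZ_in(1)]])
    fix t assume t: "t \<in> Hom C Y0 Y"
    show "(P \<cdot> f) \<cdot> t = 0"
      unfolding Comp_assoc[OF t f' PQZ_in(1)] annihilating_add[OF f Y0 t] by (rule Comp_zero_right[OF PQZ_in(1)])
  qed
  then show "f \<in> {f\<in>Hom C Y X. P \<cdot> f = 0}" using f' by simp
qed

text \<open>The same argument one suspension further: composites with \<open>Z\<close> kill maps
  from \<open>\<Sigma>T\<close> because \<open>\<C>(\<Sigma>T, \<Sigma>\<^sup>2Y1) = 0\<close>, and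
  duality with maps from \<open>\<Sigma>Y0\<close> makes \<open>SM P \<cdot> f\<close> vanish, so
  that \<open>f\<close> factors through \<open>Z\<close>.\<close>

lemma image_Z: "(\<lambda>g. Z \<cdot> g) ` Hom C Y (S (S Y1)) = annihilating (S T) Y (S X)"
proof (intro equalityI subsetI)
  fix f assume "f \<in> (\<lambda>g. Z \<cdot> g) ` Hom C Y (S (S Y1))"
  then obtain g where g: "f = Z \<cdot> g" "g \<in> Hom C Y (S (S Y1))" by (rule imageE)
  show "f \<in> annihilating (S T) Y (S X)"
    unfolding g(1)
  proof (rule annihilatingI[OF Comp_closed[OF g(2) PQZ_in(3)]])
    fix t assume t: "t \<in> Hom C (S T) Y"
    have "g \<cdot> t = 0" by (rule rigid_Susp[OF Y1 Comp_closed[OF t g(2)]])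
    then show "(Z \<cdot> g) \<cdot> t = 0"
      unfolding Comp_assoc[OF t g(2) PQZ_in(3)] by (simp add: Comp_zero_right[OF PQZ_in(3)])
  qed
next
  fix f assume f: "f \<in> annihilating (S T) Y (S X)"
  note f' = annihilatingD(1)[OF f]
  note hP = SM_closed[OF PQZ_in(1)]
  have "SM P \<cdot> f = 0"
  proof (rule zero_if_annihilating[OF Comp_closed[OF f' hP]])
    fix t assume t: "t \<in> Hom C (S Y0) Y"
    show "(SM P \<cdot> f) \<cdot> t = 0"
      unfolding Comp_assoc[OF t f' hP] annihilating_add[OF f in_add_Susp[OF Y0] t] by (rule Comp_zero_right[OF hP])
  qed
  then have "(- SM P) \<cdot> f = 0" using Comp_neg_left[OF f' hP] by simp
  then obtain g where "g \<in> Hom C Y (S (S Y1))" "f = Z \<cdot> g"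
    by (rule Dist_exact_cov[OF Dist_rot[OF Dist_rot[OF Dist_PQZ]] f'])
  then show "f \<in> (\<lambda>g. Z \<cdot> g) ` Hom C Y (S (S Y1))" by blast
qed

lemma exact_image:
  assumes D: "Dist C A B E a b c"
  shows "(\<lambda>g. a \<cdot> g) ` Hom C Y A = {g\<in>Hom C Y B. b \<cdot> g = 0}"
proof (intro equalityI subsetI)
  fix f assume "f \<in> (\<lambda>g. a \<cdot> g) ` Hom C Y A"
  then obtain g where g: "f = a \<cdot> g" "g \<in> Hom C Y A" by (rule imageE)
  note h = Dist_in[OF D]
  have "b \<cdot> f = (b \<cdot> a) \<cdot> g" unfolding g(1) by (rule Comp_assoc[OF g(2) h(1,2), symmetric])
  then show "f \<in> {g\<in>Hom C Y B. b \<cdot> g = 0}"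
    using Dist_comp_zero[OF D] Comp_zero_left[OF g(2)] Comp_closed[OF g(2) h(1)] g(1) by simp
next
  fix f assume "f \<in> {g\<in>Hom C Y B. b \<cdot> g = 0}"
  then have f: "f \<in> Hom C Y B" "b \<cdot> f = 0" by simp_all
  obtain g where "g \<in> Hom C Y A" "f = a \<cdot> g" by (rule Dist_exact_cov[OF D f])
  then show "f \<in> (\<lambda>g. a \<cdot> g) ` Hom C Y A" by blast
qed

text \<open>The alternating sum of dimensions along \<open>0 \<rightarrow> K(Y, X) \<rightarrow>
  \<C>(Y, X) \<rightarrow> \<C>(Y, \<Sigma>\<^sup>2Y0) \<rightarrow> \<C>(Y, \<Sigma>\<^sup>2Y1)
  \<rightarrow> K'(Y, \<Sigma>X) \<rightarrow> 0\<close>, with duality applied to the terms in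
  \<open>Y0\<close> and \<open>Y1\<close>.\<close>

lemma coresolution_dim:
  "int (m.dim (Hom C Y X)) - int (m.dim (annihilating T Y X)) - int (m.dim (annihilating (S T) Y (S X)))
    = int (m.dim (Hom C Y0 Y)) - int (m.dim (Hom C Y1 Y))"
proof -
  have "m.dim (Hom C Y X) = m.dim (annihilating T Y X) + m.dim ((\<lambda>g. P \<cdot> g) ` Hom C Y X)"
    using m.rank_nullity(2)[OF vector_space_mor fd_Hom linear_Comp_right[OF PQZ_in(1), of Y]] unfolding kernel_P .
  moreover have "m.dim (Hom C Y (S (S Y0))) = m.dim ((\<lambda>g. P \<cdot> g) ` Hom C Y X) + m.dim ((\<lambda>g. Q \<cdot> g) ` Hom C Y (S (S Y0)))"
    using m.rank_nullity(2)[OF vector_space_mor fd_Hom linear_Comp_right[OF PQZ_in(2), of Y]]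
    unfolding exact_image[OF Dist_PQZ] .
  moreover have "m.dim (Hom C Y (S (S Y1))) = m.dim ((\<lambda>g. Q \<cdot> g) ` Hom C Y (S (S Y0))) + m.dim (annihilating (S T) Y (S X))"
    using m.rank_nullity(2)[OF vector_space_mor fd_Hom linear_Comp_right[OF PQZ_in(3), of Y]]
    unfolding exact_image[OF Dist_rot[OF Dist_PQZ]] image_Z .
  ultimately show ?thesis unfolding dim_Hom_Susp2 by simp
qed

section \<open>Radicals of the Calabi-Yau pairing\<close>

context
  fixes T1 T0 u v w
  assumes T1: "in_add T T1" and T0: "in_add T T0" and D': "Dist C T1 T0 X u v w"
begin

text \<open>For \<open>t\<close> from \<open>\<Sigma>T\<close> to \<open>X\<close>, naturality turns
  the pairing of \<open>f \<cdot> t\<close> with \<open>y\<close> into that of \<open>f\<close> with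
  \<open>SM t \<cdot> y\<close>, which lies in \<open>K'\<close> because
  \<open>\<C>(\<Sigma>T, \<Sigma>\<^sup>2T) = 0\<close>; nondegeneracy gives
  \<open>f \<cdot> t = 0\<close>. Conversely, each element of \<open>K'(Y, \<Sigma>X)\<close> is
  some \<open>Z \<cdot> y\<close>, and \<open>SM z\<close> moves across to \<open>f\<close>, which
  kills it.\<close>

lemma left_radical:
  "{f\<in>annihilating T X (S Y). \<forall>g\<in>annihilating (S T) Y (S X). \<phi> X Y f g = 0}
    = annihilating T X (S Y) \<inter> annihilating (S T) X (S Y)"
proof (intro equalityI subsetI)
  fix f assume "f \<in> {f\<in>annihilating T X (S Y). \<forall>g\<in>annihilating (S T) Y (S X). \<phi> X Y f g = 0}"
  then have f: "f \<in> annihilating T X (S Y)" and fg: "\<And>g. g \<in> annihilating (S T) Y (S X) \<Longrightarrow> \<phi> X Y f g = 0"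
    by simp_all
  note f' = annihilatingD(1)[OF f]
  have "f \<in> annihilating (S T) X (S Y)"
  proof (rule annihilatingI[OF f'])
    fix t assume t: "t \<in> Hom C (S T) X"
    show "f \<cdot> t = 0"
    proof (rule pairing_nondegenerate_left[OF Comp_closed[OF t f']])
      fix y assume y: "y \<in> Hom C Y (S (S T))"
      note ty = Comp_closed[OF y SM_closed[OF t]]
      have "SM t \<cdot> y \<in> annihilating (S T) Y (S X)"
      proof (rule annihilatingI[OF ty])
        fix s assume s: "s \<in> Hom C (S T) Y"
        have "y \<cdot> s = 0" by (rule rigid_Susp[OF in_add_self Comp_closed[OF s y]])
        then show "(SM t \<cdot> y) \<cdot> s = 0"
          unfolding Comp_assoc[OF s y SM_closed[OF t]] by (simp add: Comp_zero_right[OF SM_closed[OF t]])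
      qed
      then show "\<phi> (S T) Y (f \<cdot> t) y = 0" using nat1[OF t f' y] fg by simp
    qed
  qed
  with f show "f \<in> annihilating T X (S Y) \<inter> annihilating (S T) X (S Y)" by blast
next
  fix f assume "f \<in> annihilating T X (S Y) \<inter> annihilating (S T) X (S Y)"
  then have f: "f \<in> annihilating T X (S Y)" "f \<in> annihilating (S T) X (S Y)" by simp_all
  have "\<phi> X Y f g = 0" if g: "g \<in> annihilating (S T) Y (S X)" for g
  proof -
    obtain y where y: "g = Z \<cdot> y" "y \<in> Hom C Y (S (S Y1))" using g unfolding image_Z[symmetric] by (rule imageE)
    have "\<phi> X Y f g = \<phi> (S Y1) Y (f \<cdot> SM z) y"
      unfolding y(1) by (rule nat1[OF SM_closed[OF pqz_in(3)] annihilatingD(1)[OF f(1)] y(2), symmetric])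
    then show ?thesis
      using annihilating_add[OF f(2) in_add_Susp[OF Y1] SM_closed[OF pqz_in(3)]] pairing_zero_left by simp
  qed
  with f(1) show "f \<in> {f\<in>annihilating T X (S Y). \<forall>g\<in>annihilating (S T) Y (S X). \<phi> X Y f g = 0}" by simp
qed

text \<open>Here naturality in the second variable is used: \<open>SM t \<cdot> a\<close> lies in
  \<open>K\<close> because \<open>\<C>(T, \<Sigma>T) = 0\<close>. Conversely, each element of
  \<open>K(X, \<Sigma>Y)\<close> is some \<open>SM k \<cdot> w\<close>, by the first triangle, and
  \<open>k\<close> moves across to \<open>g\<close>, which kills maps from
  \<open>T1\<close>.\<close>

lemma right_radical:
  "{g\<in>annihilating (S T) Y (S X). \<forall>f\<in>annihilating T X (S Y). \<phi> X Y f g = 0}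
    = annihilating T Y (S X) \<inter> annihilating (S T) Y (S X)"
proof (intro equalityI subsetI)
  fix g assume "g \<in> {g\<in>annihilating (S T) Y (S X). \<forall>f\<in>annihilating T X (S Y). \<phi> X Y f g = 0}"
  then have g: "g \<in> annihilating (S T) Y (S X)" and fg: "\<And>f. f \<in> annihilating T X (S Y) \<Longrightarrow> \<phi> X Y f g = 0"
    by simp_all
  note g' = annihilatingD(1)[OF g]
  have "g \<in> annihilating T Y (S X)"
  proof (rule annihilatingI[OF g'])
    fix t assume t: "t \<in> Hom C T Y"
    show "g \<cdot> t = 0"
    proof (rule pairing_nondegenerate_right[OF Comp_closed[OF t g']])
      fix a assume a: "a \<in> Hom C X (S T)"
      have "SM t \<cdot> a \<in> annihilating T X (S Y)"
      proof (rule annihilatingI[OF Comp_closed[OF a SM_closed[OF t]]])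
        fix s assume s: "s \<in> Hom C T X"
        have "a \<cdot> s = 0" by (rule rigid_T[OF Comp_closed[OF s a]])
        then show "(SM t \<cdot> a) \<cdot> s = 0"
          unfolding Comp_assoc[OF s a SM_closed[OF t]] by (simp add: Comp_zero_right[OF SM_closed[OF t]])
      qed
      then show "\<phi> X T a (g \<cdot> t) = 0" using nat2[OF t a g'] fg by simp
    qed
  qed
  with g show "g \<in> annihilating T Y (S X) \<inter> annihilating (S T) Y (S X)" by blast
next
  fix g assume "g \<in> annihilating T Y (S X) \<inter> annihilating (S T) Y (S X)"
  then have g: "g \<in> annihilating T Y (S X)" "g \<in> annihilating (S T) Y (S X)" by simp_all
  note w = Dist_in(3)[OF D']
  have "\<phi> X Y f g = 0" if f: "f \<in> annihilating T X (S Y)" for f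
  proof -
    obtain k where k: "f = SM k \<cdot> w" "k \<in> Hom C T1 Y"
      using f unfolding cokernel_map_image[OF T1 T0 D', symmetric] by (rule imageE)
    have "\<phi> X Y f g = \<phi> X T1 w (g \<cdot> k)"
      unfolding k(1) by (rule nat2[OF k(2) w annihilatingD(1)[OF g(1)]])
    then show ?thesis using annihilating_add[OF g(1) T1 k(2)] pairing_zero_right[OF w] by simp
  qed
  with g(2) show "g \<in> {g\<in>annihilating (S T) Y (S X). \<forall>f\<in>annihilating T X (S Y). \<phi> X Y f g = 0}" by simp
qed

lemma antisymmetric_form:
  assumes r: "represents N X \<theta>" and N': "N' \<in> fd_modules \<Lambda>"
    and "represents P0 T0 \<theta>0" "represents P1 T1 \<theta>1" "represents Q0 Y0 \<theta>2" "represents Q1 Y1 \<theta>3"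
  shows "euler_form \<Lambda> N N' - euler_form \<Lambda> N' N = int (mor_dim (mod_hom \<Lambda> P0 N')) - int (mor_dim (mod_hom \<Lambda> P1 N'))
    - int (mor_dim (mod_hom \<Lambda> Q0 N')) + int (mor_dim (mod_hom \<Lambda> Q1 N'))"
proof -
  obtain S1 S0 W' u' v' w' \<theta>' where S1: "in_add T S1" and S0: "in_add T S0" and D'': "Dist C S1 S0 (S (S W')) u' v' w'"
    and r': "represents N' (S (S W')) \<theta>'"
    by (rule presentation[OF N'])
  let ?Y = "S (S W')"
  have 1: "m.dim (annihilating (S T) ?Y (S X)) + m.dim (annihilating T X (S ?Y) \<inter> annihilating (S T) X (S ?Y)) =
     m.dim (annihilating T X (S ?Y)) + m.dim (annihilating T ?Y (S X) \<inter> annihilating (S T) ?Y (S X))"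
    unfolding left_radical[symmetric] right_radical[symmetric]
  proof (rule pairing_rank_eq[OF vector_space_mor vector_space_mor annihilating_fd annihilating_fd])
    show "linear_on (Scale C) (*) (annihilating (S T) ?Y (S X)) (\<phi> X ?Y f)" if "f \<in> annihilating T X (S ?Y)" for f
      by (rule linear_on_subset[OF pairing_linear_right[OF annihilatingD(1)[OF that]]]) (auto dest: annihilatingD)
    show "linear_on (Scale C) (*) (annihilating T X (S ?Y)) (\<lambda>f. \<phi> X ?Y f g)" for g
      by (rule linear_on_subset[OF pairing_linear_left]) (auto dest: annihilatingD)
  qed
  \<comment> \<open>By the equality of ranks, the dimensions of both \<open>K \<inter> K'\<close>
    and of \<open>K(X, \<Sigma>Y)\<close> cancel, leaving \<open>dim K'(Y, \<Sigma>X)\<close>;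
    \<open>coresolution_dim\<close> expresses this together with the remaining terms in
    \<open>\<C>(Y, X)\<close>.\<close>
  show ?thesis
    unfolding euler_form_annihilating(1)[OF T1 T0 D' r r'] euler_form_annihilating(2)[OF S1 S0 D'' r' r]
      hom_dim_add[OF T0 assms(3) r'] hom_dim_add[OF T1 assms(4) r'] hom_dim_add[OF Y0 assms(5) r'] hom_dim_add[OF Y1 assms(6) r']
    using 1 coresolution_dim[of ?Y] by linarith
qed

end

end

end

section \<open>The antisymmetric form as a combination of exact functors\<close>

context cluster_tilted
begin

text \<open>The order of the quantifiers is the point: the four projectives serve all
  \<open>N'\<close> at once, so exactness of each \<open>Hom(P, ?)\<close> yields additivity in
  \<open>N'\<close>. From here on the category is present only through this formula and the
  existence of resolutions.\<close>

theorem antisymmetric_form_projective: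
  assumes N: "N \<in> fd_modules \<Lambda>"
  obtains P0 P1 Q0 Q1 where "projective_mod \<Lambda> P0" "projective_mod \<Lambda> P1" "projective_mod \<Lambda> Q0" "projective_mod \<Lambda> Q1"
    "\<forall>N'\<in>fd_modules \<Lambda>. euler_form \<Lambda> N N' - euler_form \<Lambda> N' N =
       int (mor_dim (mod_hom \<Lambda> P0 N')) - int (mor_dim (mod_hom \<Lambda> P1 N'))
       - int (mor_dim (mod_hom \<Lambda> Q0 N')) + int (mor_dim (mod_hom \<Lambda> Q1 N'))"
proof -
  obtain \<phi> :: "'o \<Rightarrow> 'o \<Rightarrow> 'm \<Rightarrow> 'm \<Rightarrow> 'k" where
    1: "\<forall>X Y. bij_betw (\<phi> X Y) (Hom C X (Susp C Y)) (dual_space (Scale C) (Hom C Y (Susp C X))) \<and>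
            linear_on (Scale C) (fun_scale (*)) (Hom C X (Susp C Y)) (\<phi> X Y)" and
    2: "\<forall>X X' Y. \<forall>a\<in>Hom C X' X. \<forall>f\<in>Hom C X (Susp C Y). \<forall>g\<in>Hom C Y (Susp C X').
        \<phi> X' Y (f \<cdot> a) g = \<phi> X Y f (SuspM C a \<cdot> g)" and
    3: "\<forall>X Y Y'. \<forall>b\<in>Hom C Y Y'. \<forall>f\<in>Hom C X (Susp C Y). \<forall>g\<in>Hom C Y' (Susp C X).
        \<phi> X Y' (SuspM C b \<cdot> f) g = \<phi> X Y f (g \<cdot> b)"
    using calabi_yau[unfolded two_calabi_yau_def] by (elim exE conjE)
  interpret cy_pairing C T \<phi>
    by unfold_locales (use 1 2 3 in simp_all)
  obtain T1 T0 W u v w \<theta> where T1: "in_add T T1" and T0: "in_add T T0" and D: "Dist C T1 T0 (S (S W)) u v w"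
    and r: "represents N (S (S W)) \<theta>"
    by (rule presentation[OF N])
  obtain Y0 Y1 p q z where Y: "in_add T Y0" "in_add T Y1" "Dist C W Y0 Y1 p q z"
    by (rule coresolution)
  obtain P0 \<theta>0 where r0: "represents P0 T0 \<theta>0" by (rule represents_exists)
  obtain P1 \<theta>1 where r1: "represents P1 T1 \<theta>1" by (rule represents_exists)
  obtain Q0 \<theta>2 where r2: "represents Q0 Y0 \<theta>2" by (rule represents_exists)
  obtain Q1 \<theta>3 where r3: "represents Q1 Y1 \<theta>3" by (rule represents_exists)
  show ?thesis
    by (rule that[OF projective_if_in_add[OF T0 r0] projective_if_in_add[OF T1 r1]
      projective_if_in_add[OF Y(1) r2] projective_if_in_add[OF Y(2) r3]])
      (intro ballI antisymmetric_form[OF Y T1 T0 D r _ r0 r1 r2 r3])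
qed

end

section \<open>Bilinear forms on quotients of free abelian groups\<close>

text \<open>The homomorphism from the free abelian group that takes the value \<open>p i\<close> on
  the generator \<open>i\<close>.\<close>

definition frag_eval :: "('i \<Rightarrow> int) \<Rightarrow> ('i \<Rightarrow>\<^sub>0 int) \<Rightarrow> int" where
  "frag_eval p x = (\<Sum>i\<in>Poly_Mapping.keys x. Poly_Mapping.lookup x i * p i)"

lemma frag_eval_superset:
  assumes "finite K" "Poly_Mapping.keys x \<subseteq> K"
  shows "frag_eval p x = (\<Sum>i\<in>K. Poly_Mapping.lookup x i * p i)"
  unfolding frag_eval_def
  by (rule sum.mono_neutral_left[OF assms]) (simp add: in_keys_iff)

lemma frag_eval_add: "frag_eval p (x + y) = frag_eval p x + frag_eval p y"
proof -
  let ?K = "Poly_Mapping.keys x \<union> Poly_Mapping.keys y"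
  have "frag_eval p z = (\<Sum>i\<in>?K. Poly_Mapping.lookup z i * p i)" if "Poly_Mapping.keys z \<subseteq> ?K" for z
    by (rule frag_eval_superset[OF _ that]) simp
  from this[of x] this[of y] this[of "x + y"] show ?thesis
    using Poly_Mapping.keys_add[of x y] by (simp add: lookup_add algebra_simps sum.distrib)
qed

lemma frag_eval_diff: "frag_eval p (x - y) = frag_eval p x - frag_eval p y"
  using frag_eval_add[of p "x - y" y] by simp

lemma frag_eval_of: "frag_eval p (frag_of i) = p i"
  by (simp add: frag_eval_def)

lemma frag_eval_add_left: "frag_eval (\<lambda>i. p i + q i) x = frag_eval p x + frag_eval q x"
  by (simp add: frag_eval_def algebra_simps sum.distrib)

lemma frag_eval_cong: "(\<And>i. i \<in> Poly_Mapping.keys x \<Longrightarrow> p i = q i) \<Longrightarrow> frag_eval p x = frag_eval q x"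
  by (simp add: frag_eval_def)

lemma free_Abelian_quotient_normal:
  assumes "R \<subseteq> carrier (free_Abelian_group I)"
  shows "generate (free_Abelian_group I) R \<lhd> free_Abelian_group I"
  by (rule comm_group.subgroup_imp_normal[OF abelian_free_Abelian_group group.generate_is_subgroup[OF group_free_Abelian_group assms]])

text \<open>This makes the definite description in \<open>split_form\<close> single-valued. The
  induction on free generators proceeds by differences, in one variable at a time.\<close>

lemma bilinear_form_unique:
  fixes I :: "'i set" and b b' :: "('i \<Rightarrow>\<^sub>0 int) set \<Rightarrow> ('i \<Rightarrow>\<^sub>0 int) set \<Rightarrow> int"
  defines "G \<equiv> free_Abelian_group I"
  assumes H: "H \<lhd> G" and b: "bilinear_form (G Mod H) b" and b': "bilinear_form (G Mod H) b'"
    and eq: "\<And>i j. i \<in> I \<Longrightarrow> j \<in> I \<Longrightarrow> b (H #>\<^bsub>G\<^esub> frag_of i) (H #>\<^bsub>G\<^esub> frag_of j) = b' (H #>\<^bsub>G\<^esub> frag_of i) (H #>\<^bsub>G\<^esub> frag_of j)"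
    and x: "x \<in> carrier (G Mod H)" and y: "y \<in> carrier (G Mod H)"
  shows "b x y = b' x y"
proof -
  interpret normal H G by (rule H)
  let ?c = "\<lambda>a. H #>\<^bsub>G\<^esub> a"
  have c: "?c a \<in> carrier (G Mod H)" if "a \<in> carrier G" for a using that by (simp add: carrier_FactGroup)
  have sum: "?c (a + d) = ?c a \<otimes>\<^bsub>G Mod H\<^esub> ?c d" if "a \<in> carrier G" "d \<in> carrier G" for a d
    using rcos_sum[OF that] by (simp add: G_def)
  have add: "\<beta> (?c (a + d)) z = \<beta> (?c a) z + \<beta> (?c d) z" "\<beta> z (?c (a + d)) = \<beta> z (?c a) + \<beta> z (?c d)"
    if "bilinear_form (G Mod H) \<beta>" "a \<in> carrier G" "d \<in> carrier G" "z \<in> carrier (G Mod H)" for \<beta> a d z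
    using that(1) c[OF that(2)] c[OF that(3)] that(4) unfolding sum[OF that(2,3)] bilinear_form_def by blast+
  have G0: "0 \<in> carrier G" by (simp add: G_def)
  have Gd: "a - d \<in> carrier G" if "a \<in> carrier G" "d \<in> carrier G" for a d
    using that Poly_Mapping.keys_diff[of a d] by (auto simp: G_def)
  have bzero: "\<beta> (?c 0) z = 0" "\<beta> z (?c 0) = 0" if "bilinear_form (G Mod H) \<beta>" "z \<in> carrier (G Mod H)" for \<beta> z
    using add[OF that(1) G0 G0 that(2)] by simp_all
  have bdiff: "\<beta> (?c (a - d)) z = \<beta> (?c a) z - \<beta> (?c d) z" "\<beta> z (?c (a - d)) = \<beta> z (?c a) - \<beta> z (?c d)"
    if "bilinear_form (G Mod H) \<beta>" "a \<in> carrier G" "d \<in> carrier G" "z \<in> carrier (G Mod H)" for \<beta> a d z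
    using add[OF that(1) Gd[OF that(2,3)] that(3,4)] by simp_all
  have fI: "frag_of i \<in> carrier G" if "i \<in> I" for i using that by (simp add: G_def)
  have 1: "a \<in> carrier G \<and> b (?c a) (?c (frag_of j)) = b' (?c a) (?c (frag_of j))" if j: "j \<in> I" and a: "Poly_Mapping.keys a \<subseteq> I" for a j
    using a
  proof (induction rule: frag_induction)
    case zero
    then show ?case using G0 bzero(1)[OF b c[OF fI[OF j]]] bzero(1)[OF b' c[OF fI[OF j]]] by simp
  next
    case (one i)
    then show ?case using eq j fI by simp
  next
    case (diff a d)
    then show ?case
      using Gd bdiff(1)[OF b _ _ c[OF fI[OF j]]] bdiff(1)[OF b' _ _ c[OF fI[OF j]]] by simp
  qed
  have 2: "d \<in> carrier G \<and> b (?c a) (?c d) = b' (?c a) (?c d)" if a: "a \<in> carrier G" and d: "Poly_Mapping.keys d \<subseteq> I" for a d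
    using d
  proof (induction rule: frag_induction)
    case zero
    then show ?case using G0 bzero(2)[OF b c[OF a]] bzero(2)[OF b' c[OF a]] by simp
  next
    case (one i)
    then show ?case using 1[OF one] a fI by (simp add: G_def)
  next
    case (diff d e)
    then show ?case
      using Gd bdiff(2)[OF b _ _ c[OF a]] bdiff(2)[OF b' _ _ c[OF a]] by simp
  qed
  obtain a where "a \<in> carrier G" "x = ?c a" using x by (auto simp: carrier_FactGroup)
  moreover obtain d where "d \<in> carrier G" "y = ?c d" using y by (auto simp: carrier_FactGroup)
  ultimately show ?thesis using 2[of a d] by (simp add: G_def)
qed

text \<open>A triple \<open>(m, a, b)\<close> in \<open>Rel\<close> stands for the relation
  \<open>m = a + b\<close>. The bilinear extension of \<open>f\<close> vanishes whenever one
  argument is a relator, hence whenever one argument is in \<open>H\<close>.\<close>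

lemma bilinear_form_quotient:
  fixes I :: "'i set" and f :: "'i \<Rightarrow> 'i \<Rightarrow> int" and Rel :: "('i \<times> 'i \<times> 'i) set"
  defines "G \<equiv> free_Abelian_group I"
  defines "H \<equiv> generate G ((\<lambda>(m, a, b). frag_of m - frag_of a - frag_of b) ` Rel)"
  assumes Rel: "Rel \<subseteq> I \<times> I \<times> I"
    and f: "\<And>m a b j. (m, a, b) \<in> Rel \<Longrightarrow> j \<in> I \<Longrightarrow> f m j = f a j + f b j \<and> f j m = f j a + f j b"
  obtains \<omega> where "bilinear_form (G Mod H) \<omega>"
    "\<forall>i\<in>I. \<forall>j\<in>I. \<omega> (H #>\<^bsub>G\<^esub> frag_of i) (H #>\<^bsub>G\<^esub> frag_of j) = f i j"
proof -
  let ?R = "(\<lambda>(m, a, b). frag_of m - frag_of a - frag_of b) ` Rel"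
  have fI: "frag_of i \<in> carrier G" if "i \<in> I" for i using that by (simp add: G_def)
  have Gd: "a - d \<in> carrier G" if "a \<in> carrier G" "d \<in> carrier G" for a d
    using that Poly_Mapping.keys_diff[of a d] by (auto simp: G_def)
  have R: "?R \<subseteq> carrier G"
    using Rel by (auto intro!: Gd fI)
  have HG: "H \<lhd> G" unfolding H_def G_def by (rule free_Abelian_quotient_normal[OF R[unfolded G_def]])
  then interpret normal H G .
  let ?c = "\<lambda>a. H #>\<^bsub>G\<^esub> a"
  define \<beta> where "\<beta> x y = frag_eval (\<lambda>i. frag_eval (f i) y) x" for x y
  have add: "\<beta> (x + x') y = \<beta> x y + \<beta> x' y" "\<beta> x (y + y') = \<beta> x y + \<beta> x y'" for x x' y y'
    by (simp_all add: \<beta>_def frag_eval_add frag_eval_add_left)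
  have neg: "\<beta> (- x) y = - \<beta> x y" "\<beta> x (- y) = - \<beta> x y" for x y
    using add(1)[of x "- x" y] add(2)[of x y "- y"] add(1)[of 0 0 y] add(2)[of x 0 0] by simp_all
  have keys: "Poly_Mapping.keys y \<subseteq> I" if "y \<in> carrier G" for y using that by (simp add: G_def)
  have RR: "\<beta> r y = 0 \<and> \<beta> y r = 0" if "r \<in> ?R" "y \<in> carrier G" for r y
  proof -
    obtain m a b where r: "(m, a, b) \<in> Rel" "r = frag_of m - frag_of a - frag_of b" using \<open>r \<in> ?R\<close> by auto
    have "frag_eval (f m) y = frag_eval (\<lambda>j. f a j + f b j) y"
      by (rule frag_eval_cong) (use f[OF r(1)] keys[OF that(2)] in auto)
    then have "\<beta> r y = 0" by (simp add: \<beta>_def r(2) frag_eval_diff frag_eval_of frag_eval_add_left)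
    moreover have "frag_eval (\<lambda>i. frag_eval (f i) r) y = frag_eval (\<lambda>_. 0) y"
      by (rule frag_eval_cong) (use f[OF r(1)] keys[OF that(2)] in \<open>auto simp: r(2) frag_eval_diff frag_eval_of\<close>)
    then have "\<beta> y r = 0" by (simp add: \<beta>_def frag_eval_def)
    ultimately show ?thesis by simp
  qed
  have HH: "\<beta> h y = 0 \<and> \<beta> y h = 0" if "h \<in> H" "y \<in> carrier G" for h y
    using that(1) unfolding H_def
  proof (induction rule: generate.induct)
    case one
    show ?case using add(1)[of 0 0 y] add(2)[of y 0 0] by (simp add: G_def)
  next
    case (incl h)
    then show ?case using RR that(2) by blast
  next
    case (inv h)
    then have "h \<in> carrier G" using R by blast
    then have "inv\<^bsub>G\<^esub> h = - h" by (simp add: G_def)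
    then show ?case using RR[OF inv that(2)] neg by simp
  next
    case (eng h h')
    then show ?case using add by (simp add: G_def)
  qed
  \<comment> \<open>The form is evaluated at arbitrary representatives; others differ from them by
    elements of \<open>H\<close>, which do not contribute.\<close>
  define \<omega> where "\<omega> A B = \<beta> (SOME a. a \<in> A) (SOME b. b \<in> B)" for A B
  have some: "\<exists>h\<in>H. (SOME a. a \<in> ?c x) = h + x" if "x \<in> carrier G" for x
  proof -
    have "(SOME a. a \<in> ?c x) \<in> ?c x" using rcos_self[OF that subgroup_axioms] by (rule someI)
    then show ?thesis unfolding r_coset_def by (auto simp: G_def)
  qed
  have \<omega>: "\<omega> (?c x) (?c y) = \<beta> x y" if x: "x \<in> carrier G" and y: "y \<in> carrier G" for x y
  proof -
    obtain h where h: "h \<in> H" "(SOME a. a \<in> ?c x) = h + x" using some[OF x] by blast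
    obtain k where k: "k \<in> H" "(SOME a. a \<in> ?c y) = k + y" using some[OF y] by blast
    show ?thesis unfolding \<omega>_def h(2) k(2) using HH[OF h(1)] HH[OF k(1)] h(1) k(1) x y subset add by auto
  qed
  have "bilinear_form (G Mod H) \<omega>"
    unfolding bilinear_form_def
  proof (intro ballI)
    fix x y z assume "x \<in> carrier (G Mod H)" "y \<in> carrier (G Mod H)" "z \<in> carrier (G Mod H)"
    then obtain a b d where a: "a \<in> carrier G" "x = ?c a" and b: "b \<in> carrier G" "y = ?c b" and d: "d \<in> carrier G" "z = ?c d"
      by (auto simp: carrier_FactGroup)
    have "x \<otimes>\<^bsub>G Mod H\<^esub> y = ?c (a + b)" "y \<otimes>\<^bsub>G Mod H\<^esub> z = ?c (b + d)"
      using rcos_sum[OF a(1) b(1)] rcos_sum[OF b(1) d(1)] a b d by (simp_all add: G_def)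
    moreover have "a + b \<in> carrier G" "b + d \<in> carrier G"
      using m_closed[OF a(1) b(1)] m_closed[OF b(1) d(1)] by (simp_all add: G_def)
    ultimately show "\<omega> (x \<otimes>\<^bsub>G Mod H\<^esub> y) z = \<omega> x z + \<omega> y z \<and> \<omega> x (y \<otimes>\<^bsub>G Mod H\<^esub> z) = \<omega> x y + \<omega> x z"
      using \<omega> a b d add by simp
  qed
  moreover have "\<forall>i\<in>I. \<forall>j\<in>I. \<omega> (?c (frag_of i)) (?c (frag_of j)) = f i j"
    by (simp add: \<omega> fI) (simp add: \<beta>_def frag_eval_of)
  ultimately show ?thesis by (rule that)
qed

section \<open>The form on the Grothendieck group\<close>

text \<open>An isomorphism is the left map of a short exact sequence whose third term is zero, so
  this is a case of \<open>vanishing_hom_dim_additive\<close>.\<close>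

lemma vanishing_hom_iso:
  assumes P: "P \<in> fd_modules A" and M: "M \<in> fd_modules A" and N: "N \<in> fd_modules A" and iso: "mod_iso A M N"
  shows "mor_dim (vanishing_hom A P S M) = mor_dim (vanishing_hom A P S N)"
proof -
  obtain f where f: "f \<in> mod_hom A M N" "bij_betw f (vecs M) (vecs N)"
    using iso unfolding mod_iso_def by blast
  define Z :: "('a, 'b) rmod" where "Z = \<lparr>vecs = {0}, act = (\<lambda>_ _. 0)\<rparr>"
  have Z: "Z \<in> fd_modules A"
    using vs.fd_zero by (simp add: Z_def fd_modules_def linear_on_def vs.scale_zero_right)
  have g: "(\<lambda>_. 0) \<in> mod_hom A N Z"
    by (simp add: mod_hom_def Z_def linear_on_def vs.scale_zero_right image_subset_iff)
  have hZ: "vanishing_hom A P S Z = {0}"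
  proof -
    have "h = 0" if "h \<in> mod_hom A P Z" for h
    proof
      fix x
      show "h x = 0 x" using mod_hom_range[OF Z that, of x] by (simp add: Z_def zero_fun_apply)
    qed
    moreover have "0 \<in> vanishing_hom A P S Z"
      using ms.subspace_0[OF mod_hom_subspace[OF P Z]] by (simp add: vanishing_hom_def)
    ultimately show ?thesis unfolding vanishing_hom_def by blast
  qed
  have "mor_dim (vanishing_hom A P S N) = mor_dim (vanishing_hom A P S M) + mor_dim (vanishing_hom A P S Z)"
  proof (rule vanishing_hom_dim_additive[OF P M N Z f(1) g])
    show "inj_on f (vecs M)" "f ` vecs M = {x\<in>vecs N. 0 = 0}" using f(2) by (auto simp: bij_betw_def)
    fix h assume "h \<in> vanishing_hom A P S Z"
    then have "h = 0" by (simp add: hZ)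
    moreover have "0 \<in> vanishing_hom A P S N"
      using ms.subspace_0[OF mod_hom_subspace[OF P N]] by (simp add: vanishing_hom_def)
    ultimately show "\<exists>h'\<in>vanishing_hom A P S N. (\<lambda>_. 0) \<circ> h' = h"
      by (intro bexI[of _ 0]) (simp_all add: fun_eq_iff)
  qed
  then show ?thesis by (simp add: hZ ms.dim_zero)
qed

lemma mod_iso_if_iso_class_eq:
  assumes N: "N \<in> fd_modules A" and e: "iso_class A N = iso_class A N'"
  shows "mod_iso A N N'"
proof -
  have "mod_iso A N N"
    unfolding mod_iso_def
    by (rule bexI[OF _ mod_hom_id[OF N]]) (auto simp: bij_betw_def inj_on_def image_iff)
  then have "N \<in> iso_class A N'" using N unfolding e[symmetric] by (simp add: iso_class_def)
  then show ?thesis by (simp add: iso_class_def)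
qed

lemma relations_carrier:
  "{frag_of (iso_class A M) - frag_of (iso_class A L) - frag_of (iso_class A N) | L M N.
    L \<in> fd_modules A \<and> M \<in> fd_modules A \<and> N \<in> fd_modules A \<and> E L M N} \<subseteq> carrier (free_on_modules A)"
proof
  fix x assume "x \<in> {frag_of (iso_class A M) - frag_of (iso_class A L) - frag_of (iso_class A N) | L M N.
    L \<in> fd_modules A \<and> M \<in> fd_modules A \<and> N \<in> fd_modules A \<and> E L M N}"
  then obtain L M N where x: "x = frag_of (iso_class A M) - frag_of (iso_class A L) - frag_of (iso_class A N)"
    and f: "L \<in> fd_modules A" "M \<in> fd_modules A" "N \<in> fd_modules A" by blast
  have "Poly_Mapping.keys x \<subseteq> {iso_class A M, iso_class A L, iso_class A N}"
    unfolding x using Poly_Mapping.keys_diff[of "frag_of (iso_class A M) - frag_of (iso_class A L)" "frag_of (iso_class A N)"]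
      Poly_Mapping.keys_diff[of "frag_of (iso_class A M)" "frag_of (iso_class A L)"] by auto
  then show "x \<in> carrier (free_on_modules A)" using f by (auto simp: free_on_modules_def)
qed

text \<open>The predicate \<open>E\<close> will be a direct sum decomposition or a short exact
  sequence, so that one construction gives the forms on \<open>K0_split\<close> and on
  \<open>K0\<close>. Values on isoclasses are read off at chosen modules, and the invariance of
  \<open>F\<close> removes the choice.\<close>

lemma bilinear_form_on_modules:
  fixes A :: "('k::field, 'a::ab_group_add) alg" and F :: "('k, 'a) rmod \<Rightarrow> ('k, 'a) rmod \<Rightarrow> int"
    and E :: "('k, 'a) rmod \<Rightarrow> ('k, 'a) rmod \<Rightarrow> ('k, 'a) rmod \<Rightarrow> bool"
  defines "G \<equiv> free_on_modules A"
  defines "H \<equiv> generate G {frag_of (iso_class A M) - frag_of (iso_class A L) - frag_of (iso_class A N) | L M N.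
        L \<in> fd_modules A \<and> M \<in> fd_modules A \<and> N \<in> fd_modules A \<and> E L M N}"
  assumes iso: "\<And>M N K. M \<in> fd_modules A \<Longrightarrow> N \<in> fd_modules A \<Longrightarrow> K \<in> fd_modules A \<Longrightarrow> mod_iso A M N \<Longrightarrow>
      F M K = F N K \<and> F K M = F K N"
    and add: "\<And>L M N K. L \<in> fd_modules A \<Longrightarrow> M \<in> fd_modules A \<Longrightarrow> N \<in> fd_modules A \<Longrightarrow> K \<in> fd_modules A \<Longrightarrow> E L M N \<Longrightarrow>
      F M K = F L K + F N K \<and> F K M = F K L + F K N"
  obtains \<omega> where "bilinear_form (G Mod H) \<omega>"
    "\<forall>N\<in>fd_modules A. \<forall>N'\<in>fd_modules A.
      \<omega> (H #>\<^bsub>G\<^esub> frag_of (iso_class A N)) (H #>\<^bsub>G\<^esub> frag_of (iso_class A N')) = F N N'"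
proof -
  let ?I = "iso_class A ` fd_modules A"
  define rep where "rep c = (SOME N. N \<in> fd_modules A \<and> iso_class A N = c)" for c
  have rep: "rep (iso_class A N) \<in> fd_modules A" "iso_class A (rep (iso_class A N)) = iso_class A N"
    if "N \<in> fd_modules A" for N
    using someI[of "\<lambda>M. M \<in> fd_modules A \<and> iso_class A M = iso_class A N" N] that unfolding rep_def by blast+
  define f where "f i j = F (rep i) (rep j)" for i j
  have f: "f (iso_class A N) (iso_class A N') = F N N'" if N: "N \<in> fd_modules A" and N': "N' \<in> fd_modules A" for N N'
    using iso[OF rep(1)[OF N] N rep(1)[OF N'] mod_iso_if_iso_class_eq[OF rep[OF N]]]
      iso[OF rep(1)[OF N'] N' N mod_iso_if_iso_class_eq[OF rep[OF N']]] by (simp add: f_def)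
  define Rel where "Rel = {(iso_class A M, iso_class A L, iso_class A N) | L M N.
        L \<in> fd_modules A \<and> M \<in> fd_modules A \<and> N \<in> fd_modules A \<and> E L M N}"
  have R: "Rel \<subseteq> ?I \<times> ?I \<times> ?I" by (auto simp: Rel_def)
  have fR: "f m j = f a j + f b j \<and> f j m = f j a + f j b" if r: "(m, a, b) \<in> Rel" and j: "j \<in> ?I" for m a b j
  proof -
    obtain L M N where 1: "m = iso_class A M" "a = iso_class A L" "b = iso_class A N"
      "L \<in> fd_modules A" "M \<in> fd_modules A" "N \<in> fd_modules A" "E L M N"
      using r unfolding Rel_def by blast
    obtain K where K: "j = iso_class A K" "K \<in> fd_modules A" using j by blast
    show ?thesis using add[OF 1(4-6) K(2) 1(7)] f 1 K by simp
  qed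
  have "(\<lambda>(m, a, b). frag_of m - frag_of a - frag_of b) ` Rel =
     {frag_of (iso_class A M) - frag_of (iso_class A L) - frag_of (iso_class A N) | L M N.
        L \<in> fd_modules A \<and> M \<in> fd_modules A \<and> N \<in> fd_modules A \<and> E L M N}"
    unfolding Rel_def by (auto simp: image_iff) metis
  then have H: "H = generate (free_Abelian_group ?I) ((\<lambda>(m, a, b). frag_of m - frag_of a - frag_of b) ` Rel)"
    by (simp add: H_def G_def free_on_modules_def)
  obtain \<omega> where b: "bilinear_form (free_Abelian_group ?I Mod H) \<omega>" and
    v: "\<forall>i\<in>?I. \<forall>j\<in>?I. \<omega> (H #>\<^bsub>free_Abelian_group ?I\<^esub> frag_of i) (H #>\<^bsub>free_Abelian_group ?I\<^esub> frag_of j) = f i j"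
    unfolding H by (rule bilinear_form_quotient[OF R fR])
  show ?thesis
  proof (rule that)
    show "bilinear_form (G Mod H) \<omega>" using b by (simp add: G_def free_on_modules_def)
    show "\<forall>N\<in>fd_modules A. \<forall>N'\<in>fd_modules A.
      \<omega> (H #>\<^bsub>G\<^esub> frag_of (iso_class A N)) (H #>\<^bsub>G\<^esub> frag_of (iso_class A N')) = F N N'"
      using v f by (simp add: G_def free_on_modules_def)
  qed
qed

section \<open>Descent from the split to the usual Grothendieck group\<close>

context cluster_tilted
begin

lemma resolution_exists:
  assumes N: "N \<in> fd_modules \<Lambda>"
  obtains P0 P1 P2 e d1 d2 where "proj_resolution \<Lambda> N P0 P1 P2 e d1 d2"
proof -
  obtain T1 T0 W u v w \<theta> where "in_add T T1" "in_add T T0" "Dist C T1 T0 (S (S W)) u v w"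
    "represents N (S (S W)) \<theta>"
    by (rule presentation[OF N])
  then show ?thesis by (rule resolution) (rule that)
qed

abbreviation fdm where "fdm \<equiv> fd_modules \<Lambda>"
abbreviation form_a where "form_a N N' \<equiv> euler_form \<Lambda> N N' - euler_form \<Lambda> N' N"

lemma euler_form_direct_sum_right:
  assumes N: "N \<in> fdm" and "N1 \<in> fdm" "N2 \<in> fdm" "M \<in> fdm" "mod_direct_sum \<Lambda> N1 N2 M"
  shows "euler_form \<Lambda> N M = euler_form \<Lambda> N N1 + euler_form \<Lambda> N N2"
proof -
  obtain P0 P1 P2 e d1 d2 where P: "proj_resolution \<Lambda> N P0 P1 P2 e d1 d2" by (rule resolution_exists[OF N])
  then have f: "P0 \<in> fdm" "P1 \<in> fdm" by (simp_all add: proj_resolution_def projective_in)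
  show ?thesis
    unfolding euler_form_resolution[OF N assms(2) P] euler_form_resolution[OF N assms(3) P] euler_form_resolution[OF N assms(4) P]
    using vanishing_hom_direct_sum[OF f(1) assms(2-5), of "{}"] vanishing_hom_direct_sum[OF f(2) assms(2-5), of "d2 ` vecs P2"]
    by (simp add: vanishing_hom_empty)
qed

lemma euler_form_iso_right:
  assumes N: "N \<in> fdm" and "M \<in> fdm" "M' \<in> fdm" "mod_iso \<Lambda> M M'"
  shows "euler_form \<Lambda> N M = euler_form \<Lambda> N M'"
proof -
  obtain P0 P1 P2 e d1 d2 where P: "proj_resolution \<Lambda> N P0 P1 P2 e d1 d2" by (rule resolution_exists[OF N])
  then have f: "P0 \<in> fdm" "P1 \<in> fdm" by (simp_all add: proj_resolution_def projective_in)
  show ?thesis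
    unfolding euler_form_resolution[OF N assms(2) P] euler_form_resolution[OF N assms(3) P]
    using vanishing_hom_iso[OF f(1) assms(2-4), of "{}"] vanishing_hom_iso[OF f(2) assms(2-4), of "d2 ` vecs P2"]
    by (simp add: vanishing_hom_empty)
qed

lemma form_a_exact_right:
  assumes N: "N \<in> fdm" and f: "L \<in> fdm" "M \<in> fdm" "K \<in> fdm" and s: "short_exact \<Lambda> L M K"
  shows "form_a N M = form_a N L + form_a N K"
proof -
  obtain P0 P1 Q0 Q1 where P: "projective_mod \<Lambda> P0" "projective_mod \<Lambda> P1" "projective_mod \<Lambda> Q0" "projective_mod \<Lambda> Q1"
    "\<forall>N'\<in>fdm. form_a N N' = int (mor_dim (mod_hom \<Lambda> P0 N')) - int (mor_dim (mod_hom \<Lambda> P1 N'))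
       - int (mor_dim (mod_hom \<Lambda> Q0 N')) + int (mor_dim (mod_hom \<Lambda> Q1 N'))"
    by (rule antisymmetric_form_projective[OF N])
  show ?thesis
    unfolding P(5)[rule_format, OF f(1)] P(5)[rule_format, OF f(2)] P(5)[rule_format, OF f(3)]
      hom_dim_short_exact[OF P(1) f s] hom_dim_short_exact[OF P(2) f s] hom_dim_short_exact[OF P(3) f s]
      hom_dim_short_exact[OF P(4) f s] by simp
qed

lemma form_a_iso_right:
  assumes N: "N \<in> fdm" and f: "M \<in> fdm" "M' \<in> fdm" and s: "mod_iso \<Lambda> M M'"
  shows "form_a N M = form_a N M'"
proof -
  obtain P0 P1 Q0 Q1 where P: "projective_mod \<Lambda> P0" "projective_mod \<Lambda> P1" "projective_mod \<Lambda> Q0" "projective_mod \<Lambda> Q1"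
    "\<forall>N'\<in>fdm. form_a N N' = int (mor_dim (mod_hom \<Lambda> P0 N')) - int (mor_dim (mod_hom \<Lambda> P1 N'))
       - int (mor_dim (mod_hom \<Lambda> Q0 N')) + int (mor_dim (mod_hom \<Lambda> Q1 N'))"
    by (rule antisymmetric_form_projective[OF N])
  have i: "mor_dim (mod_hom \<Lambda> P M) = mor_dim (mod_hom \<Lambda> P M')" if "projective_mod \<Lambda> P" for P
    using vanishing_hom_iso[OF projective_in[OF that] f s, of "{}"] by (simp add: vanishing_hom_empty)
  show ?thesis
    unfolding P(5)[rule_format, OF f(1)] P(5)[rule_format, OF f(2)] i[OF P(1)] i[OF P(2)] i[OF P(3)] i[OF P(4)] by simp
qed

theorem antisymmetric_form_descends:
  "\<exists>\<omega>. bilinear_form (K0 \<Lambda>) \<omega> \<and>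
    (\<forall>x\<in>carrier (K0_split \<Lambda>). \<forall>y\<in>carrier (K0_split \<Lambda>).
       \<omega> (split_to_K0 \<Lambda> x) (split_to_K0 \<Lambda> y) = split_form_a \<Lambda> x y) \<and>
    (\<forall>N\<in>fd_modules \<Lambda>. \<forall>N'\<in>fd_modules \<Lambda>. \<omega> (class_K0 \<Lambda> N) (class_K0 \<Lambda> N') = form_a N N')"
proof -
  let ?G = "free_on_modules \<Lambda>" and ?Hs = "split_relations \<Lambda>" and ?He = "exact_relations \<Lambda>"
  define Rs where "Rs = {frag_of (iso_class \<Lambda> M) - frag_of (iso_class \<Lambda> L) - frag_of (iso_class \<Lambda> N) | L M N.
        L \<in> fdm \<and> M \<in> fdm \<and> N \<in> fdm \<and> mod_direct_sum \<Lambda> L N M}"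
  define Re where "Re = {frag_of (iso_class \<Lambda> M) - frag_of (iso_class \<Lambda> L) - frag_of (iso_class \<Lambda> N) | L M N.
        L \<in> fdm \<and> M \<in> fdm \<and> N \<in> fdm \<and> short_exact \<Lambda> L M N}"
  have Rs_eq: "{frag_of (iso_class \<Lambda> M) - frag_of (iso_class \<Lambda> N1) - frag_of (iso_class \<Lambda> N2) | M N1 N2.
        M \<in> fdm \<and> N1 \<in> fdm \<and> N2 \<in> fdm \<and> mod_direct_sum \<Lambda> N1 N2 M} = Rs"
    unfolding Rs_def by blast
  have Hs: "?Hs = generate ?G Rs" unfolding split_relations_def Rs_eq ..
  have He: "?He = generate ?G Re" unfolding exact_relations_def Re_def ..
  have Rc: "Rs \<subseteq> carrier ?G" "Re \<subseteq> carrier ?G" unfolding Rs_def Re_def by (rule relations_carrier)+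
  have nHs: "?Hs \<lhd> ?G" and nHe: "?He \<lhd> ?G"
    unfolding Hs He unfolding free_on_modules_def
    by (rule free_Abelian_quotient_normal, use Rc in \<open>simp add: free_on_modules_def\<close>)+
  have "Rs \<subseteq> Re"
  proof
    fix x assume "x \<in> Rs"
    then obtain L M N where "x = frag_of (iso_class \<Lambda> M) - frag_of (iso_class \<Lambda> L) - frag_of (iso_class \<Lambda> N)"
      "L \<in> fdm" "M \<in> fdm" "N \<in> fdm" "mod_direct_sum \<Lambda> L N M" unfolding Rs_def by blast
    then show "x \<in> Re" unfolding Re_def using short_exact_if_direct_sum[of N \<Lambda> L M] by blast
  qed
  then have sub: "?Hs \<subseteq> ?He"
    unfolding Hs He by (intro group.mono_generate) (simp add: free_on_modules_def)
  note e_iso = euler_form_iso_right and a_iso = form_a_iso_right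
  have e_iso_left: "euler_form \<Lambda> M K = euler_form \<Lambda> N K"
    if "M \<in> fdm" "N \<in> fdm" "K \<in> fdm" "mod_iso \<Lambda> M N" for M N K
    using e_iso[OF that(3,1,2,4)] a_iso[OF that(3,1,2,4)] by simp
  \<comment> \<open>The left argument is moved to the right: additivity of the antisymmetric form
    applies because a split sequence is short exact, and the Euler form itself is additive on direct
    sums on the right.\<close>
  have e_add_left: "euler_form \<Lambda> M K = euler_form \<Lambda> L K + euler_form \<Lambda> N K"
    if "L \<in> fdm" "M \<in> fdm" "N \<in> fdm" "K \<in> fdm" "mod_direct_sum \<Lambda> L N M" for L M N K
    using euler_form_direct_sum_right[OF that(4,1,3,2,5)]
      form_a_exact_right[OF that(4,1,2,3) short_exact_if_direct_sum[OF that(3,5)]] by simp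
  obtain b where b: "bilinear_form (?G Mod ?Hs) b" and
    b_class: "\<forall>N\<in>fdm. \<forall>N'\<in>fdm. b (class_split \<Lambda> N) (class_split \<Lambda> N') = euler_form \<Lambda> N N'"
  proof (rule bilinear_form_on_modules[where A = \<Lambda> and F = "euler_form \<Lambda>" and E = "\<lambda>L M N. mod_direct_sum \<Lambda> L N M"])
    show "euler_form \<Lambda> M K = euler_form \<Lambda> N K \<and> euler_form \<Lambda> K M = euler_form \<Lambda> K N"
      if "M \<in> fdm" "N \<in> fdm" "K \<in> fdm" "mod_iso \<Lambda> M N" for M N K
      using e_iso_left[OF that] e_iso[OF that(3,1,2,4)] by simp
    show "euler_form \<Lambda> M K = euler_form \<Lambda> L K + euler_form \<Lambda> N K \<and> euler_form \<Lambda> K M = euler_form \<Lambda> K L + euler_form \<Lambda> K N"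
      if "L \<in> fdm" "M \<in> fdm" "N \<in> fdm" "K \<in> fdm" "mod_direct_sum \<Lambda> L N M" for L M N K
      using e_add_left[OF that] euler_form_direct_sum_right[OF that(4,1,3,2,5)] by simp
  qed (unfold Rs_def[symmetric] Hs[symmetric] class_split_def[symmetric], rule that)
  obtain \<omega> where w: "bilinear_form (?G Mod ?He) \<omega>" and
    w_class: "\<forall>N\<in>fdm. \<forall>N'\<in>fdm. \<omega> (class_K0 \<Lambda> N) (class_K0 \<Lambda> N') = form_a N N'"
  proof (rule bilinear_form_on_modules[where A = \<Lambda> and F = form_a and E = "short_exact \<Lambda>"])
    show "form_a M K = form_a N K \<and> form_a K M = form_a K N"
      if "M \<in> fdm" "N \<in> fdm" "K \<in> fdm" "mod_iso \<Lambda> M N" for M N K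
      using a_iso[OF that(3,1,2,4)] by simp
    show "form_a M K = form_a L K + form_a N K \<and> form_a K M = form_a K L + form_a K N"
      if "L \<in> fdm" "M \<in> fdm" "N \<in> fdm" "K \<in> fdm" "short_exact \<Lambda> L M N" for L M N K
      using form_a_exact_right[OF that(4,1,2,3,5)] by simp
  qed (unfold Re_def[symmetric] He[symmetric] class_K0_def[symmetric], rule that)
  have uniq: "b1 x y = b2 x y"
    if "bilinear_form (K0_split \<Lambda>) b1" "bilinear_form (K0_split \<Lambda>) b2"
      "\<And>N N'. N \<in> fdm \<Longrightarrow> N' \<in> fdm \<Longrightarrow> b1 (class_split \<Lambda> N) (class_split \<Lambda> N') = b2 (class_split \<Lambda> N) (class_split \<Lambda> N')"
      "x \<in> carrier (K0_split \<Lambda>)" "y \<in> carrier (K0_split \<Lambda>)" for b1 b2 x y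
  proof (rule bilinear_form_unique[OF nHs[unfolded free_on_modules_def]
        that(1)[unfolded K0_split_def free_on_modules_def] that(2)[unfolded K0_split_def free_on_modules_def] _
        that(4)[unfolded K0_split_def free_on_modules_def] that(5)[unfolded K0_split_def free_on_modules_def]])
    fix i j assume i: "i \<in> iso_class \<Lambda> ` fdm" and j: "j \<in> iso_class \<Lambda> ` fdm"
    obtain N where N: "i = iso_class \<Lambda> N" "N \<in> fdm" using i by (rule imageE)
    obtain N' where N': "j = iso_class \<Lambda> N'" "N' \<in> fdm" using j by (rule imageE)
    show "b1 (?Hs #>\<^bsub>free_Abelian_group (iso_class \<Lambda> ` fdm)\<^esub> frag_of i) (?Hs #>\<^bsub>free_Abelian_group (iso_class \<Lambda> ` fdm)\<^esub> frag_of j)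
      = b2 (?Hs #>\<^bsub>free_Abelian_group (iso_class \<Lambda> ` fdm)\<^esub> frag_of i) (?Hs #>\<^bsub>free_Abelian_group (iso_class \<Lambda> ` fdm)\<^esub> frag_of j)"
      unfolding N(1) N'(1) by (rule that(3)[OF N(2) N'(2), unfolded class_split_def free_on_modules_def])
  qed
  have sf: "split_form \<Lambda> x y = b x y" if "x \<in> carrier (K0_split \<Lambda>)" "y \<in> carrier (K0_split \<Lambda>)" for x y
    unfolding split_form_def
  proof (rule the_equality)
    show "\<exists>b'. bilinear_form (K0_split \<Lambda>) b' \<and> (\<forall>N\<in>fdm. \<forall>N'\<in>fdm.
        b' (class_split \<Lambda> N) (class_split \<Lambda> N') = euler_form \<Lambda> N N') \<and> b x y = b' x y"
      using b b_class unfolding K0_split_def by blast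
    fix n assume "\<exists>b'. bilinear_form (K0_split \<Lambda>) b' \<and> (\<forall>N\<in>fdm. \<forall>N'\<in>fdm.
        b' (class_split \<Lambda> N) (class_split \<Lambda> N') = euler_form \<Lambda> N N') \<and> n = b' x y"
    then obtain b' where b': "bilinear_form (K0_split \<Lambda>) b'" "\<forall>N\<in>fdm. \<forall>N'\<in>fdm.
        b' (class_split \<Lambda> N) (class_split \<Lambda> N') = euler_form \<Lambda> N N'" "n = b' x y" by blast
    show "n = b x y"
      unfolding b'(3) by (rule uniq[OF b'(1) b[folded K0_split_def] _ that]) (use b'(2) b_class in simp)
  qed
  have gG: "group ?G" by (simp add: free_on_modules_def)
  interpret s: normal ?Hs ?G by (rule nHs)
  interpret e: normal ?He ?G by (rule nHe)
  \<comment> \<open>Since \<open>?Hs\<close> is contained in \<open>?He\<close>, all elements of a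
    split coset lie in one exact coset, so the image in the definition of \<open>split_to_K0\<close>
    is a singleton.\<close>
  have proj: "split_to_K0 \<Lambda> (?Hs #>\<^bsub>?G\<^esub> a) = ?He #>\<^bsub>?G\<^esub> a" if a: "a \<in> carrier ?G" for a
  proof -
    have "?He #>\<^bsub>?G\<^esub> c = ?He #>\<^bsub>?G\<^esub> a" if "c \<in> ?Hs #>\<^bsub>?G\<^esub> a" for c
    proof -
      have "c \<in> ?He #>\<^bsub>?G\<^esub> a" using that sub unfolding r_coset_def by blast
      then show ?thesis using group.repr_independence[OF gG _ a e.subgroup_axioms] by simp
    qed
    moreover have "a \<in> ?Hs #>\<^bsub>?G\<^esub> a" by (rule group.rcos_self[OF gG a s.subgroup_axioms])
    ultimately have "(\<lambda>c. ?He #>\<^bsub>?G\<^esub> c) ` (?Hs #>\<^bsub>?G\<^esub> a) = {?He #>\<^bsub>?G\<^esub> a}" by blast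
    then show ?thesis by (simp add: split_to_K0_def)
  qed
  \<comment> \<open>Both are bilinear on \<open>K0_split \<Lambda>\<close> and agree on classes of
    modules; uniqueness then makes them equal everywhere.\<close>
  let ?w = "\<lambda>x y. \<omega> (split_to_K0 \<Lambda> x) (split_to_K0 \<Lambda> y)" and ?b = "\<lambda>x y. b x y - b y x"
  have w': "bilinear_form (K0_split \<Lambda>) ?w"
    unfolding bilinear_form_def
  proof (intro ballI)
    fix x y z assume "x \<in> carrier (K0_split \<Lambda>)" "y \<in> carrier (K0_split \<Lambda>)" "z \<in> carrier (K0_split \<Lambda>)"
    then obtain a c d where a: "a \<in> carrier ?G" "x = ?Hs #>\<^bsub>?G\<^esub> a" and c: "c \<in> carrier ?G" "y = ?Hs #>\<^bsub>?G\<^esub> c"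
      and d: "d \<in> carrier ?G" "z = ?Hs #>\<^bsub>?G\<^esub> d"
      unfolding K0_split_def carrier_FactGroup by blast
    have m: "split_to_K0 \<Lambda> (x' \<otimes>\<^bsub>K0_split \<Lambda>\<^esub> y') = split_to_K0 \<Lambda> x' \<otimes>\<^bsub>?G Mod ?He\<^esub> split_to_K0 \<Lambda> y'"
      if "a' \<in> carrier ?G" "c' \<in> carrier ?G" "x' = ?Hs #>\<^bsub>?G\<^esub> a'" "y' = ?Hs #>\<^bsub>?G\<^esub> c'" for a' c' x' y'
      using s.rcos_sum[OF that(1,2)] e.rcos_sum[OF that(1,2)] proj[OF that(1)] proj[OF that(2)]
        proj[OF s.m_closed[OF that(1,2)]] that(3,4) by (simp add: K0_split_def)
    have i: "split_to_K0 \<Lambda> (?Hs #>\<^bsub>?G\<^esub> a') \<in> carrier (?G Mod ?He)" if "a' \<in> carrier ?G" for a'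
      unfolding proj[OF that] carrier_FactGroup using that by blast
    show "?w (x \<otimes>\<^bsub>K0_split \<Lambda>\<^esub> y) z = ?w x z + ?w y z \<and> ?w x (y \<otimes>\<^bsub>K0_split \<Lambda>\<^esub> z) = ?w x y + ?w x z"
      unfolding m[OF a(1) c(1) a(2) c(2)] m[OF c(1) d(1) c(2) d(2)]
      using w i[OF a(1)] i[OF c(1)] i[OF d(1)] unfolding bilinear_form_def a(2) c(2) d(2) by blast
  qed
  have b'': "bilinear_form (K0_split \<Lambda>) ?b"
    using b unfolding bilinear_form_def K0_split_def by simp
  have fc: "frag_of (iso_class \<Lambda> N) \<in> carrier ?G" if "N \<in> fdm" for N
    using that by (simp add: free_on_modules_def)
  have "?w x y = ?b x y" if "x \<in> carrier (K0_split \<Lambda>)" "y \<in> carrier (K0_split \<Lambda>)" for x y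
  proof (rule uniq[OF w' b'' _ that])
    fix N N' assume N: "N \<in> fdm" "N' \<in> fdm"
    have "split_to_K0 \<Lambda> (class_split \<Lambda> M) = class_K0 \<Lambda> M" if "M \<in> fdm" for M
      unfolding class_split_def class_K0_def by (rule proj[OF fc[OF that]])
    then show "?w (class_split \<Lambda> N) (class_split \<Lambda> N') = ?b (class_split \<Lambda> N) (class_split \<Lambda> N')"
      using w_class b_class N by simp
  qed
  then show ?thesis
    using w w_class sf unfolding K0_def split_form_a_def by (intro exI[of _ \<omega>]) simp
qed

end

theorem theorem3p4:
  fixes C :: "('k::alg_closed_field, 'o, 'm::ab_group_add) tri_cat"
    and T :: 'o
    and \<Lambda> :: "('k, 'm) alg"
  assumes "triangulated_category C"
    and "hom_finite C"
    and "two_calabi_yau C"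
    and "idempotents_split C"
    and "cluster_tilting C T"
  defines "\<Lambda> \<equiv> End_alg C T"
  shows "\<exists>\<omega>. bilinear_form (K0 \<Lambda>) \<omega> \<and>
    (\<forall>x\<in>carrier (K0_split \<Lambda>). \<forall>y\<in>carrier (K0_split \<Lambda>).
       \<omega> (split_to_K0 \<Lambda> x) (split_to_K0 \<Lambda> y) = split_form_a \<Lambda> x y) \<and>
    (\<forall>N\<in>fd_modules \<Lambda>. \<forall>N'\<in>fd_modules \<Lambda>.
       \<omega> (class_K0 \<Lambda> N) (class_K0 \<Lambda> N') = euler_form \<Lambda> N N' - euler_form \<Lambda> N' N)"
proof -
  interpret triangulated_category C by fact
  interpret cluster_tilted C T by unfold_locales fact+
  show ?thesis unfolding \<Lambda>_def by (rule antisymmetric_form_descends)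
qed

end
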